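(* Let $X\ne\{0\}$ be a complex Banach space and let $\eta:[0,\infty[\to]0,\infty[$ be a decreasing continuous function such that $\lim_{t\to\infty}t^k\eta(t)=0$ for every $k\in\mathbb N$. For $n\ge1$ let $v_n(x)=\eta(\|x\|)^{1/n}$ and $w_n(x)=\eta(\|x\|/n)$, $x\in X$, and let $V=\{v_n\}_n$, $W=\{w_n\}_n$. If $\eta$ is essential, then $\big(\mathcal PV(^nX)\big)_n$ is an $\infty$-Schauder decomposition of $HV(X)$ if and only if $HV(X)=HW(X)$. In this case, there exist positive constants $a_1,a_2,b_1,b_2,\alpha_1,\alpha_2$ such that $$a_1e^{-b_1t^{\alpha_1}}\le\eta(t)\le a_2e^{-b_2t^{\alpha_2}}\quad\text{for all }t\ge 0.$$
   Context: For a countable family $V$ of weights on $X$ (continuous bounded functions $X\to[0,\infty[$), $HV(X)$ is the space of holomorphic $f:X\to\mathbb C$ with $\|f\|_v:=\sup_{x\in X}v(x)|f(x)|<\infty$ for all $v\in V$, endowed with the Fréchet topology given by these seminorms; similarly $HW(X)$. $\mathcal P(^nX)$ ($n=0,1,2,\dots$) is the space of continuous $n$-homogeneous polynomials on $X$, and $\mathcal PV(^nX)=\mathcal P(^nX)\cap HV(X)$, considered as a Banach space with the norm $\|P\|_v=\sup_{x\in X}|P(x)|\,\eta(\|x\|)$, where $v=v_1$. The associated weight of $\eta$ is $\tilde\eta(t)=1/\sup\{|g(t)|: g\in H(\mathbb C),\ |g(z)|\le 1/\eta(|z|)\ \text{for all }z\in\mathbb C\}$; $\eta$ is essential if there is a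 constant $C$ with $\tilde\eta\le C\eta$. A sequence $(F_n)_n$ of subspaces of a Fréchet space $F$ is a Schauder decomposition of $F$ if each $x\in F$ can be written in a unique way as a convergent series $x=\sum_n x_n$ with $x_n\in F_n$, and the projections $x\mapsto\sum_{n\le m}x_n$ are continuous. A Schauder decomposition by Banach spaces $(F_n,\|\cdot\|)$ is an $\infty$-Schauder decomposition if, for every sequence $(x_n)_n$ with $x_n\in F_n$, the series $\sum_n x_n$ converges in $F$ if and only if $\lim_n\|x_n\|^{1/n}=0$. *)

theory Defs
  imports "HOL-Analysis.Analysis" "HOL-Library.Function_Algebras"
begin

class complex_banach = banach +
  fixes scaleC :: "complex \<Rightarrow> 'a \<Rightarrow> 'a"
  assumes scaleC_add_right: "scaleC c (x + y) = scaleC c x + scaleC c y"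
    and scaleC_add_left: "scaleC (c + d) x = scaleC c x + scaleC d x"
    and scaleC_scaleC: "scaleC c (scaleC d x) = scaleC (c * d) x"
    and scaleC_of_real: "scaleC (complex_of_real r) x = scaleR r x"
    and norm_scaleC: "norm (scaleC c x) = cmod c * norm x"

text \<open>Holomorphic on the whole space: Frechet differentiable everywhere, with complex linear
  derivative.\<close>

definition entire_on_banach :: "('a::complex_banach \<Rightarrow> complex) \<Rightarrow> bool" where
  "entire_on_banach f \<longleftrightarrow>
     (\<forall>x. \<exists>D. (f has_derivative D) (at x) \<and> Vector_Spaces.linear scaleC (*) D)"

text \<open>An \<open>n\<close>-linear form is encoded as a function of a sequence which depends only on the
  entries with index below \<open>n\<close>.\<close>

definition n_linear_form :: "nat \<Rightarrow> ((nat \<Rightarrow> 'a::complex_banach) \<Rightarrow> complex) \<Rightarrow> bool" where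
  "n_linear_form n A \<longleftrightarrow>
     (\<forall>x y. (\<forall>i<n. x i = y i) \<longrightarrow> A x = A y) \<and>
     (\<forall>i<n. \<forall>x. Vector_Spaces.linear scaleC (*) (\<lambda>u. A (x(i := u))))"

definition continuous_homogeneous_polys :: "nat \<Rightarrow> ('a::complex_banach \<Rightarrow> complex) set" where
  "continuous_homogeneous_polys n =
     {P. (\<exists>A. n_linear_form n A \<and> (\<forall>x. P x = A (\<lambda>_. x))) \<and> continuous_on UNIV P}"


definition weighted_sup :: "('a \<Rightarrow> real) \<Rightarrow> ('a \<Rightarrow> complex) \<Rightarrow> real" where
  "weighted_sup v f = (SUP x. v x * cmod (f x))"

definition weighted_space :: "('a::complex_banach \<Rightarrow> real) set \<Rightarrow> ('a \<Rightarrow> complex) set" where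
  "weighted_space V =
     {f. entire_on_banach f \<and> (\<forall>v\<in>V. bdd_above (range (\<lambda>x. v x * cmod (f x))))}"

text \<open>The topology on \<^term>\<open>weighted_space V\<close> given by the seminorms \<^term>\<open>weighted_sup v\<close>:
  the open seminorm balls around arbitrary centres form a subbase. For nonempty \<open>V\<close> its
  \<^const>\<open>topspace\<close> is \<^term>\<open>weighted_space V\<close>.\<close>

definition weighted_topology :: "('a::complex_banach \<Rightarrow> real) set \<Rightarrow> ('a \<Rightarrow> complex) topology" where
  "weighted_topology V = topology_generated_by
     {{g \<in> weighted_space V. weighted_sup v (g - f) < e} | v f e.
        v \<in> V \<and> f \<in> weighted_space V \<and> 0 < e}"

definition weighted_polys ::
    "('a::complex_banach \<Rightarrow> real) set \<Rightarrow> nat \<Rightarrow> ('a \<Rightarrow> complex) set" where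
  "weighted_polys V n = continuous_homogeneous_polys n \<inter> weighted_space V"


definition series_converges_to ::
    "('b::ab_group_add) topology \<Rightarrow> (nat \<Rightarrow> 'b) \<Rightarrow> 'b \<Rightarrow> bool" where
  "series_converges_to T y x \<longleftrightarrow> limitin T (\<lambda>m. \<Sum>n<m. y n) x sequentially"

definition fun_scale :: "complex \<Rightarrow> ('a \<Rightarrow> complex) \<Rightarrow> 'a \<Rightarrow> complex" where
  "fun_scale c f = (\<lambda>x. c * f x)"

definition is_expansion ::
    "('b::ab_group_add) topology \<Rightarrow> (nat \<Rightarrow> 'b set) \<Rightarrow> 'b \<Rightarrow> (nat \<Rightarrow> 'b) \<Rightarrow> bool" where
  "is_expansion T F x y \<longleftrightarrow> (\<forall>n. y n \<in> F n) \<and> series_converges_to T y x"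

text \<open>\<open>T\<close> is a vector space topology on its carrier \<^term>\<open>topspace T\<close>, a space of
  complex-valued functions.\<close>

definition schauder_decomposition ::
    "('a \<Rightarrow> complex) topology \<Rightarrow> (nat \<Rightarrow> ('a \<Rightarrow> complex) set) \<Rightarrow> bool" where
  "schauder_decomposition T F \<longleftrightarrow>
     (\<forall>n. F n \<subseteq> topspace T \<and> module.subspace fun_scale (F n)) \<and>
     (\<forall>x\<in>topspace T. \<exists>!y. is_expansion T F x y) \<and>
     (\<forall>m. continuous_map T T (\<lambda>x. \<Sum>n\<le>m. (THE y. is_expansion T F x y) n))"

definition banach_space_with_norm ::
    "('a \<Rightarrow> complex) set \<Rightarrow> (('a \<Rightarrow> complex) \<Rightarrow> real) \<Rightarrow> bool" where
  "banach_space_with_norm S N \<longleftrightarrow>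
     module.subspace fun_scale S \<and>
     (\<forall>f\<in>S. 0 \<le> N f \<and> (N f = 0 \<longleftrightarrow> f = 0)) \<and>
     (\<forall>f\<in>S. \<forall>g\<in>S. N (f + g) \<le> N f + N g) \<and>
     (\<forall>f\<in>S. \<forall>c. N (fun_scale c f) = cmod c * N f) \<and>
     (\<forall>s. (\<forall>k. s k \<in> S) \<and> (\<forall>e>0. \<exists>K. \<forall>j\<ge>K. \<forall>k\<ge>K. N (s j - s k) < e) \<longrightarrow>
        (\<exists>f\<in>S. (\<lambda>k. N (s k - f)) \<longlonglongrightarrow> 0))"

definition infinity_schauder_decomposition ::
    "('a \<Rightarrow> complex) topology \<Rightarrow> (nat \<Rightarrow> ('a \<Rightarrow> complex) set) \<Rightarrow>
     (nat \<Rightarrow> ('a \<Rightarrow> complex) \<Rightarrow> real) \<Rightarrow> bool" where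
  "infinity_schauder_decomposition T F N \<longleftrightarrow>
     schauder_decomposition T F \<and>
     (\<forall>n. banach_space_with_norm (F n) (N n)) \<and>
     (\<forall>y. (\<forall>n. y n \<in> F n) \<longrightarrow>
        ((\<exists>x. series_converges_to T y x) \<longleftrightarrow> (\<lambda>n. root n (N n (y n))) \<longlonglongrightarrow> 0))"


definition associated_weight :: "(real \<Rightarrow> real) \<Rightarrow> real \<Rightarrow> real" where
  "associated_weight \<eta> t =
     1 / Sup {cmod (g (complex_of_real t)) | g.
                g holomorphic_on UNIV \<and> (\<forall>z. cmod (g z) \<le> 1 / \<eta> (cmod z))}"

definition essential :: "(real \<Rightarrow> real) \<Rightarrow> bool" where
  "essential \<eta> \<longleftrightarrow> (\<exists>C. \<forall>t\<ge>0. associated_weight \<eta> t \<le> C * \<eta> t)"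

definition root_weights :: "(real \<Rightarrow> real) \<Rightarrow> ('a::real_normed_vector \<Rightarrow> real) set" where
  "root_weights \<eta> = {(\<lambda>x. root n (\<eta> (norm x))) | n. 1 \<le> n}"

definition dilated_weights :: "(real \<Rightarrow> real) \<Rightarrow> ('a::real_normed_vector \<Rightarrow> real) set" where
  "dilated_weights \<eta> = {(\<lambda>x. \<eta> (norm x / real n)) | n. 1 \<le> n}"

end

theory Submission
  imports Defs "HOL-Complex_Analysis.Complex_Analysis"
begin

text \<open>
  Let \<open>P\<^sub>n\<close> be the homogeneous Taylor parts of \<open>f\<close>. By homogeneity and Cauchy's estimates,
  \<open>\<parallel>P\<^sub>n\<parallel>\<^bsup>1/n\<^esup> \<rightarrow> 0\<close> holds if and only if \<open>\<Sum> P\<^sub>n\<close> defines an element of \<open>HW(X)\<close>, with tails that are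
  geometrically small against every \<open>w\<^sub>m\<close>. Hence the decomposition is an \<open>\<infinity>\<close>-Schauder decomposition
  when \<open>HV(X) = HW(X)\<close> and every \<open>v\<^sub>n\<close> is dominated by a multiple of some \<open>w\<^sub>m\<close>; the converse is
  immediate.

  The domination of weights comes from the set equality by a gliding hump: if it failed, a series
  \<open>\<Sum> 2\<^sup>-\<^sup>j c\<^sub>j l\<^bsup>k\<^sub>j\<^esup>\<close> in a norming functional \<open>l\<close> would lie in one space but not in the other. The
  monomials exist because \<open>\<eta>\<close> is essential. The two inclusions give, for \<open>\<phi> = - ln \<eta>\<close>,
  the inequalities \<open>\<phi>(t/m) \<le> \<phi>(t)/2 + C\<close> and \<open>\<phi>(t) \<le> m \<phi>(t/2) + C\<close>, whose iteration yields the
  growth bounds.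
\<close>

section \<open>Entire functions on a complex Banach space\<close>

text \<open>The equality with HW(X) is one of sets, whereas convergence in the decomposition is
  measured by the seminorms of \<open>V\<close>. This gap shapes the proof: domination of the
  weights is what carries geometric tail estimates from \<open>W\<close> over to \<open>V\<close>.
  Dilations enter through homogeneity: replacing \<eta>(t) by \<eta>(t/m) multiplies the norm of an
  n-homogeneous polynomial by m^n, so being summable against all dilations means beating every m^n,
  that is, n-th roots tending to 0. In the gliding hump the j-th monomial is bounded, uniformly in
  j, against all weights of index at most j, yet reaches 4^j somewhere against the offending weight.
  The factor 2^-j yields convergence and leaves peaks of height 2^j; nonnegative coefficients
  exclude cancellation along a ray on which \<open>l\<close> is real. Limits of entire functions are
  taken through the characterisation as Gateaux holomorphic and locally bounded, since both
  properties survive locally uniform limits without any control of Frechet derivatives.\<close>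

lemma scaleC_one: "scaleC 1 (x::'a::complex_banach) = x"
  using scaleC_of_real[of 1 x] by simp

interpretation scaleC: vector_space "scaleC :: complex \<Rightarrow> 'a \<Rightarrow> 'a::complex_banach"
  by unfold_locales (simp_all add: scaleC_add_left scaleC_add_right scaleC_scaleC scaleC_one)

lemma clinear_iff:
  "Vector_Spaces.linear scaleC (*) (D :: 'a::complex_banach \<Rightarrow> complex) \<longleftrightarrow>
     (\<forall>x y. D (x + y) = D x + D y) \<and> (\<forall>c x. D (scaleC c x) = c * D x)"
  by (simp add: Vector_Spaces.linear_iff scaleC.vector_space_axioms vector_space_over_itself.vector_space_axioms)

section \<open>Taylor coefficients of entire functions of one variable\<close>

definition taylor_coeff :: "(complex \<Rightarrow> complex) \<Rightarrow> nat \<Rightarrow> complex" where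
  "taylor_coeff g k = (deriv ^^ k) g 0 / fact k"

lemma taylor_coeff_sums:
  assumes "g holomorphic_on UNIV"
  shows "(\<lambda>k. taylor_coeff g k * z ^ k) sums g z"
proof -
  have "(\<lambda>k. (deriv ^^ k) g 0 / fact k * (z - 0) ^ k) sums g z"
    by (rule holomorphic_power_series[where r = "cmod z + 1"])
      (use assms holomorphic_on_subset in \<open>auto simp: dist_norm\<close>)
  then show ?thesis by (simp add: taylor_coeff_def)
qed

lemma taylor_coeff_bound:
  assumes "g holomorphic_on UNIV" "0 < r" "\<And>w. cmod w = r \<Longrightarrow> cmod (g w) \<le> M"
  shows "cmod (taylor_coeff g k) * r ^ k \<le> M"
proof -
  have "cmod ((deriv ^^ k) g 0) \<le> fact k * M / r ^ k"
    using assms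
    by (intro Cauchy_inequality) (auto intro: holomorphic_on_subset holomorphic_on_imp_continuous_on)
  then show ?thesis using assms(2)
    by (simp add: taylor_coeff_def norm_divide field_simps)
qed

lemma taylor_coeff_0: "taylor_coeff g 0 = g 0" and taylor_coeff_1: "taylor_coeff g (Suc 0) = deriv g 0"
  by (simp_all add: taylor_coeff_def)

text \<open>Convergence at every z makes the convergence radius infinite, so the formal series is
  the expansion of \<open>g\<close> at 0 and its coefficients are given by the derivatives of
  \<open>g\<close>.\<close>

lemma taylor_coeff_unique:
  assumes "\<And>z. (\<lambda>k. a k * z ^ k) sums g z"
  shows "taylor_coeff g k = a k"
proof -
  have "fps_conv_radius (Abs_fps a) \<ge> \<infinity>"
    unfolding fps_conv_radius_def
    by (rule conv_radius_geI_ex') (use assms sums_summable in auto)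
  then have "g has_fps_expansion (Abs_fps a)"
    unfolding has_fps_expansion_def eval_fps_def
    using assms by (auto simp: sums_iff)
  from fps_nth_fps_expansion[OF this, of k] show ?thesis by (simp add: taylor_coeff_def)
qed

text \<open>Cauchy's estimate on the unit circle bounds every coefficient by M, so the tail is
  dominated by a geometric series; the restriction on z makes 1 / (1 - |z|) at most 2.\<close>

lemma taylor_remainder_bound:
  assumes "g holomorphic_on UNIV" "\<And>w. cmod w \<le> 1 \<Longrightarrow> cmod (g w) \<le> M" "cmod z \<le> 1/2"
  shows "cmod (g z - (\<Sum>k<n. taylor_coeff g k * z ^ k)) \<le> 2 * M * cmod z ^ n"
proof -
  have M: "cmod (taylor_coeff g k) \<le> M" for k
    using taylor_coeff_bound[OF assms(1), of 1 M k] assms(2) by simp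
  then have M0: "0 \<le> M" by (meson norm_ge_zero order_trans)
  have 1: "(\<lambda>k. taylor_coeff g (k + n) * z ^ (k + n)) sums (g z - (\<Sum>k<n. taylor_coeff g k * z ^ k))"
    by (rule sums_split_initial_segment[OF taylor_coeff_sums[OF assms(1)]])
  have 2: "(\<lambda>k. M * cmod z ^ n * cmod z ^ k) sums (M * cmod z ^ n * (1 / (1 - cmod z)))"
    by (intro sums_mult geometric_sums) (use assms(3) in auto)
  have "cmod (g z - (\<Sum>k<n. taylor_coeff g k * z ^ k)) \<le> M * cmod z ^ n * (1 / (1 - cmod z))"
  proof (rule norm_sums_le[OF 1 2])
    fix k show "cmod (taylor_coeff g (k + n) * z ^ (k + n)) \<le> M * cmod z ^ n * cmod z ^ k"
      using mult_right_mono[OF M[of "k+n"], of "cmod z ^ (k+n)"]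
      by (simp add: norm_mult norm_power power_add mult_ac)
  qed
  also have "\<dots> \<le> M * cmod z ^ n * 2"
    using assms(3) M0 by (intro mult_left_mono) (auto simp: field_simps)
  finally show ?thesis by (simp add: mult_ac)
qed

section \<open>Gateaux holomorphy, directional derivatives and Frechet differentiability\<close>

definition gateaux_entire :: "('a::complex_banach \<Rightarrow> complex) \<Rightarrow> bool" where
  "gateaux_entire f \<longleftrightarrow> (\<forall>x y. (\<lambda>z. f (x + scaleC z y)) holomorphic_on UNIV)"

definition locally_bounded :: "('a::real_normed_vector \<Rightarrow> complex) \<Rightarrow> bool" where
  "locally_bounded f \<longleftrightarrow> (\<forall>x. \<exists>r>0. \<exists>M. \<forall>y. norm (y - x) \<le> r \<longrightarrow> cmod (f y) \<le> M)"

definition ddir :: "'a::complex_banach \<Rightarrow> ('a \<Rightarrow> complex) \<Rightarrow> 'a \<Rightarrow> complex" where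
  "ddir y f x = deriv (\<lambda>z. f (x + scaleC z y)) 0"

lemma gateaux_entireD: "gateaux_entire f \<Longrightarrow> (\<lambda>z. f (x + scaleC z y)) holomorphic_on UNIV"
  by (simp add: gateaux_entire_def)

lemma ddir_bound:
  assumes "gateaux_entire f" "\<And>w. cmod w = 1 \<Longrightarrow> cmod (f (x + scaleC w y)) \<le> M"
  shows "cmod (ddir y f x) \<le> M"
  using taylor_coeff_bound[OF gateaux_entireD[OF assms(1)], of 1 x y M "Suc 0"] assms(2)
  by (simp add: ddir_def taylor_coeff_1)

lemma ddir_has_field_derivative:
  assumes "gateaux_entire f"
  shows "((\<lambda>z. f (x + scaleC z y)) has_field_derivative ddir y f x) (at 0)"
  unfolding ddir_def by (rule holomorphic_derivI[OF gateaux_entireD[OF assms]]) auto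

lemma ddir_scaleC:
  assumes "gateaux_entire f"
  shows "ddir (scaleC c y) f x = c * ddir y f x"
proof -
  have "((\<lambda>z. f (x + scaleC z y)) \<circ> (\<lambda>z. z * c) has_field_derivative ddir y f x * c) (at 0)"
    by (rule DERIV_chain) (auto intro!: ddir_has_field_derivative assms derivative_eq_intros)
  then have "((\<lambda>z. f (x + scaleC z (scaleC c y))) has_field_derivative c * ddir y f x) (at 0)"
    by (simp add: o_def scaleC_scaleC mult.commute)
  then show ?thesis by (simp add: ddir_def DERIV_imp_deriv)
qed

lemma ddir_remainder:
  assumes "gateaux_entire f" "\<And>w. cmod w \<le> 1 \<Longrightarrow> cmod (f (x + scaleC w y)) \<le> M" "cmod z \<le> 1/2"
  shows "cmod (f (x + scaleC z y) - f x - z * ddir y f x) \<le> 2 * M * (cmod z)\<^sup>2"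
    and "cmod (f (x + scaleC z y) - f x) \<le> 2 * M * cmod z"
  using taylor_remainder_bound[OF gateaux_entireD[OF assms(1)], of x y M z 2]
    taylor_remainder_bound[OF gateaux_entireD[OF assms(1)], of x y M z 1] assms(2,3)
  by (simp_all add: ddir_def taylor_coeff_0 taylor_coeff_1 numeral_2_eq_2 algebra_simps)

lemma gateaux_entire_shift:
  assumes "gateaux_entire f"
  shows "gateaux_entire (\<lambda>x. f (x + a))"
  using gateaux_entireD[OF assms, of "_ + a"] unfolding gateaux_entire_def
  by (simp add: add_ac)

lemma gateaux_entire_diff:
  "gateaux_entire f \<Longrightarrow> gateaux_entire g \<Longrightarrow> gateaux_entire (\<lambda>x. f x - g x)"
  by (auto simp: gateaux_entire_def intro!: holomorphic_intros)

lemma ddir_diff: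
  assumes "gateaux_entire f" "gateaux_entire g"
  shows "ddir y (\<lambda>x. f x - g x) x = ddir y f x - ddir y g x"
  using DERIV_imp_deriv[OF DERIV_diff[OF ddir_has_field_derivative[OF assms(1), of x y] ddir_has_field_derivative[OF assms(2), of x y]]]
  by (simp add: ddir_def[of y "\<lambda>x. f x - g x"])

lemma ddir_shift: "ddir y (\<lambda>x. f (x + a)) x = ddir y f (x + a)"
  by (simp add: ddir_def add_ac)

text \<open>Comparing the increments along \<open>t(y+z)\<close>, \<open>ty\<close> and then \<open>tz\<close> to first order.\<close>

lemma ddir_add_small:
  fixes f :: "'a::complex_banach \<Rightarrow> complex"
  assumes f: "gateaux_entire f" and M: "\<And>h. norm (h - x) \<le> r \<Longrightarrow> cmod (f h) \<le> M"
    and r: "norm y + norm z \<le> r / 2"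
  shows "ddir (y + z) f x = ddir y f x + ddir z f x"
proof -
  have r0: "0 \<le> r" using r by (smt (verit) norm_ge_zero field_sum_of_halves)
  have bnd: "cmod (f (x + a)) \<le> M" if "norm a \<le> r" for a using M that by simp
  have M0: "0 \<le> M" using bnd[of 0] r0 norm_ge_zero[of "f (x+0)"] by (smt (verit) norm_zero)
  have small: "norm (scaleC w u) \<le> norm u" if "cmod w \<le> 1" for w and u :: 'a
    using that by (simp add: norm_scaleC mult_left_le_one_le)
  \<comment> \<open>The remainders \<open>1\<close>, \<open>2\<close>, \<open>3\<close> and the
    change of base point in \<open>4\<close> contribute 2 M t^2 each. After division by t at most 8
    M t is left, which is rounded up to 10 M t and tends to 0.\<close>
  have key: "cmod (ddir (y + z) f x - ddir y f x - ddir z f x) \<le> 10 * M * t" if t: "0 < t" "t \<le> 1/2" for t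
  proof -
    let ?t = "complex_of_real t"
    have nt: "cmod ?t = t" using t by simp
    have 1: "cmod (f (x + scaleC ?t (y+z)) - f x - ?t * ddir (y+z) f x) \<le> 2 * M * t\<^sup>2"
      using ddir_remainder(1)[OF f, of x "y+z" M ?t] t nt bnd
        small norm_triangle_ineq[of y z] r r0 by (smt (verit) field_sum_of_halves)
    have 2: "cmod (f (x + scaleC ?t y) - f x - ?t * ddir y f x) \<le> 2 * M * t\<^sup>2"
      using ddir_remainder(1)[OF f, of x y M ?t] t nt bnd
        small r r0 norm_ge_zero[of z] by (smt (verit) field_sum_of_halves)
    have 3: "cmod (f ((x + scaleC ?t y) + scaleC ?t z) - f (x + scaleC ?t y) - ?t * ddir z f (x + scaleC ?t y)) \<le> 2 * M * t\<^sup>2"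
    proof (rule order_trans[OF ddir_remainder(1)[OF f, of "x + scaleC ?t y" z M ?t]])
      fix w assume "cmod w \<le> 1"
      then have "norm (scaleC ?t y + scaleC w z) \<le> norm y + norm z"
        using small[of ?t y] small[of w z] t nt norm_triangle_ineq[of "scaleC ?t y" "scaleC w z"] by simp
      then show "cmod (f (x + scaleC ?t y + scaleC w z)) \<le> M"
        using bnd[of "scaleC ?t y + scaleC w z"] r r0 by (simp add: add.assoc)
    qed (use t nt in auto)
    \<comment> \<open>Moving the base point by ty changes the derivative in direction z by O(t): the
      difference is the derivative of u |-> f(u + ty) - f(u), which is O(t) on the relevant circle,
      and Cauchy's estimate applies.\<close>
    have 4: "cmod (ddir z f (x + scaleC ?t y) - ddir z f x) \<le> 2 * M * t"
    proof -
      have "ddir z f (x + scaleC ?t y) - ddir z f x = ddir z (\<lambda>u. f (u + scaleC ?t y) - f u) x"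
        using f by (simp add: ddir_diff gateaux_entire_shift ddir_shift)
      also have "cmod \<dots> \<le> 2 * M * t"
      proof (rule ddir_bound)
        fix w assume w: "cmod w = 1"
        have "cmod (f ((x + scaleC w z) + scaleC ?t y) - f (x + scaleC w z)) \<le> 2 * M * cmod ?t"
        proof (rule ddir_remainder(2)[OF f])
          fix w' assume "cmod w' \<le> 1"
          then have "norm (scaleC w z + scaleC w' y) \<le> norm z + norm y"
            using small[of w z] small[of w' y] w norm_triangle_ineq[of "scaleC w z" "scaleC w' y"] by simp
          then show "cmod (f (x + scaleC w z + scaleC w' y)) \<le> M"
            using bnd[of "scaleC w z + scaleC w' y"] r r0 by (simp add: add.assoc)
        qed (use t in auto)
        then show "cmod (f (x + scaleC w z + scaleC ?t y) - f (x + scaleC w z)) \<le> 2 * M * t" using nt by simp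
      qed (intro gateaux_entire_diff gateaux_entire_shift f)
      finally show ?thesis .
    qed
    have "t * cmod (ddir (y + z) f x - ddir y f x - ddir z f x)
       = cmod (?t * (ddir (y + z) f x - ddir y f x - ddir z f x))" using nt by (simp add: norm_mult)
    also have "?t * (ddir (y + z) f x - ddir y f x - ddir z f x) =
       - (f (x + scaleC ?t (y+z)) - f x - ?t * ddir (y+z) f x)
       + (f (x + scaleC ?t y) - f x - ?t * ddir y f x)
       + (f ((x + scaleC ?t y) + scaleC ?t z) - f (x + scaleC ?t y) - ?t * ddir z f (x + scaleC ?t y))
       + ?t * (ddir z f (x + scaleC ?t y) - ddir z f x)"
      by (simp add: scaleC_add_right algebra_simps)
    also have "cmod \<dots> \<le> 2 * M * t\<^sup>2 + 2 * M * t\<^sup>2 + 2 * M * t\<^sup>2 + t * (2 * M * t)"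
      using 1 2 3 4 t by (intro norm_triangle_le add_mono) (auto simp: norm_mult norm_minus_commute intro!: mult_mono)
    also have "\<dots> \<le> t * (10 * M * t)" using M0 t by (simp add: power2_eq_square mult_ac)
    finally show ?thesis using t by simp
  qed
  have "((\<lambda>t. 10 * M * t) \<longlongrightarrow> 10 * M * 0) (at_right 0)" by (intro tendsto_intros)
  moreover have "\<forall>\<^sub>F t in at_right 0. cmod (ddir (y + z) f x - ddir y f x - ddir z f x) \<le> 10 * M * t"
    by (rule eventually_mono[OF eventually_at_right_real[of 0 "1/2"]]) (auto intro!: key)
  ultimately have "cmod (ddir (y + z) f x - ddir y f x - ddir z f x) \<le> 0"
    using tendsto_lowerbound by (metis mult_zero_right trivial_limit_at_right_real)
  then show ?thesis by (simp add: algebra_simps)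
qed

text \<open>Homogeneity of the directional derivative reduces additivity to directions so short that
  f is bounded on the whole region involved.\<close>

lemma ddir_add:
  assumes f: "gateaux_entire f" "locally_bounded f"
  shows "ddir (y + z) f x = ddir y f x + ddir z f x"
proof -
  obtain r M where r: "r > 0" "\<And>h. norm (h - x) \<le> r \<Longrightarrow> cmod (f h) \<le> M"
    using f(2) unfolding locally_bounded_def by meson
  \<comment> \<open>The summand 1 keeps the denominator positive when y = z = 0.\<close>
  define c where "c = complex_of_real (r / (2 * (norm y + norm z + 1)))"
  have n: "norm y + norm z + 1 > 0" by (smt (verit) norm_ge_zero)
  have c: "c \<noteq> 0" using r(1) n by (simp add: c_def del: of_real_divide of_real_mult)
  have nc: "cmod c = r / (2 * (norm y + norm z + 1))" using r(1) n unfolding c_def norm_of_real by simp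
  have "norm (scaleC c y) + norm (scaleC c z) \<le> r / 2"
    using r(1) n by (simp add: norm_scaleC nc divide_simps) (simp add: algebra_simps)
  then have "ddir (scaleC c y + scaleC c z) f x = ddir (scaleC c y) f x + ddir (scaleC c z) f x"
    using ddir_add_small[OF f(1) r(2)] by blast
  then have "c * ddir (y + z) f x = c * (ddir y f x + ddir z f x)"
    using ddir_scaleC[OF f(1)] by (simp flip: scaleC_add_right add: distrib_left)
  then show ?thesis using c by simp
qed

text \<open>From right to left, the candidate derivative is y |-> \<open>ddir y f x\<close>: linear
  by \<open>ddir_add\<close> and \<open>ddir_scaleC\<close>, bounded by Cauchy's estimate on a ball
  where f is bounded, and with a quadratic remainder that is uniform in the direction.\<close>

lemma entire_on_banach_iff:
  fixes f :: "'a::complex_banach \<Rightarrow> complex"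
  shows "entire_on_banach f \<longleftrightarrow> gateaux_entire f \<and> locally_bounded f"
proof safe
  assume f: "entire_on_banach f"
  show "gateaux_entire f" unfolding gateaux_entire_def
  proof (intro allI)
    fix x y :: 'a
    show "(\<lambda>z. f (x + scaleC z y)) holomorphic_on UNIV" unfolding holomorphic_on_def
    proof
      fix z
      obtain D where D: "(f has_derivative D) (at (x + scaleC z y))" "Vector_Spaces.linear scaleC (*) D"
        using f unfolding entire_on_banach_def by meson
      have bl: "bounded_linear (\<lambda>z. scaleC z y)"
      proof (rule bounded_linear_intro[where K = "norm y"])
        show "scaleC (r *\<^sub>R c) y = r *\<^sub>R scaleC c y" for r c
          by (simp add: scaleR_conv_of_real[of r c] flip: scaleC_of_real)
      qed (simp_all add: scaleC_add_left norm_scaleC)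
      have "((\<lambda>z. x + scaleC z y) has_derivative (\<lambda>z. scaleC z y)) (at z)"
        using has_derivative_add[OF has_derivative_const bounded_linear_imp_has_derivative[OF bl]] by simp
      from diff_chain_at[OF this D(1)] D(2)
      have "((\<lambda>z. f (x + scaleC z y)) has_derivative (\<lambda>z. D y * z)) (at z)"
        by (simp add: o_def clinear_iff mult.commute)
      then have "((\<lambda>z. f (x + scaleC z y)) has_field_derivative D y) (at z)"
        by (simp add: has_field_derivative_def)
      then show "(\<lambda>z. f (x + scaleC z y)) field_differentiable at z within UNIV"
        unfolding field_differentiable_def by blast
    qed
  qed
  show "locally_bounded f" unfolding locally_bounded_def
  proof
    fix x
    obtain D where D: "(f has_derivative D) (at x)"
      using f unfolding entire_on_banach_def by meson
    then have "isCont f x" using has_derivative_continuous by blast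
    then obtain d where d: "d > 0" "\<And>y. dist y x < d \<Longrightarrow> dist (f y) (f x) < 1"
      unfolding continuous_at_eps_delta using zero_less_one by blast
    have "cmod (f y) \<le> cmod (f x) + 1" if "norm (y - x) \<le> d / 2" for y
      using d(2)[of y] d(1) that norm_triangle_sub[of "f y" "f x"] by (simp add: dist_norm)
    then show "\<exists>r>0. \<exists>M. \<forall>y. norm (y - x) \<le> r \<longrightarrow> cmod (f y) \<le> M"
      using d(1) half_gt_zero by blast
  qed
next
  assume f: "gateaux_entire f" "locally_bounded f"
  show "entire_on_banach f" unfolding entire_on_banach_def
  proof (intro allI exI conjI)
    fix x
    let ?D = "\<lambda>y. ddir y f x"
    show lin: "Vector_Spaces.linear scaleC (*) ?D"
      using ddir_add[OF f] ddir_scaleC[OF f(1)] by (simp add: clinear_iff)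
    obtain r M where r: "r > 0" "\<And>h. norm (h - x) \<le> r \<Longrightarrow> cmod (f h) \<le> M"
      using f(2) unfolding locally_bounded_def by meson
    have M0: "0 \<le> M" using r(2)[of x] r(1) norm_ge_zero[of "f x"] by (smt (verit) norm_zero diff_self)
    \<comment> \<open>Writing an increment as a scalar multiple of a vector of norm at most r turns
      the one-variable estimates on the unit disc into estimates in terms of \<open>norm h\<close>,
      with the same bound M for all directions.\<close>
    have ex: "\<exists>z y. h = scaleC z y \<and> cmod z = norm h / r \<and> norm y \<le> r" for h
    proof (cases "h = 0")
      case True then show ?thesis using r(1) by (intro exI[of _ 0] exI[of _ h]) auto
    next
      case False
      then show ?thesis using r(1)
        by (intro exI[of _ "of_real (norm h / r)"] exI[of _ "scaleC (of_real (r / norm h)) h"])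
          (simp add: scaleC_of_real norm_scaleC norm_divide)
    qed
    have bd: "cmod (f (x + scaleC w y)) \<le> M" if "cmod w \<le> 1" "norm y \<le> r" for w y
      using r(2)[of "x + scaleC w y"] mult_left_le_one_le[of "norm y" "cmod w"] that by (simp add: norm_scaleC)
    have Db: "cmod (?D h) \<le> norm h * (M / r)" for h
    proof -
      obtain z y where zy: "h = scaleC z y" "cmod z = norm h / r" "norm y \<le> r" using ex by blast
      then have "cmod (?D h) = cmod z * cmod (?D y)" by (simp add: ddir_scaleC[OF f(1)] norm_mult)
      also have "\<dots> \<le> cmod z * M" using bd zy r(1) by (intro mult_left_mono ddir_bound[OF f(1)]) auto
      finally show ?thesis using zy by simp
    qed
    show "(f has_derivative ?D) (at x)"
    proof (rule has_derivativeI)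
      show "bounded_linear ?D"
      proof (rule bounded_linear_intro[OF _ _ Db])
        show "?D (r *\<^sub>R y) = r *\<^sub>R ?D y" for r y
          using ddir_scaleC[OF f(1), of "of_real r" y x] by (simp add: scaleC_of_real scaleR_conv_of_real)
      qed (use ddir_add[OF f] in auto)
      show "((\<lambda>y. (f y - f x - ?D (y - x)) /\<^sub>R norm (y - x)) \<longlongrightarrow> 0) (at x)"
      proof (rule Lim_null_comparison)
        have "((\<lambda>y. 2 * M / r\<^sup>2 * norm (y - x)) \<longlongrightarrow> 2 * M / r\<^sup>2 * norm (x - x)) (at x)"
          by (intro tendsto_intros)
        then show "((\<lambda>y. 2 * M / r\<^sup>2 * norm (y - x)) \<longlongrightarrow> 0) (at x)" by simp
        have "\<forall>\<^sub>F y in at x. dist y x < r / 2"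
          unfolding eventually_at using r(1) half_gt_zero by blast
        then show "\<forall>\<^sub>F y in at x. norm ((f y - f x - ?D (y - x)) /\<^sub>R norm (y - x)) \<le> 2 * M / r\<^sup>2 * norm (y - x)"
        proof eventually_elim
          case (elim y)
          obtain z u where zu: "y - x = scaleC z u" "cmod z = norm (y - x) / r" "norm u \<le> r" using ex by blast
          have z2: "cmod z \<le> 1/2" using elim r(1) unfolding zu(2) dist_norm by (simp add: pos_divide_le_eq)
          have "y = x + scaleC z u" using zu(1) by (simp add: algebra_simps)
          then have "cmod (f y - f x - ?D (y - x)) \<le> 2 * M * (cmod z)\<^sup>2"
            using ddir_remainder(1)[OF f(1) bd z2, of u] zu by (simp add: ddir_scaleC[OF f(1)])
          also have "\<dots> = 2 * M * (norm (y - x))\<^sup>2 / r\<^sup>2" using zu by (simp add: power_divide)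
          finally have "cmod (f y - f x - ?D (y - x)) \<le> 2 * M / r\<^sup>2 * norm (y - x) * norm (y - x)"
            by (simp add: power2_eq_square)
          moreover have "norm ((f y - f x - ?D (y - x)) /\<^sub>R norm (y - x)) = cmod (f y - f x - ?D (y - x)) / norm (y - x)"
            by (simp add: divide_inverse mult.commute)
          ultimately show ?case
            using pos_divide_le_eq[of "norm (y - x)" "cmod (f y - f x - ?D (y - x))" "2 * M / r\<^sup>2 * norm (y - x)"]
            by (cases "y = x") simp_all
        qed
      qed
    qed
  qed
qed

text \<open>Each half of \<open>entire_on_banach_iff\<close> passes to the limit: Weierstrass'
  theorem on complex lines, and a local bound inherited from a single F n that is within 1 of
  f.\<close>

lemma entire_on_banach_locally_uniform_limit:
  fixes f :: "'a::complex_banach \<Rightarrow> complex"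
  assumes F: "\<And>n. entire_on_banach (F n)"
    and lim: "\<And>x. \<exists>r>0. uniform_limit (cball x r) F f sequentially"
  shows "entire_on_banach f"
  unfolding entire_on_banach_iff
proof
  show "gateaux_entire f" unfolding gateaux_entire_def
  proof (intro allI)
    fix x y :: 'a
    show "(\<lambda>z. f (x + scaleC z y)) holomorphic_on UNIV"
    proof (rule holomorphic_uniform_sequence[OF open_UNIV])
      show "(\<lambda>z. F n (x + scaleC z y)) holomorphic_on UNIV" for n
        using F[of n] by (simp add: entire_on_banach_iff gateaux_entire_def)
      fix z0
      obtain r where r: "r > 0" "uniform_limit (cball (x + scaleC z0 y) r) F f sequentially"
        using lim by blast
      \<comment> \<open>The disc of this radius is mapped by the line into the ball on which
        convergence is uniform; the summand 1 covers y = 0.\<close>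
      define d where "d = r / (norm y + 1)"
      have y1: "norm y + 1 > 0" by (smt (verit) norm_ge_zero)
      have d: "d > 0" using r(1) y1 by (simp add: d_def)
      have "x + scaleC z y \<in> cball (x + scaleC z0 y) r" if "z \<in> cball z0 d" for z
      proof -
        have "dist (x + scaleC z0 y) (x + scaleC z y) = cmod (z0 - z) * norm y"
          by (simp add: dist_norm norm_scaleC flip: scaleC.scale_left_diff_distrib)
        also have "\<dots> \<le> d * (norm y + 1)" using that d by (intro mult_mono) (auto simp: dist_norm)
        also have "\<dots> = r" using y1 by (simp add: d_def)
        finally show ?thesis by simp
      qed
      note in_ball = this
      have "uniform_limit (cball z0 d) (\<lambda>n z. F n (x + scaleC z y)) (\<lambda>z. f (x + scaleC z y)) sequentially"
        unfolding uniform_limit_iff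
      proof (intro allI impI)
        fix e :: real assume "0 < e"
        then have "\<forall>\<^sub>F n in sequentially. \<forall>u\<in>cball (x + scaleC z0 y) r. dist (F n u) (f u) < e"
          using r(2) unfolding uniform_limit_iff by blast
        then show "\<forall>\<^sub>F n in sequentially. \<forall>z\<in>cball z0 d. dist (F n (x + scaleC z y)) (f (x + scaleC z y)) < e"
          by (rule eventually_mono) (use in_ball in blast)
      qed
      then show "\<exists>d>0. cball z0 d \<subseteq> UNIV \<and>
          uniform_limit (cball z0 d) (\<lambda>n z. F n (x + scaleC z y)) (\<lambda>z. f (x + scaleC z y)) sequentially"
        using d by blast
    qed
  qed
  show "locally_bounded f" unfolding locally_bounded_def
  proof
    fix x
    obtain r where r: "r > 0" "uniform_limit (cball x r) F f sequentially" using lim by blast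
    then have "\<forall>\<^sub>F n in sequentially. \<forall>y\<in>cball x r. dist (F n y) (f y) < 1"
      unfolding uniform_limit_iff using zero_less_one by blast
    then obtain n where n: "\<And>y. y \<in> cball x r \<Longrightarrow> dist (F n y) (f y) < 1"
      using eventually_happens'[OF sequentially_bot] by blast
    obtain r' M where r': "r' > 0" "\<And>y. norm (y - x) \<le> r' \<Longrightarrow> cmod (F n y) \<le> M"
      using F[of n] unfolding entire_on_banach_iff locally_bounded_def by meson
    have "cmod (f y) \<le> M + 1" if "norm (y - x) \<le> min r r'" for y
    proof -
      have "dist (F n y) (f y) < 1" using n[of y] that by (simp add: dist_norm norm_minus_commute)
      then show ?thesis using r'(2)[of y] that norm_triangle_sub[of "f y" "F n y"]
        by (simp add: dist_norm norm_minus_commute)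
    qed
    then show "\<exists>r>0. \<exists>M. \<forall>y. norm (y - x) \<le> r \<longrightarrow> cmod (f y) \<le> M"
      using r r' by (intro exI[of _ "min r r'"]) auto
  qed
qed

section \<open>Closure properties of entire functions\<close>

lemma entire_continuous: "entire_on_banach f \<Longrightarrow> continuous_on UNIV f"
  unfolding entire_on_banach_def
  by (meson continuous_at_imp_continuous_on has_derivative_continuous)

lemma entire_bounded_linear:
  assumes "bounded_linear D" "\<And>c x. D (scaleC c x) = c * D x"
  shows "entire_on_banach D"
  unfolding entire_on_banach_def clinear_iff
  using assms bounded_linear_imp_has_derivative[OF assms(1)]
  by (metis bounded_linear.linear linear_add)

lemma entire_const: "entire_on_banach (\<lambda>_. c)"
  unfolding entire_on_banach_def clinear_iff
  by (intro allI exI[of _ "\<lambda>_. 0"]) simp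

lemma entire_add:
  assumes "entire_on_banach f" "entire_on_banach g"
  shows "entire_on_banach (\<lambda>x. f x + g x)"
  unfolding entire_on_banach_def clinear_iff
proof
  fix x
  obtain D where D: "(f has_derivative D) (at x)" "Vector_Spaces.linear scaleC (*) D"
    using assms(1) unfolding entire_on_banach_def by meson
  obtain E where E: "(g has_derivative E) (at x)" "Vector_Spaces.linear scaleC (*) E"
    using assms(2) unfolding entire_on_banach_def by meson
  show "\<exists>D. ((\<lambda>x. f x + g x) has_derivative D) (at x) \<and>
        (\<forall>x y. D (x + y) = D x + D y) \<and> (\<forall>c x. D (scaleC c x) = c * D x)"
    using has_derivative_add[OF D(1) E(1)] D(2) E(2)
    by (intro exI[of _ "\<lambda>h. D h + E h"]) (simp add: clinear_iff algebra_simps)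
qed

lemma entire_cmult:
  assumes "entire_on_banach f"
  shows "entire_on_banach (\<lambda>x. c * f x)"
  unfolding entire_on_banach_def clinear_iff
proof
  fix x
  obtain D where D: "(f has_derivative D) (at x)" "Vector_Spaces.linear scaleC (*) D"
    using assms(1) unfolding entire_on_banach_def by meson
  show "\<exists>D. ((\<lambda>x. c * f x) has_derivative D) (at x) \<and>
        (\<forall>x y. D (x + y) = D x + D y) \<and> (\<forall>c x. D (scaleC c x) = c * D x)"
    using has_derivative_mult_right[OF D(1), of c] D(2)
    by (intro exI[of _ "\<lambda>h. c * D h"]) (simp add: clinear_iff algebra_simps)
qed

lemma entire_diff:
  "entire_on_banach f \<Longrightarrow> entire_on_banach g \<Longrightarrow> entire_on_banach (\<lambda>x. f x - g x)"
  using entire_add[of f "\<lambda>x. - 1 * g x"] entire_cmult[of g "-1"] by simp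

lemma entire_sum:
  "(\<And>i. i \<in> I \<Longrightarrow> entire_on_banach (f i)) \<Longrightarrow> entire_on_banach (\<lambda>x. \<Sum>i\<in>I. f i x)"
  by (induction I rule: infinite_finite_induct) (auto intro: entire_const entire_add)

lemma entire_translate: "entire_on_banach f \<Longrightarrow> entire_on_banach (\<lambda>x. f (x + a))"
proof -
  assume f: "entire_on_banach f"
  have "((\<lambda>x. f (x + a)) has_derivative D) (at x)" if "(f has_derivative D) (at (x + a))" for D x
    using diff_chain_at[of "\<lambda>x. x + a" "\<lambda>h. h" x f D] that
    by (simp add: o_def has_derivative_add_const has_derivative_ident)
  with f show ?thesis unfolding entire_on_banach_def by meson
qed

lemma bounded_linear_scaleC: "bounded_linear (scaleC c :: 'a::complex_banach \<Rightarrow> 'a)"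
proof (rule bounded_linear_intro[where K = "cmod c"])
  show "scaleC c (r *\<^sub>R x) = r *\<^sub>R scaleC c x" for r and x :: 'a
    by (simp add: mult.commute flip: scaleC_of_real)
qed (simp_all add: scaleC_add_right norm_scaleC)

lemma entire_dilate:
  assumes "entire_on_banach f"
  shows "entire_on_banach (\<lambda>x. f (scaleC c x))"
  unfolding entire_on_banach_def clinear_iff
proof
  fix x
  obtain D where D: "(f has_derivative D) (at (scaleC c x))" "Vector_Spaces.linear scaleC (*) D"
    using assms(1) unfolding entire_on_banach_def by meson
  have "((\<lambda>x. f (scaleC c x)) has_derivative (\<lambda>h. D (scaleC c h))) (at x)"
    using diff_chain_at[OF bounded_linear_imp_has_derivative[OF bounded_linear_scaleC] D(1)]
    by (simp add: o_def)
  then show "\<exists>D. ((\<lambda>x. f (scaleC c x)) has_derivative D) (at x) \<and>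
        (\<forall>x y. D (x + y) = D x + D y) \<and> (\<forall>c x. D (scaleC c x) = c * D x)"
    using D(2)
    by (intro exI[of _ "\<lambda>h. D (scaleC c h)"]) (simp add: clinear_iff scaleC_add_right mult.left_commute)
qed

lemma ddir_lincomb_right:
  assumes "entire_on_banach P" "entire_on_banach Q"
  shows "ddir y (\<lambda>x. a * P x + b * Q x) = (\<lambda>x. a * ddir y P x + b * ddir y Q x)"
proof
  fix x
  have "((\<lambda>z. P (x + scaleC z y)) has_field_derivative ddir y P x) (at 0)"
    "((\<lambda>z. Q (x + scaleC z y)) has_field_derivative ddir y Q x) (at 0)"
    using assms by (auto simp: entire_on_banach_iff intro: ddir_has_field_derivative)
  from DERIV_add[OF DERIV_cmult[OF this(1), of a] DERIV_cmult[OF this(2), of b]]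
  show "ddir y (\<lambda>x. a * P x + b * Q x) x = a * ddir y P x + b * ddir y Q x"
    unfolding ddir_def[of y "\<lambda>x. a * P x + b * Q x"] by (rule DERIV_imp_deriv)
qed

lemma ddir_lincomb_left:
  assumes "entire_on_banach P"
  shows "ddir (scaleC a u + scaleC b v) P = (\<lambda>x. a * ddir u P x + b * ddir v P x)"
  using assms by (auto simp: entire_on_banach_iff ddir_add ddir_scaleC)

text \<open>The derivative is the locally uniform limit of difference quotients with step 1/(n+1),
  to which the closure under such limits applies.\<close>

lemma entire_ddir:
  fixes f :: "'a::complex_banach \<Rightarrow> complex"
  assumes f: "entire_on_banach f"
  shows "entire_on_banach (ddir y f)"
proof (rule entire_on_banach_locally_uniform_limit)
  define F where "F n x = of_nat (Suc n) * (f (x + scaleC (of_real (1 / real (Suc n))) y) - f x)" for n x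
  show "entire_on_banach (F n)" for n
    unfolding F_def by (intro entire_cmult entire_diff entire_translate f)
  fix x
  have g: "gateaux_entire f" using f by (simp add: entire_on_banach_iff)
  obtain r M where r: "r > 0" "\<And>h. norm (h - x) \<le> r \<Longrightarrow> cmod (f h) \<le> M"
    using f unfolding entire_on_banach_iff locally_bounded_def by meson
  \<comment> \<open>Dividing y by R gives u of norm at most r/2, so that x' + wu stays in the ball
    of radius r about x for all |w| \<le> 1 and all x' within r/2 of x. The price is the factor R^2
    in \<open>est\<close>.\<close>
  define R where "R = 2 * norm y / r + 1"
  have R: "R > 0" using r(1) by (simp add: R_def add_nonneg_pos)
  define u where "u = scaleC (of_real (1 / R)) y"
  have yu: "y = scaleC (of_real R) u" using R by (simp add: u_def scaleC_of_real del: of_real_divide)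
  have nu: "norm u \<le> r / 2"
  proof -
    have "norm u = norm y / R" using R by (simp add: u_def scaleC_of_real del: of_real_divide)
    also have "\<dots> \<le> r / 2"
      unfolding pos_divide_le_eq[OF R] using r(1) by (simp add: R_def field_simps)
    finally show ?thesis .
  qed
  have est: "cmod (F n x' - ddir y f x') \<le> 2 * M * R\<^sup>2 * (1 / real (Suc n))"
    if n: "R * (1 / real (Suc n)) \<le> 1/2" and x': "x' \<in> cball x (r / 2)" for n x'
  proof -
    let ?z = "complex_of_real (R * (1 / real (Suc n)))"
    have "cmod (f (x' + scaleC ?z u) - f x' - ?z * ddir u f x') \<le> 2 * M * (cmod ?z)\<^sup>2"
    proof (rule ddir_remainder(1)[OF g])
      fix w assume "cmod w \<le> 1"
      then have "norm (scaleC w u) \<le> r / 2"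
        using nu mult_left_le_one_le[of "norm u" "cmod w"] by (simp add: norm_scaleC)
      then show "cmod (f (x' + scaleC w u)) \<le> M"
        using x' norm_triangle_ineq[of "x' - x" "scaleC w u"]
        by (intro r(2)) (simp add: dist_norm norm_minus_commute algebra_simps)
    qed (subst norm_of_real, use n R in simp)
    then have "real (Suc n) * cmod (f (x' + scaleC ?z u) - f x' - ?z * ddir u f x') \<le> real (Suc n) * (2 * M * (cmod ?z)\<^sup>2)"
      by (intro mult_left_mono) auto
    moreover have "real (Suc n) * cmod (f (x' + scaleC ?z u) - f x' - ?z * ddir u f x') = cmod (F n x' - ddir y f x')"
    proof -
      have *: "scaleC ?z u = scaleC (of_real (1 / real (Suc n))) y" by (simp add: yu mult.commute)
      have "F n x' - ddir y f x' = of_nat (Suc n) * (f (x' + scaleC ?z u) - f x' - ?z * ddir u f x')"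
        unfolding F_def * by (simp add: yu ddir_scaleC[OF g] field_simps del: of_nat_Suc)
      then show ?thesis by (simp add: norm_mult del: of_nat_Suc)
    qed
    moreover have "real (Suc n) * (2 * M * (cmod ?z)\<^sup>2) = 2 * M * R\<^sup>2 * (1 / real (Suc n))"
      using R by (simp add: norm_mult norm_divide power_divide power2_eq_square divide_simps del: of_nat_Suc)
    ultimately show ?thesis by (simp only:)
  qed
  have "uniform_limit (cball x (r / 2)) F (ddir y f) sequentially"
  proof (rule uniform_limitI)
    fix e :: real assume e: "0 < e"
    have l: "(\<lambda>n. C * (1 / real (Suc n))) \<longlonglongrightarrow> 0" for C
      using tendsto_mult_right_zero[OF lim_inverse_n'[THEN LIMSEQ_Suc], of C] by simp
    have "\<forall>\<^sub>F n in sequentially. R * (1 / real (Suc n)) < 1/2 \<and> 2 * M * R\<^sup>2 * (1 / real (Suc n)) < e"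
      by (intro eventually_conj order_tendstoD(2)[OF l]) (use e in auto)
    then show "\<forall>\<^sub>F n in sequentially. \<forall>x\<in>cball x (r / 2). dist (F n x) (ddir y f x) < e"
      unfolding dist_norm
      by (rule eventually_mono) (meson est less_imp_le order_le_less_trans)
  qed
  then show "\<exists>r>0. uniform_limit (cball x r) F (ddir y f) sequentially"
    using r(1) half_gt_zero by blast
qed

section \<open>Homogeneous polynomials and Taylor expansion\<close>

text \<open>The polar form of P: the n-th derivative at 0 in the directions xs 0, ..., xs (n-1),
  divided by n!, which accumulates from the factors \<open>Suc n\<close>.\<close>

primrec derivative_form :: "nat \<Rightarrow> ('a::complex_banach \<Rightarrow> complex) \<Rightarrow> (nat \<Rightarrow> 'a) \<Rightarrow> complex" where
  "derivative_form 0 P xs = P 0"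
| "derivative_form (Suc n) P xs = derivative_form n (ddir (xs n) P) xs / of_nat (Suc n)"

lemma derivative_form_lincomb:
  assumes "entire_on_banach P" "entire_on_banach Q"
  shows "derivative_form n (\<lambda>x. a * P x + b * Q x) xs = a * derivative_form n P xs + b * derivative_form n Q xs"
  using assms
proof (induction n arbitrary: P Q)
  case (Suc n)
  then show ?case
    by (simp add: ddir_lincomb_right entire_ddir add_divide_distrib del: of_nat_Suc)
qed simp

lemma derivative_form_cong:
  "(\<And>i. i < n \<Longrightarrow> xs i = ys i) \<Longrightarrow> derivative_form n P xs = derivative_form n P ys"
  by (induction n arbitrary: P) simp_all

text \<open>The direction with the last index is differentiated first. If it varies, linearity of
  \<open>ddir\<close> in the direction is combined with linearity of the remaining form in the
  function; otherwise induction applies.\<close>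

lemma derivative_form_lincomb_arg:
  assumes "entire_on_banach P" "i < n"
  shows "derivative_form n P (xs(i := scaleC a u + scaleC b v))
    = a * derivative_form n P (xs(i := u)) + b * derivative_form n P (xs(i := v))"
  using assms
proof (induction n arbitrary: P)
  case (Suc n)
  show ?case
  proof (cases "i = n")
    case True
    have *: "derivative_form n Q (xs(n := w)) = derivative_form n Q xs" for Q w
      by (rule derivative_form_cong) simp
    show ?thesis using Suc.prems
      unfolding True derivative_form.simps fun_upd_same *
      by (simp add: ddir_lincomb_left derivative_form_lincomb entire_ddir add_divide_distrib del: of_nat_Suc)
  next
    case False
    then show ?thesis using Suc
      by (simp add: entire_ddir add_divide_distrib del: of_nat_Suc)
  qed
qed simp

lemma n_linear_form_derivative_form:
  assumes "entire_on_banach P"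
  shows "n_linear_form n (derivative_form n P)"
  unfolding n_linear_form_def clinear_iff
proof (intro conjI allI impI)
  show "derivative_form n P x = derivative_form n P y" if "\<forall>i<n. x i = y i" for x y
    using that derivative_form_cong by blast
  fix i and xs :: "nat \<Rightarrow> 'a" assume i: "i < n"
  note l = derivative_form_lincomb_arg[OF assms i, of xs]
  show "derivative_form n P (xs(i := u + v)) = derivative_form n P (xs(i := u)) + derivative_form n P (xs(i := v))" for u v
    using l[of 1 u 1 v] by simp
  show "derivative_form n P (xs(i := scaleC c u)) = c * derivative_form n P (xs(i := u))" for c u
    using l[of c u 0 u] by simp
qed

definition homogeneous :: "nat \<Rightarrow> ('a::complex_banach \<Rightarrow> complex) \<Rightarrow> bool" where
  "homogeneous n P \<longleftrightarrow> (\<forall>c x. P (scaleC c x) = c ^ n * P x)"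

text \<open>The case c = 0 follows from the others by letting c tend to 0 along a line; this also
  covers degree 0, where 0^0 = 1.\<close>

lemma homogeneousI:
  assumes P: "entire_on_banach P" and h: "\<And>c x. c \<noteq> 0 \<Longrightarrow> P (scaleC c x) = c ^ n * P x"
  shows "homogeneous n P"
  unfolding homogeneous_def
proof (intro allI)
  fix c x
  show "P (scaleC c x) = c ^ n * P x"
  proof (cases "c = 0")
    case True
    have "continuous_on UNIV (\<lambda>z. P (0 + scaleC z x))"
      using P unfolding entire_on_banach_iff
      by (intro holomorphic_on_imp_continuous_on gateaux_entireD) simp
    then have "\<forall>w\<in>UNIV. ((\<lambda>z. P (0 + scaleC z x)) \<longlongrightarrow> P (0 + scaleC w x)) (at w)"
      unfolding continuous_on_def .
    from bspec[OF this, of 0] have "((\<lambda>z. P (scaleC z x)) \<longlongrightarrow> P (scaleC 0 x)) (at 0)"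
      by simp
    moreover have "((\<lambda>z. P (scaleC z x)) \<longlongrightarrow> 0 ^ n * P x) (at 0)"
      by (rule Lim_transform_eventually[where f = "\<lambda>z. z ^ n * P x"])
        (auto intro!: tendsto_intros simp: eventually_at h intro: zero_less_one)
    ultimately show ?thesis using True tendsto_unique[OF trivial_limit_at] by blast
  qed (use h in auto)
qed

text \<open>Euler's identity: P(x + zx) = (1+z)^n P(x) gives \<open>ddir x P x\<close> = n P(x),
  which cancels the division in the form. Induction applies because \<open>ddir x P\<close> is
  homogeneous of one degree less.\<close>

lemma derivative_form_diag:
  assumes "entire_on_banach P" "homogeneous n P"
  shows "derivative_form n P (\<lambda>_. x) = P x"
  using assms
proof (induction n arbitrary: P)
  case 0
  then show ?case using scaleC.scale_zero_left[of x]
    unfolding homogeneous_def by (metis derivative_form.simps(1) mult_1 power_0)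
next
  case (Suc n)
  have g: "gateaux_entire P" using Suc.prems by (simp add: entire_on_banach_iff)
  have h: "P (scaleC c x) = c ^ Suc n * P x" for c x using Suc.prems(2) by (simp add: homogeneous_def)
  have "homogeneous n (ddir x P)"
  proof (rule homogeneousI)
    fix c :: complex and y :: 'a assume c: "c \<noteq> 0"
    have "((\<lambda>z. P (y + scaleC z x)) \<circ> (\<lambda>z. z / c) has_field_derivative ddir x P y * (1 / c)) (at 0)"
      by (rule DERIV_chain) (use c in \<open>auto intro!: ddir_has_field_derivative g derivative_eq_intros\<close>)
    then have "((\<lambda>z. c ^ Suc n * P (y + scaleC (z / c) x)) has_field_derivative c ^ Suc n * (ddir x P y * (1 / c))) (at 0)"
      unfolding o_def by (rule DERIV_cmult)
    moreover have "c ^ Suc n * P (y + scaleC (z / c) x) = P (scaleC c y + scaleC z x)" for z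
      using h[of c "y + scaleC (z / c) x"] c by (simp add: scaleC_add_right)
    ultimately have "((\<lambda>z. P (scaleC c y + scaleC z x)) has_field_derivative c ^ n * ddir x P y) (at 0)"
      using c by simp
    then show "ddir x P (scaleC c y) = c ^ n * ddir x P y"
      unfolding ddir_def[of x P "scaleC c y"] by (rule DERIV_imp_deriv)
  qed (intro entire_ddir Suc.prems)
  then have "derivative_form n (ddir x P) (\<lambda>_. x) = ddir x P x"
    by (intro Suc.IH entire_ddir Suc.prems)
  moreover have "ddir x P x = of_nat (Suc n) * P x"
  proof -
    have "P (x + scaleC z x) = (1 + z) ^ Suc n * P x" for z
      using h[of "1 + z" x] by (simp add: scaleC_add_left scaleC_one)
    moreover have "((\<lambda>z. (1 + z) ^ Suc n * P x) has_field_derivative of_nat (Suc n) * P x) (at 0)"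
      by (auto intro!: derivative_eq_intros)
    ultimately show ?thesis unfolding ddir_def by (simp only: DERIV_imp_deriv)
  qed
  ultimately show ?case by (simp del: of_nat_Suc)
qed

lemma continuous_homogeneous_polysI:
  assumes "entire_on_banach P" "homogeneous n P"
  shows "P \<in> continuous_homogeneous_polys n"
  unfolding continuous_homogeneous_polys_def
  using assms n_linear_form_derivative_form[OF assms(1)] derivative_form_diag[OF assms] entire_continuous
  by fastforce

text \<open>The scalar is pulled out of one argument of the multilinear form at a time.\<close>

lemma continuous_homogeneous_polysD:
  fixes P :: "'a::complex_banach \<Rightarrow> complex"
  assumes "P \<in> continuous_homogeneous_polys n"
  shows "homogeneous n P"
  unfolding homogeneous_def
proof (intro allI)
  fix c and x :: 'a
  obtain A where A: "n_linear_form n A" "\<And>x. P x = A (\<lambda>_. x)"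
    using assms unfolding continuous_homogeneous_polys_def by blast
  \<comment> \<open>\<open>X k\<close> has exactly its first k entries scaled, so X 0 is constantly
    x, and X n agrees with the constant scaled vector on the entries that A can see.\<close>
  define X where "X k i = (if i < k then scaleC c x else x)" for k i :: nat
  have "A (X k) = c ^ k * A (\<lambda>_. x)" if "k \<le> n" for k
    using that
  proof (induction k)
    case 0
    then show ?case by (simp add: X_def)
  next
    case (Suc k)
    have "A ((X k)(k := scaleC c x)) = c * A ((X k)(k := x))"
      using A(1) Suc.prems unfolding n_linear_form_def clinear_iff by (metis Suc_le_lessD)
    moreover have "(X k)(k := scaleC c x) = X (Suc k)" "(X k)(k := x) = X k"
      by (auto simp: X_def fun_eq_iff less_Suc_eq)
    ultimately show ?case using Suc by simp
  qed
  moreover have "A (X n) = A (\<lambda>_. scaleC c x)"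
    using A(1) unfolding n_linear_form_def by (metis X_def)
  ultimately show "P (scaleC c x) = c ^ n * P x" using A(2) by simp
qed

section \<open>Homogeneous Taylor parts of an entire function\<close>

definition hom_part :: "nat \<Rightarrow> ('a::complex_banach \<Rightarrow> complex) \<Rightarrow> 'a \<Rightarrow> complex" where
  "hom_part n f x = taylor_coeff (\<lambda>z. f (scaleC z x)) n"

lemma entire_line: "entire_on_banach f \<Longrightarrow> (\<lambda>z. f (scaleC z x)) holomorphic_on UNIV"
  using gateaux_entireD[of f 0 x] by (simp add: entire_on_banach_iff)

lemma hom_part_sums_line:
  "entire_on_banach f \<Longrightarrow> (\<lambda>n. hom_part n f x * z ^ n) sums f (scaleC z x)"
  unfolding hom_part_def by (intro taylor_coeff_sums entire_line)

lemma hom_part_sums: "entire_on_banach f \<Longrightarrow> (\<lambda>n. hom_part n f x) sums f x"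
  using hom_part_sums_line[of f x 1] by (simp add: scaleC_one)

text \<open>Homogeneity turns the expansion at the points zx into a power series in z, so uniqueness
  of Taylor coefficients on each line decides.\<close>

lemma hom_part_unique:
  assumes "\<And>n. homogeneous n (y n)" "\<And>x. (\<lambda>n. y n x) sums f x"
  shows "y n = hom_part n f"
proof
  fix x
  have "(\<lambda>n. y n x * z ^ n) sums f (scaleC z x)" for z
    using assms(2)[of "scaleC z x"] assms(1) unfolding homogeneous_def by (simp add: mult.commute)
  from taylor_coeff_unique[OF this] show "y n x = hom_part n f x" by (simp add: hom_part_def)
qed

lemma hom_part_homogeneous:
  assumes "entire_on_banach f"
  shows "homogeneous n (hom_part n f)"
  unfolding homogeneous_def
proof (intro allI)
  fix c x
  have "(\<lambda>k. (c ^ k * hom_part k f x) * z ^ k) sums f (scaleC z (scaleC c x))" for z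
    using hom_part_sums_line[OF assms, of x "z * c"] by (simp add: power_mult_distrib mult_ac)
  from taylor_coeff_unique[OF this] show "hom_part n f (scaleC c x) = c ^ n * hom_part n f x"
    by (simp add: hom_part_def)
qed

lemma hom_part_bound:
  assumes "entire_on_banach f" "\<And>u. norm u = norm x \<Longrightarrow> cmod (f u) \<le> M"
  shows "cmod (hom_part n f x) \<le> M"
  using taylor_coeff_bound[OF entire_line[OF assms(1)], of 1 x M n] assms(2)
  by (simp add: hom_part_def norm_scaleC)

text \<open>By strong induction: the n-th part is the limit of z^-n (f(zx) - sum over k < n of z^k
  P_k(x)) as z tends to 0, uniformly near each point because f is bounded on balls. In a weighted
  space this boundedness comes from the positive lower bound of a weight on each ball.\<close>

lemma hom_part_entire:
  fixes f :: "'a::complex_banach \<Rightarrow> complex"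
  assumes f: "entire_on_banach f" and bd: "\<And>R. \<exists>M. \<forall>x. norm x \<le> R \<longrightarrow> cmod (f x) \<le> M"
  shows "entire_on_banach (hom_part n f)"
proof (induction n rule: less_induct)
  case (less n)
  \<comment> \<open>Here z = 1/(m+2); the shift by 2 keeps z within the radius 1/2 required by
    \<open>taylor_remainder_bound\<close>.\<close>
  define F where "F m x = of_nat (m + 2) ^ n * (f (scaleC (1 / of_nat (m + 2)) x)
     - (\<Sum>k<n. (1 / of_nat (m + 2)) ^ k * hom_part k f x))" for m x
  show ?case
  proof (rule entire_on_banach_locally_uniform_limit)
    show "entire_on_banach (F m)" for m
      unfolding F_def by (intro entire_cmult entire_diff entire_sum entire_dilate f less.IH) auto
    fix x :: 'a
    obtain M where M: "\<And>u. norm u \<le> norm x + 1 \<Longrightarrow> cmod (f u) \<le> M" using bd by meson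
    have est: "cmod (F m u - hom_part n f u) \<le> 2 * M * (1 / real (m + 2))" if u: "u \<in> cball x 1" for m u
    proof -
      let ?z = "1 / of_nat (m + 2) :: complex"
      have nz: "cmod ?z = 1 / real (m + 2)" by (simp only: norm_divide norm_one norm_of_nat)
      have nu: "norm u \<le> norm x + 1" using u norm_triangle_sub[of u x] by (simp add: dist_norm norm_minus_commute)
      have "cmod (f (scaleC w u)) \<le> M" if "cmod w \<le> 1" for w
        by (rule M) (use that nu mult_left_le_one_le[of "norm u" "cmod w"] in \<open>simp add: norm_scaleC\<close>)
      from taylor_remainder_bound[OF entire_line[OF f] this, of ?z "Suc n"]
      have *: "cmod (f (scaleC ?z u) - (\<Sum>k<Suc n. hom_part k f u * ?z ^ k)) \<le> 2 * M * cmod ?z ^ Suc n"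
        unfolding hom_part_def nz by simp
      have "F m u - hom_part n f u = of_nat (m + 2) ^ n * (f (scaleC ?z u) - (\<Sum>k<Suc n. hom_part k f u * ?z ^ k))"
      proof -
        have "(of_nat (m + 2) :: complex) \<noteq> 0" unfolding of_nat_eq_0_iff by simp
        then show ?thesis unfolding F_def
          by (simp add: power_divide algebra_simps del: of_nat_add)
      qed
      then have "cmod (F m u - hom_part n f u) = real (m + 2) ^ n * cmod (f (scaleC ?z u) - (\<Sum>k<Suc n. hom_part k f u * ?z ^ k))"
        by (simp only: norm_mult norm_power norm_of_nat)
      also have "\<dots> \<le> real (m + 2) ^ n * (2 * M * cmod ?z ^ Suc n)"
        using * by (intro mult_left_mono) auto
      also have "\<dots> = 2 * M * (1 / real (m + 2))"
        unfolding nz by (simp add: power_divide del: of_nat_add)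
      finally show ?thesis .
    qed
    have "uniform_limit (cball x 1) F (hom_part n f) sequentially"
    proof (rule uniform_limitI)
      fix e :: real assume e: "0 < e"
      have l: "(\<lambda>n. C * (1 / real (n + 2))) \<longlonglongrightarrow> 0" for C
        using tendsto_mult_right_zero[OF LIMSEQ_ignore_initial_segment[OF lim_inverse_n', of 2], of C] by simp
      have "\<forall>\<^sub>F m in sequentially. 2 * M * (1 / real (m + 2)) < e"
        by (intro order_tendstoD(2)[OF l]) (use e in auto)
      then show "\<forall>\<^sub>F m in sequentially. \<forall>u\<in>cball x 1. dist (F m u) (hom_part n f u) < e"
        unfolding dist_norm by (rule eventually_mono) (meson est order_le_less_trans)
    qed
    then show "\<exists>r>0. uniform_limit (cball x r) F (hom_part n f) sequentially"
      using zero_less_one by blast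
  qed
qed

section \<open>Norming functionals\<close>

definition sublinear :: "('a::real_vector \<Rightarrow> real) \<Rightarrow> bool" where
  "sublinear p \<longleftrightarrow> (\<forall>x y. p (x + y) \<le> p x + p y) \<and> (\<forall>r>0. \<forall>x. p (r *\<^sub>R x) = r * p x)"

lemma sublinearD:
  assumes "sublinear p"
  shows "p (x + y) \<le> p x + p y" "r > 0 \<Longrightarrow> p (r *\<^sub>R x) = r * p x" "p 0 = 0" "- p (- x) \<le> p x"
proof -
  show 1: "p (x + y) \<le> p x + p y" for x y using assms by (simp add: sublinear_def)
  show "r > 0 \<Longrightarrow> p (r *\<^sub>R x) = r * p x" using assms by (simp add: sublinear_def)
  have "p (2 *\<^sub>R 0) = 2 * p 0" using assms unfolding sublinear_def by (metis zero_less_numeral)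
  then show 0: "p 0 = 0" by simp
  show "- p (- x) \<le> p x" using 1[of x "- x"] 0 by simp
qed

text \<open>The reverse inequality for homogeneity is the assumed one for 1/r and the vector
  rx.\<close>

lemma sublinearI:
  assumes "\<And>x y. p (x + y) \<le> p x + p y" "\<And>r x. r > 0 \<Longrightarrow> p (r *\<^sub>R x) \<le> r * p x"
  shows "sublinear p"
  unfolding sublinear_def
proof (intro conjI allI impI assms(1))
  fix r :: real and x assume r: "r > 0"
  have "p ((1 / r) *\<^sub>R (r *\<^sub>R x)) \<le> (1 / r) * p (r *\<^sub>R x)" by (rule assms(2)) (use r in simp)
  then have "r * p x \<le> p (r *\<^sub>R x)" using r by (simp add: field_simps)
  then show "p (r *\<^sub>R x) = r * p x" using assms(2)[OF r, of x] by simp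
qed

text \<open>Applied to a minimal \<open>p\<close> this forces \<open>p (x + a) = p x + p a\<close>, which gives Hahn--Banach.\<close>

lemma sublinear_reduce:
  assumes p: "sublinear p"
  shows "\<exists>q. sublinear q \<and> (\<forall>x. q x \<le> p x) \<and> (\<forall>x. q x \<le> p (x + a) - p a)"
proof -
  \<comment> \<open>The parameters t = 0 and t = 1 give the two required upper bounds for the
    infimum. Taking all t \<ge> 0 makes it sublinear, since parameters add under addition of vectors
    and scale with them.\<close>
  define g where "g x t = p (x + t *\<^sub>R a) - t * p a" for x t
  define q where "q x = (INF t\<in>{0..}. g x t)" for x
  have lb: "- p (- x) \<le> g x t" if "t \<ge> 0" for x t
  proof -
    have "p (t *\<^sub>R a) = t * p a" using sublinearD[OF p] that by (cases "t = 0") auto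
    moreover have "p (t *\<^sub>R a) \<le> p (x + t *\<^sub>R a) + p (- x)" using sublinearD(1)[OF p, of "x + t *\<^sub>R a" "- x"] by simp
    ultimately show ?thesis by (simp add: g_def)
  qed
  have bdd: "bdd_below (g x ` {0..})" for x by (rule bdd_belowI2[OF lb]) auto
  have le: "q x \<le> g x t" if "t \<ge> 0" for x t
    unfolding q_def by (rule cINF_lower[OF bdd]) (use that in auto)
  have ge: "m \<le> q x" if "\<And>t. t \<ge> 0 \<Longrightarrow> m \<le> g x t" for m x
    unfolding q_def by (rule cINF_greatest) (use that in auto)
  have "sublinear q"
  proof (rule sublinearI)
    fix x y
    have "q (x + y) - g x s \<le> q y" if "s \<ge> 0" for s
    proof (rule ge)
      fix t :: real assume t: "t \<ge> 0"
      have "q (x + y) \<le> g (x + y) (s + t)" using t that by (intro le) auto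
      also have "\<dots> \<le> g x s + g y t"
        using sublinearD(1)[OF p, of "x + s *\<^sub>R a" "y + t *\<^sub>R a"]
        by (simp add: g_def algebra_simps)
      finally show "q (x + y) - g x s \<le> g y t" by simp
    qed
    then have "q (x + y) - q y \<le> q x" by (intro ge) (smt (verit))
    then show "q (x + y) \<le> q x + q y" by simp
  next
    fix r :: real and x assume r: "r > 0"
    have "q (r *\<^sub>R x) / r \<le> q x"
    proof (rule ge)
      fix t :: real assume t: "t \<ge> 0"
      have "q (r *\<^sub>R x) \<le> g (r *\<^sub>R x) (r * t)" using r t by (intro le) auto
      also have "\<dots> = r * g x t"
        using sublinearD(2)[OF p r, of "x + t *\<^sub>R a"] by (simp add: g_def algebra_simps)
      finally show "q (r *\<^sub>R x) / r \<le> g x t" using r by (simp add: field_simps)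
    qed
    then show "q (r *\<^sub>R x) \<le> r * q x" using r by (simp add: field_simps)
  qed
  moreover have "q x \<le> p x" for x using le[of 0 x] by (simp add: g_def)
  moreover have "q x \<le> p (x + a) - p a" for x using le[of 1 x] by (simp add: g_def)
  ultimately show ?thesis by blast
qed

text \<open>Zorn's lemma for the reversed pointwise order. A chain is bounded by its pointwise
  infimum, which is finite because each sublinear p \<le> q satisfies p(x) \<ge> -q(-x).\<close>

lemma minimal_sublinear_exists:
  assumes q: "sublinear q"
  shows "\<exists>m. sublinear m \<and> (\<forall>x. m x \<le> q x) \<and> (\<forall>p. sublinear p \<longrightarrow> (\<forall>x. p x \<le> m x) \<longrightarrow> p = m)"
proof -
  define A where "A = {p. sublinear p \<and> (\<forall>x. p x \<le> q x)}"
  define P where "P = (\<lambda>a b :: 'a \<Rightarrow> real. \<forall>x. b x \<le> a x)"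
  have "\<exists>m\<in>A. \<forall>a\<in>A. P m a \<longrightarrow> a = m"
  proof (rule predicate_Zorn)
    show "partial_order_on A (relation_of P A)"
      by (rule partial_order_on_relation_ofI)
        (auto simp: P_def fun_eq_iff intro: order_trans order_antisym)
    fix C assume C: "C \<in> Chains (relation_of P A)"
    show "\<exists>u\<in>A. \<forall>a\<in>C. P a u"
    proof (cases "C = {}")
      case True
      then show ?thesis using q by (auto simp: A_def)
    next
      case False
      have CA: "p \<in> A" if "p \<in> C" for p using C that unfolding Chains_def relation_of_def by blast
      have ch: "P a b \<or> P b a" if "a \<in> C" "b \<in> C" for a b
        using C that unfolding Chains_def relation_of_def by blast
      define u where "u x = (INF p\<in>C. p x)" for x
      have lb: "- q (- x) \<le> p x" if "p \<in> C" for p x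
        using CA[OF that] sublinearD(4)[of p x] unfolding A_def by (smt (verit) mem_Collect_eq)
      have le: "u x \<le> p x" if "p \<in> C" for p x
        unfolding u_def by (rule cINF_lower[OF bdd_belowI2[OF lb] that])
      have ge: "m \<le> u x" if "\<And>p. p \<in> C \<Longrightarrow> m \<le> p x" for m x
        unfolding u_def by (rule cINF_greatest[OF False that])
      have "sublinear u"
      proof (rule sublinearI)
        fix x y
        have "u (x + y) - p1 x \<le> u y" if p1: "p1 \<in> C" for p1
        proof (rule ge)
          fix p2 assume p2: "p2 \<in> C"
          \<comment> \<open>Subadditivity of the infimum needs one functional for both summands: the
            smaller of the two chain members serves.\<close>
          obtain p3 where p3: "p3 \<in> C" "p3 x \<le> p1 x" "p3 y \<le> p2 y"
            using ch[OF p1 p2] p1 p2 unfolding P_def by blast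
          have "u (x + y) \<le> p3 x + p3 y"
            using le[OF p3(1), of "x + y"] CA[OF p3(1)] sublinearD(1)[of p3 x y] unfolding A_def by auto
          then show "u (x + y) - p1 x \<le> p2 y" using p3 by simp
        qed
        then have "u (x + y) - u y \<le> u x" by (intro ge) (smt (verit))
        then show "u (x + y) \<le> u x + u y" by simp
      next
        fix r :: real and x assume r: "r > 0"
        have "u (r *\<^sub>R x) / r \<le> u x"
        proof (rule ge)
          fix p assume p: "p \<in> C"
          then have "u (r *\<^sub>R x) \<le> r * p x"
            using le[OF p, of "r *\<^sub>R x"] CA[OF p] sublinearD(2)[of p r x] r unfolding A_def by auto
          then show "u (r *\<^sub>R x) / r \<le> p x" using r by (simp add: field_simps)
        qed
        then show "u (r *\<^sub>R x) \<le> r * u x" using r by (simp add: field_simps)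
      qed
      moreover obtain p where "p \<in> C" using False by blast
      ultimately have "u \<in> A" using le CA unfolding A_def by (smt (verit) mem_Collect_eq)
      then show ?thesis using le unfolding P_def by blast
    qed
  qed
  then obtain m where m: "m \<in> A" "\<And>a. a \<in> A \<Longrightarrow> P m a \<Longrightarrow> a = m" by blast
  have "p = m" if "sublinear p" "\<forall>x. p x \<le> m x" for p
    using m that unfolding A_def P_def by (smt (verit) mem_Collect_eq)
  then show ?thesis using m(1) unfolding A_def by blast
qed

lemma linear_below_sublinear:
  assumes q: "sublinear q"
  shows "\<exists>m. linear m \<and> (\<forall>x. m x \<le> q x)"
proof -
  obtain m where m: "sublinear m" "\<And>x. m x \<le> q x" "\<And>p. sublinear p \<Longrightarrow> (\<And>x. p x \<le> m x) \<Longrightarrow> p = m"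
    using minimal_sublinear_exists[OF q] by blast
  have add: "m (x + a) = m x + m a" for x a
  proof -
    obtain p where p: "sublinear p" "\<And>x. p x \<le> m x" "\<And>x. p x \<le> m (x + a) - m a"
      using sublinear_reduce[OF m(1), of a] by blast
    then have "p = m" using m(3) by blast
    then show ?thesis using p(3)[of x] sublinearD(1)[OF m(1), of x a] by simp
  qed
  have neg: "m (- x) = - m x" for x using add[of x "- x"] sublinearD(3)[OF m(1)] by simp
  have "m (r *\<^sub>R x) = r * m x" for r x
  proof (cases r "0::real" rule: linorder_cases)
    case less
    then show ?thesis using sublinearD(2)[OF m(1), of "- r" x] neg[of "r *\<^sub>R x"] by simp
  qed (use sublinearD[OF m(1)] in auto)
  with add have "linear m" by (intro linearI) simp_all
  then show ?thesis using m(2) by blast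
qed

text \<open>Reducing the norm in the direction x0 gives q with q(-x0) \<le> -\<open>norm x0\<close>.
  Every linear u below q then satisfies u(x0) \<ge> \<open>norm x0\<close>, so norming is built into
  the majorant and nothing has to be extended from a subspace.\<close>

lemma norming_functional_exists:
  fixes x0 :: "'a::complex_banach"
  shows "\<exists>l. Vector_Spaces.linear scaleC (*) l \<and> (\<forall>x. cmod (l x) \<le> norm x) \<and> l x0 = of_real (norm x0)"
proof -
  have "sublinear (norm :: 'a \<Rightarrow> real)"
    by (auto simp: sublinear_def norm_triangle_ineq)
  from sublinear_reduce[OF this, of x0] obtain q where
    q: "sublinear q" "\<And>x. q x \<le> norm x" "\<And>x. q x \<le> norm (x + x0) - norm x0" by blast
  obtain u where u: "linear u" "\<And>x. u x \<le> q x" using linear_below_sublinear[OF q(1)] by blast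
  have ux0: "norm x0 \<le> u x0"
    using u(2)[of "- x0"] q(3)[of "- x0"] linear_neg[OF u(1), of x0] by simp
  \<comment> \<open>The usual complexification u(x) - i u(ix) of a real functional.\<close>
  define l where "l x = Complex (u x) (- u (scaleC \<i> x))" for x
  have ladd: "l (x + y) = l x + l y" for x y
    by (simp add: l_def linear_add[OF u(1)] scaleC_add_right complex_eq_iff)
  have lsc: "l (scaleC c x) = c * l x" for c x
  proof -
    have *: "scaleC w x = Re w *\<^sub>R x + Im w *\<^sub>R scaleC \<i> x" for w
      by (simp flip: scaleC_of_real scaleC_add_left add: complex_eq mult.commute)
    have "scaleC c x = Re c *\<^sub>R x + Im c *\<^sub>R scaleC \<i> x" by (rule *)
    moreover have "scaleC \<i> (scaleC c x) = - Im c *\<^sub>R x + Re c *\<^sub>R scaleC \<i> x"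
      using *[of "\<i> * c"] by simp
    ultimately show ?thesis
      by (simp only: l_def linear_add[OF u(1)] linear_cmul[OF u(1)])
        (simp add: complex_eq_iff algebra_simps)
  qed
  have ln: "cmod (l x) \<le> norm x" for x
  proof (cases "l x = 0")
    case False
    \<comment> \<open>A rotation making l(cx) real and nonnegative, so that the bound on the real
      part u bounds the modulus.\<close>
    define c where "c = cnj (l x) / of_real (cmod (l x))"
    have "l x * cnj (l x) = (of_real (cmod (l x)))\<^sup>2" using complex_norm_square[of "l x"] by simp
    then have "l (scaleC c x) = of_real (cmod (l x))"
      using False by (simp add: lsc c_def divide_simps power2_eq_square mult.commute)
    then have "cmod (l x) = u (scaleC c x)" by (simp add: l_def complex_eq_iff)
    also have "\<dots> \<le> norm (scaleC c x)" using u(2) q(2) order_trans by blast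
    also have "\<dots> = norm x" using False by (simp add: norm_scaleC c_def norm_divide)
    finally show ?thesis .
  qed simp
  have Re: "Re (l x0) = norm x0" using ux0 u(2)[of x0] q(2)[of x0] by (simp add: l_def)
  \<comment> \<open>The real part alone already has the maximal modulus \<open>norm x0\<close>,
    which forces the imaginary part to vanish.\<close>
  have "(Re (l x0))\<^sup>2 + (Im (l x0))\<^sup>2 \<le> (norm x0)\<^sup>2"
    using power_mono[OF ln[of x0], of 2] by (simp add: cmod_power2)
  then have "Im (l x0) = 0" using Re by simp
  then have "l x0 = of_real (norm x0)" using Re by (simp add: complex_eq_iff)
  with ladd lsc ln show ?thesis by (intro exI[of _ l]) (simp add: clinear_iff)
qed

section \<open>Comparison of weights\<close>

locale weight =
  fixes \<eta> :: "real \<Rightarrow> real"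
  assumes pos: "\<And>t. 0 \<le> t \<Longrightarrow> 0 < \<eta> t"
    and decreasing: "\<And>s t. 0 \<le> s \<Longrightarrow> s \<le> t \<Longrightarrow> \<eta> t \<le> \<eta> s"
    and rapid: "\<And>k::nat. ((\<lambda>t. t ^ k * \<eta> t) \<longlongrightarrow> 0) at_top"
begin

lemma power_bound: "\<exists>D. \<forall>t\<ge>0. t ^ k * \<eta> t \<le> D"
proof -
  have "\<forall>\<^sub>F t in at_top. t ^ k * \<eta> t < 1" using order_tendstoD(2)[OF rapid, of 1] by simp
  then obtain T where T: "\<And>t. t \<ge> T \<Longrightarrow> t ^ k * \<eta> t < 1" by (auto simp: eventually_at_top_linorder)
  have "t ^ k * \<eta> t \<le> max 1 (\<bar>T\<bar> ^ k * \<eta> 0)" if "t \<ge> 0" for t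
  proof (cases "t \<ge> T")
    case False
    then have "t ^ k * \<eta> t \<le> \<bar>T\<bar> ^ k * \<eta> 0"
      using that pos[of t] decreasing[of 0 t] by (intro mult_mono power_mono) auto
    then show ?thesis by simp
  qed (use T[of t] in auto)
  then show ?thesis by blast
qed

text \<open>Cauchy's estimates replace the function witnessing that \<open>\<eta>\<close> is essential at \<open>s\<close> by a single
  monomial, at the price of the factor \<open>2\<close> in \<open>2 * s\<close>.\<close>

lemma essential_monomial_minorants:
  assumes "essential \<eta>"
  shows "\<exists>C\<ge>1. \<forall>s\<ge>0. \<exists>k a. 0 < a \<and> 1 / \<eta> s \<le> a * (2 * s) ^ k \<and> (\<forall>r\<ge>0. a * r ^ k \<le> C / \<eta> r)"
proof -
  obtain C0 where C0: "\<And>t. t \<ge> 0 \<Longrightarrow> associated_weight \<eta> t \<le> C0 * \<eta> t"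
    using assms unfolding essential_def by blast
  \<comment> \<open>The constant in the definition of \<open>essential\<close> carries no sign; the
    maximum with 1 makes it positive.\<close>
  define D where "D = max C0 1"
  have "\<exists>k a. 0 < a \<and> 1 / \<eta> s \<le> a * (2 * s) ^ k \<and> (\<forall>r\<ge>0. a * r ^ k \<le> 4 * D / \<eta> r)" if s: "s \<ge> 0" for s
  proof -
    have es: "\<eta> s > 0" using pos s by blast
    define G where "G = {g. g holomorphic_on UNIV \<and> (\<forall>z. cmod (g z) \<le> 1 / \<eta> (cmod z))}"
    define A where "A = (\<lambda>g. cmod (g (complex_of_real s))) ` G"
    have aw: "associated_weight \<eta> s = 1 / Sup A"
      unfolding associated_weight_def A_def G_def by (rule arg_cong[where f = "\<lambda>A. 1 / Sup A"]) auto
    have bdd: "bdd_above A"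
      using s by (intro bdd_aboveI[of _ "1 / \<eta> s"]) (auto simp: A_def G_def dest: spec[of _ "complex_of_real s"])
    \<comment> \<open>This constant function is admissible because \<eta> is largest at 0. It makes
      the supremum positive, so that reciprocals may be taken.\<close>
    have "(\<lambda>_. complex_of_real (1 / \<eta> 0)) \<in> G"
      using pos decreasing[of 0] by (auto simp: G_def norm_divide abs_of_pos intro!: divide_left_mono)
    then have "cmod (complex_of_real (1 / \<eta> 0)) \<in> A" unfolding A_def by (rule rev_image_eqI) simp
    then have "1 / \<eta> 0 \<in> A" using pos[of 0] by (simp add: norm_divide)
    then have A: "A \<noteq> {}" "1 / \<eta> 0 \<le> Sup A" using cSup_upper[OF _ bdd] by auto
    then have S: "Sup A > 0" using pos[of 0] by (smt (verit) divide_pos_pos)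
    have "1 / Sup A \<le> D * \<eta> s"
      using C0[OF s] es unfolding aw D_def by (smt (verit) mult_right_mono)
    then have "1 / (D * \<eta> s) \<le> Sup A" using S es by (simp add: D_def field_simps)
    moreover have Dp: "D * \<eta> s > 0" using es by (simp add: D_def)
    ultimately have "1 / (2 * D * \<eta> s) < Sup A" by (simp add: field_simps)
    then obtain g where g: "g \<in> G" "1 / (2 * D * \<eta> s) < cmod (g (of_real s))"
      using less_cSup_iff[OF A(1) bdd] unfolding A_def by auto
    then have hol: "g holomorphic_on UNIV" and gb: "\<And>z. cmod (g z) \<le> 1 / \<eta> (cmod z)" by (auto simp: G_def)
    let ?a = "taylor_coeff g"
    have ub: "cmod (?a k) * r ^ k \<le> 1 / \<eta> r" if r: "r \<ge> 0" for k r
    proof (cases "r = 0")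
      case True
      then show ?thesis using gb[of 0] pos[of 0] by (cases k) (auto simp: taylor_coeff_0)
    next
      case False
      then show ?thesis using r gb by (intro taylor_coeff_bound[OF hol]) auto
    qed
    \<comment> \<open>The chosen g has |g(s)| > 2m. If all coefficients had |a_k| (2s)^k < m,
      summing |a_k| s^k < 2^-k m would give |g(s)| \<le> 2m. Hence some single term is large at 2s,
      with the constant 4 D.\<close>
    define m where "m = 1 / (4 * D * \<eta> s)"
    have "\<exists>k. m \<le> cmod (?a k) * (2 * s) ^ k"
    proof (rule ccontr)
      assume "\<not> ?thesis"
      then have lt: "cmod (?a k) * (2 * s) ^ k < m" for k by (simp add: not_le)
      have "cmod (g (of_real s)) \<le> m * (1 / (1 - 1 / 2))"
      proof (rule norm_sums_le[OF taylor_coeff_sums[OF hol] sums_mult[OF geometric_sums]])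
        fix k
        have "cmod (?a k) * s ^ k = (1 / 2) ^ k * (cmod (?a k) * (2 * s) ^ k)"
          by (simp add: power_mult_distrib power_one_over)
        also have "\<dots> \<le> (1 / 2) ^ k * m" using lt[of k] by (intro mult_left_mono) auto
        finally show "cmod (?a k * of_real s ^ k) \<le> m * (1 / 2) ^ k"
          using s by (simp add: norm_mult norm_power mult.commute)
      qed simp
      then show False using g(2) by (simp add: m_def)
    qed
    then obtain k where k: "m \<le> cmod (?a k) * (2 * s) ^ k" by blast
    have m: "m > 0" using Dp by (simp add: m_def mult.assoc)
    show ?thesis
    proof (intro exI conjI allI impI)
      have "cmod (?a k) \<noteq> 0" using k m by auto
      moreover have "D > 0" by (simp add: D_def)
      ultimately show "0 < 4 * D * cmod (?a k)" by simp
      have "1 / \<eta> s = 4 * D * m" using es by (simp add: m_def D_def)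
      also have "\<dots> \<le> 4 * D * (cmod (?a k) * (2 * s) ^ k)" using k by (intro mult_left_mono) (auto simp: D_def)
      finally show "1 / \<eta> s \<le> 4 * D * cmod (?a k) * (2 * s) ^ k" by (simp add: mult.assoc)
      fix r :: real assume "r \<ge> 0"
      from mult_left_mono[OF ub[OF this, of k], of "4 * D"]
      show "4 * D * cmod (?a k) * r ^ k \<le> 4 * D / \<eta> r" by (simp add: D_def mult.assoc)
    qed
  qed
  moreover have "4 * D \<ge> 1" by (simp add: D_def)
  ultimately show ?thesis by blast
qed

end

section \<open>Gliding hump with powers of a linear functional\<close>

lemma entire_clinear:
  assumes "Vector_Spaces.linear scaleC (*) l" "\<And>x. cmod (l x) \<le> norm x"
  shows "entire_on_banach l"
proof (rule entire_bounded_linear)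
  have "l (r *\<^sub>R x) = r *\<^sub>R l x" for r x
    using assms(1) unfolding clinear_iff by (metis scaleC_of_real scaleR_conv_of_real)
  then show "bounded_linear l" using assms unfolding clinear_iff
    by (intro bounded_linear_intro[of l 1]) auto
qed (use assms(1) in \<open>simp add: clinear_iff\<close>)

lemma entire_power:
  assumes "entire_on_banach f"
  shows "entire_on_banach (\<lambda>x. f x ^ n)"
  unfolding entire_on_banach_def clinear_iff
proof
  fix x
  obtain D where D: "(f has_derivative D) (at x)" "Vector_Spaces.linear scaleC (*) D"
    using assms(1) unfolding entire_on_banach_def by meson
  show "\<exists>D. ((\<lambda>x. f x ^ n) has_derivative D) (at x) \<and>
        (\<forall>x y. D (x + y) = D x + D y) \<and> (\<forall>c x. D (scaleC c x) = c * D x)"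
    using has_derivative_power[OF D(1), of n] D(2)
    by (intro exI[of _ "\<lambda>y. of_nat n * D y * f x ^ (n - 1)"]) (simp add: clinear_iff algebra_simps)
qed

text \<open>The function is the sum of 2^-j c_j l^(k_j). The bounds on the monomials make it
  converge against every u m, while on the ray through x0 all terms are nonnegative, so f dominates
  each single one of them there.\<close>

lemma monomial_series_in_weighted_space:
  fixes l :: "'a::complex_banach \<Rightarrow> complex" and u :: "nat \<Rightarrow> real \<Rightarrow> real"
  assumes l: "Vector_Spaces.linear scaleC (*) l" "\<And>x. cmod (l x) \<le> norm x" "l x0 = 1"
    and u: "\<And>m t. 0 \<le> t \<Longrightarrow> 0 < u m t" "\<And>m s t. 0 \<le> s \<Longrightarrow> s \<le> t \<Longrightarrow> u m t \<le> u m s"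
      "\<And>m k. \<exists>D. \<forall>t\<ge>0. t ^ k * u m t \<le> D"
    and c: "\<And>j. 0 \<le> c j" "\<And>m. \<exists>D. \<forall>j\<ge>m. \<forall>t\<ge>0. c j * t ^ k j * u m t \<le> D"
  shows "\<exists>f\<in>weighted_space (range (\<lambda>m x. u m (norm x))).
    \<forall>j. \<forall>t\<ge>0. (1/2) ^ j * (c j * t ^ k j) \<le> cmod (f (t *\<^sub>R x0))"
proof -
  \<comment> \<open>The bound against u m is assumed only from index m on; the finitely many earlier
    monomials are bounded by rapid decay of u m.\<close>
  have all: "\<exists>D. \<forall>j. \<forall>t\<ge>0. c j * t ^ k j * u m t \<le> D" for m
  proof -
    obtain D where D: "\<And>j t. j \<ge> m \<Longrightarrow> t \<ge> 0 \<Longrightarrow> c j * t ^ k j * u m t \<le> D" using c(2) by meson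
    have "\<exists>E. \<forall>t\<ge>0. c j * t ^ k j * u m t \<le> E" for j
    proof -
      obtain E where "\<And>t. t \<ge> 0 \<Longrightarrow> t ^ k j * u m t \<le> E" using u(3) by meson
      then have "c j * (t ^ k j * u m t) \<le> c j * E" if "t \<ge> 0" for t using c(1) that by (intro mult_left_mono) auto
      then show ?thesis by (auto simp: mult.assoc)
    qed
    then obtain E where E: "\<And>j t. t \<ge> 0 \<Longrightarrow> c j * t ^ k j * u m t \<le> E j" by metis
    have "c j * t ^ k j * u m t \<le> \<bar>D\<bar> + (\<Sum>i<m. \<bar>E i\<bar>)" if t: "t \<ge> 0" for j t
    proof (cases "j \<ge> m")
      case True
      moreover have "0 \<le> (\<Sum>i<m. \<bar>E i\<bar>)" by (intro sum_nonneg) auto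
      ultimately show ?thesis using D[OF True t] by linarith
    next
      case False
      then have "\<bar>E j\<bar> \<le> (\<Sum>i<m. \<bar>E i\<bar>)" by (intro member_le_sum) auto
      then show ?thesis using E[OF t, of j] by simp
    qed
    then show ?thesis by blast
  qed
  define q where "q j x = (of_real ((1/2) ^ j * c j) :: complex) * l x ^ k j" for j x
  define f where "f x = (\<Sum>j. q j x)" for x
  have nq: "cmod (q j x) \<le> (1/2) ^ j * (c j * norm x ^ k j)" for j x
    using power_mono[OF l(2)[of x], of "k j"] c(1)[of j] unfolding q_def norm_mult norm_of_real norm_power
    by (simp add: mult_left_mono abs_mult mult.assoc)
  have qb: "cmod (q j x) \<le> (1/2) ^ j * (D / u m t)"
    if "\<And>j t. t \<ge> 0 \<Longrightarrow> c j * t ^ k j * u m t \<le> D" "norm x \<le> t" for j x D m t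
  proof -
    have t: "0 \<le> t" using that(2) norm_ge_zero order_trans by blast
    have "c j * norm x ^ k j \<le> c j * t ^ k j" using that(2) c(1) by (intro mult_left_mono power_mono) auto
    also have "\<dots> \<le> D / u m t" using that(1)[OF t, of j] u(1)[OF t, of m] by (simp add: pos_le_divide_eq)
    finally show ?thesis using nq[of j x] by (smt (verit) mult_left_mono zero_le_power half_gt_zero)
  qed
  have geo: "summable (\<lambda>j. (1/2::real) ^ j * C)" for C by (intro summable_mult2 summable_geometric) auto
  have summ: "summable (\<lambda>j. cmod (q j x))" for x
  proof -
    obtain D where D: "\<And>j t. t \<ge> 0 \<Longrightarrow> c j * t ^ k j * u 0 t \<le> D" using all by meson
    show ?thesis
      by (rule summable_comparison_test'[OF geo[of "D / u 0 (norm x)"], of 0]) (use qb[OF D order_refl] in auto)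
  qed
  have ent: "entire_on_banach f"
  proof (rule entire_on_banach_locally_uniform_limit)
    show "entire_on_banach (\<lambda>x. \<Sum>j<n. q j x)" for n
      unfolding q_def by (intro entire_sum entire_cmult entire_power entire_clinear l)
    fix x :: 'a
    obtain D where D: "\<And>j t. t \<ge> 0 \<Longrightarrow> c j * t ^ k j * u 0 t \<le> D" using all by meson
    have "uniform_limit (cball x 1) (\<lambda>n x. \<Sum>j<n. q j x) f sequentially"
      unfolding f_def
    proof (rule Weierstrass_m_test[OF _ geo])
      fix n y assume "y \<in> cball x 1"
      then have "norm y \<le> norm x + 1" using norm_triangle_sub[of y x] by (simp add: dist_norm norm_minus_commute)
      then show "cmod (q n y) \<le> (1/2) ^ n * (D / u 0 (norm x + 1))" using qb[OF D] by blast
    qed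
    then show "\<exists>r>0. uniform_limit (cball x r) (\<lambda>n x. \<Sum>j<n. q j x) f sequentially"
      using zero_less_one by blast
  qed
  have "bdd_above (range (\<lambda>x. u m (norm x) * cmod (f x)))" for m
  proof -
    obtain D where D: "\<And>j t. t \<ge> 0 \<Longrightarrow> c j * t ^ k j * u m t \<le> D" using all by meson
    have "u m (norm x) * cmod (f x) \<le> 2 * D" for x
    proof -
      have "cmod (f x) \<le> 1 / (1 - 1/2) * (D / u m (norm x))"
        unfolding f_def
        by (rule norm_sums_le[OF summable_sums[OF summable_norm_cancel[OF summ]] sums_mult2[OF geometric_sums]])
          (use qb[OF D order_refl] in auto)
      then show ?thesis using u(1)[of "norm x" m] by (simp add: field_simps)
    qed
    then show ?thesis by (intro bdd_aboveI[of _ "2 * D"]) auto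
  qed
  then have "f \<in> weighted_space (range (\<lambda>m x. u m (norm x)))" using ent by (auto simp: weighted_space_def)
  moreover have "(1/2) ^ j * (c j * t ^ k j) \<le> cmod (f (t *\<^sub>R x0))" if t: "t \<ge> 0" for j t
  proof -
    have lt: "l (t *\<^sub>R x0) = of_real t" using l(1,3) unfolding clinear_iff by (metis scaleC_of_real mult_1_right)
    define p where "p j = (1/2) ^ j * (c j * t ^ k j)" for j
    have p0: "p j \<ge> 0" for j using c(1) t by (simp add: p_def)
    have qp: "q j (t *\<^sub>R x0) = of_real (p j)" for j by (simp add: q_def p_def lt)
    have sp: "summable p" using summ[of "t *\<^sub>R x0"] p0 by (simp add: qp)
    have "f (t *\<^sub>R x0) = of_real (suminf p)" unfolding f_def qp by (rule suminf_of_real[symmetric, OF sp])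
    moreover have "p j \<le> suminf p" using sum_le_suminf[OF sp, of "{j}"] p0 by simp
    ultimately show ?thesis using p0[of j] by (simp add: p_def)
  qed
  ultimately show ?thesis by blast
qed

text \<open>The contradiction behind both comparisons of weights: peaks of at least 4^j against w
  survive the factor 2^-j as 2^j, although f was shown to lie in a space whose members are bounded
  against w.\<close>

lemma monomial_comparison:
  fixes u :: "nat \<Rightarrow> real \<Rightarrow> real"
  assumes nz: "\<exists>x::'a::complex_banach. x \<noteq> 0"
    and u: "\<And>m t. 0 \<le> t \<Longrightarrow> 0 < u m t" "\<And>m s t. 0 \<le> s \<Longrightarrow> s \<le> t \<Longrightarrow> u m t \<le> u m s"
      "\<And>m k. \<exists>D. \<forall>t\<ge>0. t ^ k * u m t \<le> D"
    and c: "\<And>j. 0 \<le> c j" "\<And>m. \<exists>D. \<forall>j\<ge>m. \<forall>t\<ge>0. c j * t ^ k j * u m t \<le> D"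
    and w: "\<And>f :: 'a \<Rightarrow> complex. f \<in> weighted_space (range (\<lambda>m x. u m (norm x)))
      \<Longrightarrow> bdd_above (range (\<lambda>x. w (norm x) * cmod (f x)))" "\<And>t. 0 \<le> t \<Longrightarrow> 0 \<le> w t"
    and t: "\<And>j. 0 \<le> t j" "\<And>j. 4 ^ j \<le> c j * t j ^ k j * w (t j)"
  shows False
proof -
  obtain x :: 'a where "x \<noteq> 0" using nz by blast
  define x0 where "x0 = sgn x"
  have x0: "norm x0 = 1" using \<open>x \<noteq> 0\<close> by (simp add: x0_def norm_sgn)
  obtain l where l: "Vector_Spaces.linear scaleC (*) l" "\<And>x. cmod (l x) \<le> norm x" "l x0 = 1"
    using norming_functional_exists[of x0] x0 by auto
  from monomial_series_in_weighted_space[OF l u c] obtain f where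
    f: "f \<in> weighted_space (range (\<lambda>m x. u m (norm x)))"
      "\<And>j t. t \<ge> 0 \<Longrightarrow> (1/2) ^ j * (c j * t ^ k j) \<le> cmod (f (t *\<^sub>R x0))" by blast
  obtain B where B: "\<And>x. w (norm x) * cmod (f x) \<le> B"
    using w(1)[OF f(1)] unfolding bdd_above_def by blast
  have "2 ^ j \<le> B" for j
  proof -
    have "(2::real) ^ j = (1/2) ^ j * 4 ^ j" by (simp flip: power_mult_distrib)
    also have "\<dots> \<le> (1/2) ^ j * (c j * t j ^ k j * w (t j))" using t(2) by (intro mult_left_mono) auto
    also have "\<dots> = w (t j) * ((1/2) ^ j * (c j * t j ^ k j))" by simp
    also have "\<dots> \<le> w (t j) * cmod (f (t j *\<^sub>R x0))" using t(1) w(2) f(2) by (intro mult_left_mono) auto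
    also have "\<dots> \<le> B" using B[of "t j *\<^sub>R x0"] t(1)[of j] x0 by simp
    finally show ?thesis .
  qed
  moreover obtain j where "B < 2 ^ j" using real_arch_pow[of 2 B] by auto
  ultimately show False by (meson not_less)
qed

lemma weighted_spaceD:
  "f \<in> weighted_space V \<Longrightarrow> v \<in> V \<Longrightarrow> bdd_above (range (\<lambda>x. v x * cmod (f x)))"
  by (simp add: weighted_space_def)

lemma positive_index_range: "{g n | n. 1 \<le> n} = range (\<lambda>m. g (Suc m))" for g :: "nat \<Rightarrow> 'b"
proof (intro equalityI subsetI)
  fix y assume "y \<in> {g n | n. 1 \<le> n}"
  then obtain n where "y = g n" "1 \<le> n" by blast
  then show "y \<in> range (\<lambda>m. g (Suc m))" by (intro image_eqI[of _ _ "n - 1"]) auto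
qed auto

lemma root_weights_range: "root_weights \<eta> = range (\<lambda>m x. root (Suc m) (\<eta> (norm x)))"
  unfolding root_weights_def by (rule positive_index_range)

lemma dilated_weights_range: "dilated_weights \<eta> = range (\<lambda>m x. \<eta> (norm x / real (Suc m)))"
  unfolding dilated_weights_def by (rule positive_index_range)

section \<open>Comparison of roots and dilations of the weight, and the resulting growth
  bounds\<close>

context weight
begin

lemma root_power_bound:
  assumes "n > 0"
  shows "\<exists>D. \<forall>t\<ge>0. t ^ k * root n (\<eta> t) \<le> D"
proof -
  obtain D where D: "\<And>t. t \<ge> 0 \<Longrightarrow> t ^ (k * n) * \<eta> t \<le> D" using power_bound by meson
  have "t ^ k * root n (\<eta> t) \<le> root n D" if "t \<ge> 0" for t
  proof -
    have "t ^ k * root n (\<eta> t) = root n (t ^ (k * n) * \<eta> t)"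
      using assms that by (simp add: real_root_mult power_mult real_root_power_cancel)
    then show ?thesis using D[OF that] assms by simp
  qed
  then show ?thesis by blast
qed

lemma dilated_power_bound:
  assumes "n > 0"
  shows "\<exists>D. \<forall>t\<ge>0. t ^ k * \<eta> (t / real n) \<le> D"
proof -
  obtain D where D: "\<And>t. t \<ge> 0 \<Longrightarrow> t ^ k * \<eta> t \<le> D" using power_bound by meson
  have "t ^ k * \<eta> (t / real n) \<le> real n ^ k * D" if "t \<ge> 0" for t
  proof -
    have "t ^ k * \<eta> (t / real n) = real n ^ k * ((t / real n) ^ k * \<eta> (t / real n))"
      using assms by (simp add: power_divide)
    also have "\<dots> \<le> real n ^ k * D" using D that by (intro mult_left_mono) auto
    finally show ?thesis .
  qed
  then show ?thesis by blast
qed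

text \<open>If domination fails for every dilation and constant, each failure point t yields a
  monomial: a minorant found at a dilate of t, rescaled so that it lies below C / \<eta>(r/(j+1))
  everywhere and is large at t against the N-th root.\<close>

lemma root_dominated_by_dilation:
  assumes nz: "\<exists>x::'a::complex_banach. x \<noteq> 0" and ess: "essential \<eta>" and N: "N \<ge> 1"
    and sub: "weighted_space (dilated_weights \<eta>) \<subseteq> (weighted_space (root_weights \<eta>) :: ('a \<Rightarrow> complex) set)"
  shows "\<exists>m\<ge>1. \<exists>C. \<forall>t\<ge>0. root N (\<eta> t) \<le> C * \<eta> (t / real m)"
proof (rule ccontr)
  assume "\<not> ?thesis"
  then have neg: "\<And>m C. m \<ge> 1 \<Longrightarrow> \<exists>t\<ge>0. C * \<eta> (t / real m) < root N (\<eta> t)" by (meson not_le)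
  obtain C where C: "\<And>s. s \<ge> 0 \<Longrightarrow> \<exists>k a. 0 < a \<and> 1 / \<eta> s \<le> a * (2 * s) ^ k \<and> (\<forall>r\<ge>0. a * r ^ k \<le> C / \<eta> r)"
    using essential_monomial_minorants[OF ess] by meson
  have "\<exists>t k c. t \<ge> 0 \<and> c \<ge> 0 \<and> (\<forall>r\<ge>0. c * r ^ k \<le> C / \<eta> (r / real (Suc j))) \<and> 4 ^ j \<le> c * t ^ k * root N (\<eta> t)" for j
  proof -
    \<comment> \<open>The dilation 2(j+1) absorbs the 2 of the monomial minorants: with s =
      t/(2(j+1)) they are large at 2s = t/(j+1). The constant 4^j is the height of the hump.\<close>
    obtain t where t: "t \<ge> 0" "4 ^ j * \<eta> (t / real (2 * Suc j)) < root N (\<eta> t)" using neg[of "2 * Suc j" "4 ^ j"] by auto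
    define s where "s = t / real (2 * Suc j)"
    have s: "s \<ge> 0" using t(1) by (simp add: s_def)
    obtain k a where ka: "0 < a" "1 / \<eta> s \<le> a * (2 * s) ^ k" "\<And>r. r \<ge> 0 \<Longrightarrow> a * r ^ k \<le> C / \<eta> r" using C[OF s] by blast
    define c where "c = a / real (Suc j) ^ k"
    have cr: "c * r ^ k = a * (r / real (Suc j)) ^ k" for r by (simp add: c_def power_divide)
    have "4 ^ j = 1 / \<eta> s * (4 ^ j * \<eta> s)" using pos[OF s] by simp
    also have "\<dots> \<le> a * (2 * s) ^ k * root N (\<eta> t)"
      using ka(1,2) t(2)[folded s_def] pos[OF s] s by (intro mult_mono) auto
    also have "2 * s = t / real (Suc j)" unfolding s_def of_nat_mult by (simp del: of_nat_Suc)
    also have "a * (t / real (Suc j)) ^ k = c * t ^ k" unfolding cr ..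
    finally have "4 ^ j \<le> c * t ^ k * root N (\<eta> t)" .
    moreover have "c \<ge> 0" using ka by (simp add: c_def)
    moreover have "c * r ^ k \<le> C / \<eta> (r / real (Suc j))" if "r \<ge> 0" for r unfolding cr using that by (intro ka) simp
    ultimately show ?thesis using t(1) by blast
  qed
  then obtain t k c where tkc: "\<And>j. t j \<ge> 0" "\<And>j. c j \<ge> 0"
    "\<And>j r. r \<ge> 0 \<Longrightarrow> c j * r ^ k j \<le> C / \<eta> (r / real (Suc j))" "\<And>j. 4 ^ j \<le> c j * t j ^ k j * root N (\<eta> (t j))" by metis
  show False
  proof (rule monomial_comparison[OF nz, of "\<lambda>m t. \<eta> (t / real (Suc m))" c k "\<lambda>t. root N (\<eta> t)" t])
    show "\<exists>D. \<forall>j\<ge>m. \<forall>t\<ge>0. c j * t ^ k j * \<eta> (t / real (Suc m)) \<le> D" for m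
    proof (intro exI[of _ C] allI impI)
      fix j and r :: real assume j: "m \<le> j" and r: "0 \<le> r"
      have p: "\<eta> (r / real (Suc m)) > 0" "\<eta> (r / real (Suc j)) > 0" using pos r by auto
      \<comment> \<open>A stronger dilation gives a larger weight, so the bound for dilation j+1
        serves all indices m \<le> j with the same constant C.\<close>
      have le: "\<eta> (r / real (Suc m)) \<le> \<eta> (r / real (Suc j))"
        using r j by (intro decreasing) (auto intro!: divide_left_mono simp del: of_nat_Suc)
      have "c j * r ^ k j * \<eta> (r / real (Suc m)) \<le> c j * r ^ k j * \<eta> (r / real (Suc j))"
        using le tkc(2) r by (intro mult_left_mono) auto
      also have "\<dots> \<le> C" using tkc(3)[OF r, of j] p by (simp add: field_simps)
      finally show "c j * r ^ k j * \<eta> (r / real (Suc m)) \<le> C" .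
    qed
    fix f :: "'a \<Rightarrow> complex" assume "f \<in> weighted_space (range (\<lambda>m x. \<eta> (norm x / real (Suc m))))"
    then have "f \<in> weighted_space (root_weights \<eta>)" using sub by (auto simp: dilated_weights_range)
    moreover have "(\<lambda>x::'a. root N (\<eta> (norm x))) \<in> root_weights \<eta>" using N by (auto simp: root_weights_def)
    ultimately show "bdd_above (range (\<lambda>x. root N (\<eta> (norm x)) * cmod (f x)))" by (rule weighted_spaceD)
  next
    show "\<eta> (t / real (Suc m)) \<le> \<eta> (s / real (Suc m))" if "0 \<le> s" "s \<le> t" for m s t
      using that by (intro decreasing divide_right_mono) auto
  qed (use tkc pos N in \<open>auto intro: dilated_power_bound less_imp_le simp del: of_nat_Suc\<close>)
qed

text \<open>Here the weights are roots of \<open>\<eta>\<close>: the monomial of degree \<open>K\<close> minorising \<open>1 / \<eta>\<close> at \<open>s\<close> is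
  raised to the power \<open>\<theta> = k / K\<close>, where \<open>k = K div J\<close> is the integer making \<open>\<theta>\<close> comparable to
  \<open>1 / J\<close>. This needs \<open>K \<ge> J\<close>, which holds for large \<open>s\<close> because \<open>\<eta>\<close> decreases rapidly.\<close>

lemma doubling_condition:
  assumes nz: "\<exists>x::'a::complex_banach. x \<noteq> 0" and ess: "essential \<eta>"
    and sub: "weighted_space (root_weights \<eta>) \<subseteq> (weighted_space (dilated_weights \<eta>) :: ('a \<Rightarrow> complex) set)"
  shows "\<exists>m::nat. m \<ge> 1 \<and> (\<exists>C. \<forall>s\<ge>0. - ln (\<eta> s) \<le> real m * (- ln (\<eta> (s / 2))) + C)"
proof (rule ccontr)
  define \<phi> where "\<phi> t = - ln (\<eta> t)" for t
  assume "\<not> ?thesis"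
  then have neg: "\<exists>s\<ge>0. real m * \<phi> (s / 2) + C < \<phi> s" if "m \<ge> 1" for m C
    using that by (simp only: \<phi>_def) (meson not_le)
  have ephi: "exp (\<phi> t) = 1 / \<eta> t" if "t \<ge> 0" for t using pos[OF that] by (simp add: \<phi>_def exp_minus inverse_eq_divide)
  have mono: "\<phi> s \<le> \<phi> t" if "0 \<le> s" "s \<le> t" for s t
    using pos[of s] pos[of t] decreasing[OF that] that by (simp add: \<phi>_def)
  obtain C where C1: "C \<ge> 1" and C: "\<And>s. s \<ge> 0 \<Longrightarrow> \<exists>k a. 0 < a \<and> 1 / \<eta> s \<le> a * (2 * s) ^ k \<and> (\<forall>r\<ge>0. a * r ^ k \<le> C / \<eta> r)"
    using essential_monomial_minorants[OF ess] by meson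
  \<comment> \<open>\<eta> may exceed 1, so \<phi> may be negative; the shift by b makes \<phi> + b
    nonnegative.\<close>
  define b where "b = max 0 (- \<phi> 0)"
  have b: "b \<ge> 0" "\<And>t. t \<ge> 0 \<Longrightarrow> - b \<le> \<phi> t" using mono[of 0] by (auto simp: b_def) (smt (verit))
  have "\<exists>t k c. t \<ge> 0 \<and> c \<ge> 0 \<and> (\<forall>r\<ge>0. c * r ^ k \<le> C * exp ((\<phi> r + b) / real (Suc j))) \<and> 4 ^ j \<le> c * t ^ k * \<eta> (t / 4)" for j
  proof -
    define J where "J = Suc j"
    have J: "J \<ge> 1" by (simp add: J_def)
    have "((\<lambda>t. C / \<eta> 1 * (t ^ 0 * \<eta> t + 2 ^ J * (t ^ J * \<eta> t))) \<longlongrightarrow> C / \<eta> 1 * (0 + 2 ^ J * 0)) at_top"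
      by (intro tendsto_intros rapid)
    then have "\<forall>\<^sub>F t in at_top. C / \<eta> 1 * (t ^ 0 * \<eta> t + 2 ^ J * (t ^ J * \<eta> t)) < 1"
      by (rule order_tendstoD(2)) simp
    then have "\<forall>\<^sub>F t in at_top. C / \<eta> 1 * (t ^ 0 * \<eta> t + 2 ^ J * (t ^ J * \<eta> t)) < 1 \<and> t ^ 0 * \<eta> t < 1"
      using order_tendstoD(2)[OF rapid[of 0] zero_less_one] by (rule eventually_conj)
    then obtain T0 where T0: "\<And>t. t \<ge> T0 \<Longrightarrow> C / \<eta> 1 * (t ^ 0 * \<eta> t + 2 ^ J * (t ^ J * \<eta> t)) < 1 \<and> t ^ 0 * \<eta> t < 1"
      unfolding eventually_at_top_linorder by blast
    define T where "T = max T0 0"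
    \<comment> \<open>The additive constant has three duties: j ln 4 becomes the height 4^j, 2 J b
      compensates a negative \<phi>(s/2), and |\<phi> T| then gives \<phi>(s) > \<phi>(T), so that s
      lies beyond the threshold T0.\<close>
    obtain s where s0: "s \<ge> 0" and s: "real (2 * J) * \<phi> (s / 2) + (real (2 * J) * (real j * ln 4) + real (2 * J) * b + \<bar>\<phi> T\<bar>) < \<phi> s"
      using neg[of "2 * J"] J by (metis mult_2 trans_le_add1)
    have "- (real (2 * J) * b) \<le> real (2 * J) * \<phi> (s / 2)"
      using mult_left_mono[OF b(2)[of "s / 2"], of "real (2 * J)"] s0 by simp
    moreover have "0 \<le> real (2 * J) * (real j * ln 4)" by simp
    ultimately have "\<phi> T < \<phi> s" using s by linarith
    then have sT: "T0 \<le> s" using mono[of s T] s0 unfolding T_def by (smt (verit))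
    have es: "\<eta> s > 0" "\<eta> s < 1" using T0[OF sT] pos[OF s0] by auto
    have phis: "\<phi> s \<ge> 0" using es by (simp add: \<phi>_def)
    obtain K a where a: "0 < a" "1 / \<eta> s \<le> a * (2 * s) ^ K" "\<And>r. r \<ge> 0 \<Longrightarrow> a * r ^ K \<le> C / \<eta> r" using C[OF s0] by blast
    \<comment> \<open>Taking r = 1 gives a \<le> C / \<eta>(1). A degree K < J would therefore bound
      1/\<eta>(s) by a fixed polynomial of degree J, contradicting the choice of T0; the summand 1
      covers 2s \<le> 1.\<close>
    have KJ: "K \<ge> J"
    proof (rule ccontr)
      assume "\<not> K \<ge> J"
      have "(2 * s) ^ K \<le> 1 + (2 * s) ^ J"
      proof (cases "2 * s \<le> 1")
        case True
        then show ?thesis using s0 power_le_one[of "2 * s" K] zero_le_power[of "2 * s" J] by linarith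
      next
        case False
        then show ?thesis using power_increasing[of K J "2 * s"] \<open>\<not> K \<ge> J\<close> by simp
      qed
      moreover have "a \<le> C / \<eta> 1" using a(3)[of 1] by simp
      ultimately have "a * (2 * s) ^ K \<le> C / \<eta> 1 * (1 + (2 * s) ^ J)"
        using a(1) s0 by (intro mult_mono) auto
      then have "1 / \<eta> s \<le> C / \<eta> 1 * (1 + (2 * s) ^ J)" using a(2) by linarith
      then have "1 \<le> C / \<eta> 1 * (1 + (2 * s) ^ J) * \<eta> s" using es(1) by (simp add: pos_divide_le_eq)
      also have "\<dots> = C / \<eta> 1 * (s ^ 0 * \<eta> s + 2 ^ J * (s ^ J * \<eta> s))" by (simp add: power_mult_distrib algebra_simps)
      finally show False using T0[OF sT] by simp
    qed
    define k where "k = K div J"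
    have k1: "k \<ge> 1" using KJ J by (simp add: k_def div_greater_zero_iff Suc_le_eq)
    have kJ: "k * J \<le> K" by (simp add: k_def)
    have "K < k * J + J" unfolding k_def using J by (metis dividend_less_times_div add.commute mult.commute mult_Suc less_le_trans zero_less_one)
    moreover have "J \<le> k * J" using k1 by simp
    ultimately have "K \<le> 2 * (k * J)" by linarith
    then have K2: "K \<le> 2 * J * k" by (simp add: mult_ac)
    have Kp: "K > 0" using KJ J by simp
    \<comment> \<open>The upper bound 1/J keeps the new monomial below a multiple of exp((\<phi> r +
      b)/J); the lower bound 1/(2J), caused by rounding in K div J, secures its size at 2s. This is
      why the failing inequality was used with the factor 2J.\<close>
    define \<theta> where "\<theta> = real k / real K"
    have th0: "\<theta> > 0" using k1 Kp by (simp add: \<theta>_def)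
    have th1: "\<theta> \<le> 1 / real J" using kJ Kp J unfolding \<theta>_def by (simp add: divide_simps flip: of_nat_mult)
    have th2: "1 / real (2 * J) \<le> \<theta>" using K2 Kp J unfolding \<theta>_def by (simp add: divide_simps mult_ac flip: of_nat_mult)
    have th3: "\<theta> \<le> 1" using th1 J by (smt (verit) divide_le_eq_1 of_nat_1 of_nat_le_iff)
    define c where "c = a powr \<theta>"
    have cr: "c * r ^ k = (a * r ^ K) powr \<theta>" if "r \<ge> 0" for r
    proof (cases "r = 0")
      case True
      then show ?thesis using k1 Kp by (simp add: power_0_left)
    next
      case False
      then have "(r ^ K) powr \<theta> = r powr real k"
        using that Kp by (simp add: powr_powr \<theta>_def flip: powr_realpow)
      then show ?thesis using that False a(1) by (simp add: c_def powr_mult powr_realpow)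
    qed
    have "c * r ^ k \<le> C * exp ((\<phi> r + b) / real (Suc j))" if r: "r \<ge> 0" for r
    proof -
      have "c * r ^ k \<le> (C / \<eta> r) powr \<theta>" unfolding cr[OF r] using a r th0 by (intro powr_mono2) auto
      also have "\<dots> = C powr \<theta> * exp (\<phi> r) powr \<theta>"
        using C1 pos[OF r] by (simp add: ephi[OF r] powr_divide)
      also have "C powr \<theta> \<le> C powr 1" using C1 th3 by (intro powr_mono) auto
      also have "exp (\<phi> r) powr \<theta> = exp (\<theta> * \<phi> r)" by (simp add: powr_def)
      also have "\<theta> * \<phi> r \<le> \<theta> * (\<phi> r + b)" using th0 b(1) by (simp add: algebra_simps)
      also have "\<dots> \<le> 1 / real J * (\<phi> r + b)" using th1 b(2)[OF r] by (intro mult_right_mono) auto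
      finally show ?thesis using C1 by (simp add: J_def mult_right_mono)
    qed
    \<comment> \<open>The dilation by 4 combines two factors of 2: the monomial is large at 2s,
      while the failing inequality compares with \<phi>(s/2).\<close>
    moreover have "4 ^ j \<le> c * (2 * s) ^ k * \<eta> (2 * s / 4)"
    proof -
      have "real j * ln 4 + \<phi> (s / 2) \<le> \<phi> s / real (2 * J)"
      proof -
        have "real (2 * J) * (real j * ln 4 + \<phi> (s / 2)) + (real (2 * J) * b + \<bar>\<phi> T\<bar>) < \<phi> s"
          using s by (simp add: algebra_simps)
        moreover have "0 \<le> real (2 * J) * b + \<bar>\<phi> T\<bar>" using b(1) by simp
        ultimately have "real (2 * J) * (real j * ln 4 + \<phi> (s / 2)) \<le> \<phi> s" by linarith
        then show ?thesis using J by (simp add: pos_le_divide_eq mult.commute)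
      qed
      also have "\<dots> \<le> \<theta> * \<phi> s" using mult_right_mono[OF th2 phis] by simp
      finally have "exp (real j * ln 4 + \<phi> (s / 2)) \<le> exp (\<theta> * \<phi> s)" by simp
      also have "\<dots> = (1 / \<eta> s) powr \<theta>" unfolding ephi[OF s0, symmetric] by (simp add: powr_def)
      also have "\<dots> \<le> c * (2 * s) ^ k" unfolding cr[OF mult_nonneg_nonneg[OF zero_le_numeral s0]]
        using a(2) es th0 by (intro powr_mono2) auto
      also have "exp (real j * ln 4 + \<phi> (s / 2)) = 4 ^ j / \<eta> (s / 2)"
        using s0 by (simp add: exp_add ephi exp_of_nat_mult)
      finally have "4 ^ j / \<eta> (s / 2) \<le> c * (2 * s) ^ k" .
      moreover have "2 * s / 4 = s / 2" by simp
      ultimately show ?thesis using pos[of "s / 2"] s0 by (simp add: pos_divide_le_eq)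
    qed
    moreover have "c \<ge> 0" by (simp add: c_def)
    moreover have "2 * s \<ge> 0" using s0 by simp
    ultimately show ?thesis by blast
  qed
  then obtain t k c where tkc: "\<And>j. t j \<ge> 0" "\<And>j. c j \<ge> 0"
    "\<And>j r. r \<ge> 0 \<Longrightarrow> c j * r ^ k j \<le> C * exp ((\<phi> r + b) / real (Suc j))" "\<And>j. 4 ^ j \<le> c j * t j ^ k j * \<eta> (t j / 4)" by metis
  have eroot: "root (Suc m) (\<eta> r) = exp (- \<phi> r / real (Suc m))" if "r \<ge> 0" for m r
    using pos[OF that] by (simp add: \<phi>_def root_powr_inverse powr_def del: of_nat_Suc)
  show False
  proof (rule monomial_comparison[OF nz, of "\<lambda>m t. root (Suc m) (\<eta> t)" c k "\<lambda>t. \<eta> (t / 4)" t])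
    show "\<exists>D. \<forall>j\<ge>m. \<forall>t\<ge>0. c j * t ^ k j * root (Suc m) (\<eta> t) \<le> D" for m
    \<comment> \<open>For j \<ge> m the exponent (\<phi>(r) + b)/(j+1) is at most \<phi>(r)/(m+1) +
      b. The root weight cancels the first summand, and exp b remains.\<close>
    proof (intro exI[of _ "C * exp b"] allI impI)
      fix j and r :: real assume j: "m \<le> j" and r: "0 \<le> r"
      have "(\<phi> r + b) / real (Suc j) \<le> (\<phi> r + b) / real (Suc m)"
        using b(2)[OF r] j by (intro divide_left_mono) auto
      also have "\<dots> = \<phi> r / real (Suc m) + b / real (Suc m)" by (rule add_divide_distrib)
      also have "b / real (Suc m) \<le> b" using b(1) by (simp add: field_simps)
      finally have "(\<phi> r + b) / real (Suc j) \<le> \<phi> r / real (Suc m) + b" by simp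
      then have "C * exp ((\<phi> r + b) / real (Suc j)) \<le> C * exp (\<phi> r / real (Suc m) + b)" using C1 by simp
      then have "c j * r ^ k j \<le> C * exp (\<phi> r / real (Suc m) + b)" using tkc(3)[OF r, of j] by linarith
      then have "c j * r ^ k j * root (Suc m) (\<eta> r) \<le> C * exp (\<phi> r / real (Suc m) + b) * exp (- \<phi> r / real (Suc m))"
        unfolding eroot[OF r] by (intro mult_right_mono) auto
      also have "\<dots> = C * exp b" by (simp add: mult.assoc flip: exp_add)
      finally show "c j * r ^ k j * root (Suc m) (\<eta> r) \<le> C * exp b" .
    qed
    fix f :: "'a \<Rightarrow> complex" assume "f \<in> weighted_space (range (\<lambda>m x. root (Suc m) (\<eta> (norm x))))"
    then have "f \<in> weighted_space (dilated_weights \<eta>)" using sub by (auto simp: root_weights_range)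
    moreover have "(\<lambda>x::'a. \<eta> (norm x / 4)) \<in> dilated_weights \<eta>"
      unfolding dilated_weights_def by (intro CollectI exI[of _ 4]) simp
    ultimately show "bdd_above (range (\<lambda>x. \<eta> (norm x / 4) * cmod (f x)))" by (rule weighted_spaceD)
  qed (use tkc pos in \<open>auto intro: root_power_bound less_imp_le decreasing simp del: of_nat_Suc\<close>)
qed

text \<open>Once the additive constant is absorbed, halving the argument costs a factor M. Iterating
  from t \<le> 2^k down to 1 bounds the modified -ln \<eta> by M^k times a constant, which is growth
  of order t^(log_2 M).\<close>

lemma lower_growth:
  assumes "m \<ge> 1" and dbl: "\<And>s. s \<ge> 0 \<Longrightarrow> - ln (\<eta> s) \<le> real m * (- ln (\<eta> (s / 2))) + C"
  shows "\<exists>a b \<alpha>. 0 < a \<and> 0 < b \<and> 0 < \<alpha> \<and> (\<forall>t\<ge>0. a * exp (- b * t powr \<alpha>) \<le> \<eta> t)"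
proof -
  define \<phi> where "\<phi> t = - ln (\<eta> t)" for t
  have mono: "\<phi> s \<le> \<phi> t" if "0 \<le> s" "s \<le> t" for s t
    using pos[of s] pos[of t] decreasing[OF that] that by (simp add: \<phi>_def)
  define b where "b = \<bar>\<phi> 0\<bar>"
  define M where "M = real m + 1"
  \<comment> \<open>The first b makes \<phi> + b nonnegative. The extra K = |C| + b is absorbed by
    2K \<le> MK, which is where M \<ge> 2 enters.\<close>
  define \<psi> where "\<psi> t = \<phi> t + b + (\<bar>C\<bar> + b)" for t
  have M2: "M \<ge> 2" using assms(1) by (simp add: M_def)
  have pb: "\<phi> t + b \<ge> 0" if "t \<ge> 0" for t using mono[of 0 t] that by (simp add: b_def)
  have psi0: "\<psi> t \<ge> 0" if "t \<ge> 0" for t using pb[OF that] by (simp add: \<psi>_def b_def)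
  have step: "\<psi> s \<le> M * \<psi> (s / 2)" if s: "s \<ge> 0" for s
  proof -
    have "\<phi> s \<le> real m * \<phi> (s / 2) + C" using dbl[OF s] by (simp add: \<phi>_def)
    moreover have "real m * \<phi> (s / 2) \<le> M * (\<phi> (s / 2) + b)"
    proof -
      have "0 \<le> real m * b" by (simp add: b_def)
      then show ?thesis using pb[of "s / 2"] s by (simp add: M_def algebra_simps)
    qed
    moreover have "2 * (\<bar>C\<bar> + b) \<le> M * (\<bar>C\<bar> + b)" using M2 by (intro mult_right_mono) (auto simp: b_def)
    moreover have "M * \<psi> (s / 2) = M * (\<phi> (s / 2) + b) + M * (\<bar>C\<bar> + b)" by (simp add: \<psi>_def algebra_simps)
    moreover have "C + b + b + \<bar>C\<bar> \<le> 2 * (\<bar>C\<bar> + b)" by simp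
    ultimately show ?thesis unfolding \<psi>_def[of s] by linarith
  qed
  have iter: "\<psi> t \<le> M ^ k * \<psi> 1" if "0 \<le> t" "t \<le> 2 ^ k" for t k
    using that
  proof (induction k arbitrary: t)
    case 0
    then show ?case using mono[of t 1] by (simp add: \<psi>_def)
  next
    case (Suc k)
    have "\<psi> t \<le> M * \<psi> (t / 2)" using Suc.prems by (intro step)
    also have "\<dots> \<le> M * (M ^ k * \<psi> 1)" using Suc.prems M2 by (intro mult_left_mono Suc.IH) auto
    finally show ?case by simp
  qed
  define \<alpha> where "\<alpha> = log 2 M"
  have \<alpha>: "\<alpha> > 0" using M2 by (simp add: \<alpha>_def)
  define B where "B = (\<psi> 1 + 1) * M"
  have B: "B > 0" using psi0[of 1] M2 by (simp add: B_def)
  have bound: "\<psi> t \<le> B + B * t powr \<alpha>" if t: "t \<ge> 0" for t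
  proof (cases "t \<le> 1")
    case True
    then have "\<psi> t \<le> \<psi> 1" using mono[of t 1] t by (simp add: \<psi>_def)
    also have "\<dots> \<le> (\<psi> 1 + 1) * M" using M2 psi0[of 1] mult_mono[of "\<psi> 1" "\<psi> 1 + 1" 1 M] by simp
    finally show ?thesis using B by (simp add: B_def add_increasing2)
  next
    case False
    \<comment> \<open>Rounding the logarithm up costs one further factor M, which is contained in
      B.\<close>
    define k where "k = nat \<lceil>log 2 t\<rceil>"
    have l0: "log 2 t > 0" using False by simp
    have k: "log 2 t \<le> real k" "real k \<le> log 2 t + 1" using l0 by (simp_all add: k_def)
    have "t = 2 powr (log 2 t)" using False by simp
    also have "\<dots> \<le> 2 powr real k" using k by (intro powr_mono) auto
    also have "\<dots> = 2 ^ k" by (simp add: powr_realpow)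
    finally have "\<psi> t \<le> M ^ k * \<psi> 1" using t by (intro iter)
    also have "M ^ k = M powr real k" using M2 by (simp add: powr_realpow)
    also have "\<dots> \<le> M powr (log 2 t + 1)" using k M2 by (intro powr_mono) auto
    also have "\<dots> = M * M powr (log 2 t)" using M2 by (simp add: powr_add)
    also have "M powr (log 2 t) = t powr \<alpha>"
      using M2 False by (simp add: powr_def \<alpha>_def log_def)
    finally have "\<psi> t \<le> M * t powr \<alpha> * \<psi> 1" using psi0[of 1] by (simp add: mult_right_mono)
    also have "\<dots> \<le> B * t powr \<alpha>" using M2 by (simp add: B_def algebra_simps)
    finally show ?thesis using B by simp
  qed
  have "exp (- B) * exp (- B * t powr \<alpha>) \<le> \<eta> t" if t: "t \<ge> 0" for t
  proof -
    have "\<phi> t \<le> \<psi> t" by (simp add: \<psi>_def b_def)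
    then have "exp (- B + - B * t powr \<alpha>) \<le> exp (- \<phi> t)" using bound[OF t] by simp
    also have "\<dots> = \<eta> t" using pos[OF t] by (simp add: \<phi>_def)
    finally show ?thesis by (simp only: exp_add)
  qed
  then show ?thesis using \<alpha> B by (intro exI[of _ "exp (- B)"] exI[of _ B] exI[of _ \<alpha>]) simp
qed

text \<open>Domination of the square root says that the rescaled weight at t is at most the square
  of its value at t/M. Starting from values below 1/e, each step doubles the exponent while t grows
  by M, which gives decay of order t^(log_M 2).\<close>

lemma upper_growth:
  assumes "m \<ge> 1" and dom: "\<And>t. t \<ge> 0 \<Longrightarrow> root 2 (\<eta> t) \<le> C * \<eta> (t / real m)"
  shows "\<exists>a b \<alpha>. 0 < a \<and> 0 < b \<and> 0 < \<alpha> \<and> (\<forall>t\<ge>0. \<eta> t \<le> a * exp (- b * t powr \<alpha>))"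
proof -
  \<comment> \<open>m may be 1, while the iteration and the logarithm to base M require M > 1.
    Enlarging the dilation is harmless since \<eta> decreases.\<close>
  define M where "M = real m + 1"
  have M2: "M \<ge> 2" using assms(1) by (simp add: M_def)
  have "0 < root 2 (\<eta> 0)" using pos[of 0] by simp
  also have "\<dots> \<le> C * \<eta> 0" using dom[of 0] by simp
  finally have "0 < C * \<eta> 0" .
  then have C: "C > 0" using pos[of 0] by (simp add: zero_less_mult_iff)
  \<comment> \<open>The factor C^2 turns the inequality into h(t) \<le> h(t/M)^2 without a
    constant.\<close>
  define h where "h t = C\<^sup>2 * \<eta> t" for t
  have hpos: "h t > 0" if "t \<ge> 0" for t using C pos[OF that] by (simp add: h_def)
  have step: "h t \<le> (h (t / M))\<^sup>2" if t: "t \<ge> 0" for t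
  proof -
    have "root 2 (\<eta> t) \<le> C * \<eta> (t / real m)" by (rule dom[OF t])
    also have "\<dots> \<le> C * \<eta> (t / M)"
      using C t assms(1) by (intro mult_left_mono decreasing) (auto simp: M_def intro!: divide_left_mono)
    finally have "(root 2 (\<eta> t))\<^sup>2 \<le> (C * \<eta> (t / M))\<^sup>2"
      using pos[OF t] by (intro power_mono) auto
    then have "\<eta> t \<le> (C * \<eta> (t / M))\<^sup>2" using pos[OF t] by (simp add: less_imp_le)
    then have "C\<^sup>2 * \<eta> t \<le> C\<^sup>2 * (C * \<eta> (t / M))\<^sup>2" by (intro mult_left_mono) auto
    then show ?thesis by (simp add: h_def power_mult_distrib power2_eq_square mult_ac)
  qed
  have "((\<lambda>t. C\<^sup>2 * (t ^ 0 * \<eta> t)) \<longlongrightarrow> C\<^sup>2 * 0) at_top" by (intro tendsto_intros rapid)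
  then have "\<forall>\<^sub>F t in at_top. C\<^sup>2 * (t ^ 0 * \<eta> t) < exp (- 1)" by (intro order_tendstoD(2)) auto
  then obtain T where T: "\<And>t. t \<ge> T \<Longrightarrow> h t < exp (- 1)" unfolding eventually_at_top_linorder h_def by auto
  define t0 where "t0 = max T 1"
  have t0: "t0 \<ge> 1" "\<And>t. t \<ge> t0 \<Longrightarrow> h t \<le> exp (- 1)" using T by (auto simp: t0_def less_imp_le)
  have iter: "h t \<le> exp (- (2 ^ k))" if "M ^ k * t0 \<le> t" for t k
    using that
  proof (induction k arbitrary: t)
    case 0
    then show ?case using t0(2)[of t] by simp
  next
    case (Suc k)
    have "M ^ k * t0 \<le> t / M" using Suc.prems M2 by (simp add: field_simps)
    moreover have "0 \<le> M ^ k * t0" using M2 t0 by simp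
    ultimately have t: "M ^ k * t0 \<le> t / M" "t / M \<ge> 0" by auto
    then have "t \<ge> 0" using M2 by (simp add: zero_le_divide_iff)
    then have "h t \<le> (h (t / M))\<^sup>2" by (rule step)
    also have "\<dots> \<le> (exp (- (2 ^ k)))\<^sup>2" using hpos[OF t(2)] Suc.IH[OF t(1)] by (intro power_mono) auto
    also have "\<dots> = exp (- (2 ^ Suc k))" by (simp add: power2_eq_square flip: exp_add)
    finally show ?case .
  qed
  define \<alpha> where "\<alpha> = log M 2"
  have \<alpha>: "\<alpha> > 0" using M2 by (simp add: \<alpha>_def)
  \<comment> \<open>The factor 1/2 pays for rounding log_M(t/t0) down, which loses at most one
    doubling.\<close>
  define b where "b = 1 / (2 * t0 powr \<alpha>)"
  have b: "b > 0" using t0 by (simp add: b_def)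
  \<comment> \<open>Below t0 one has b t^\<alpha> \<le> 1/2, so exp(1/2) compensates the decaying
    factor and h(0) bounds h there.\<close>
  define A where "A = 1 + h 0 * exp (1 / 2)"
  have A: "A \<ge> 1" "A > 0" using hpos[of 0] by (simp_all add: A_def add_pos_pos)
  have bound: "h t \<le> A * exp (- b * t powr \<alpha>)" if t: "t \<ge> 0" for t
  proof (cases "t < t0")
    case True
    have "t powr \<alpha> \<le> t0 powr \<alpha>" using t True \<alpha> by (intro powr_mono2) auto
    then have "b * t powr \<alpha> \<le> b * t0 powr \<alpha>" using b by simp
    also have "\<dots> = 1 / 2" using t0 by (simp add: b_def)
    finally have "exp 0 \<le> exp (1 / 2 + - b * t powr \<alpha>)" by simp
    then have 1: "1 \<le> exp (1 / 2) * exp (- b * t powr \<alpha>)" unfolding exp_add by simp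
    have "h t \<le> h 0" using C decreasing[of 0 t] t by (simp add: h_def)
    also have "\<dots> \<le> h 0 * (exp (1 / 2) * exp (- b * t powr \<alpha>))" using 1 hpos[of 0] by simp
    also have "\<dots> \<le> A * exp (- b * t powr \<alpha>)" by (simp add: A_def algebra_simps)
    finally show ?thesis .
  next
    case False
    define x where "x = log M (t / t0)"
    define k where "k = nat \<lfloor>x\<rfloor>"
    have q: "t / t0 \<ge> 1" using False t0 by simp
    then have x0: "x \<ge> 0" using M2 by (simp add: x_def)
    have k: "real k \<le> x" "x - 1 \<le> real k" using x0 by (simp_all add: k_def)
    have "M ^ k = M powr real k" using M2 by (simp add: powr_realpow)
    also have "\<dots> \<le> M powr x" using k M2 by (intro powr_mono) auto
    also have "\<dots> = t / t0" using q M2 by (simp add: x_def)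
    finally have "M ^ k * t0 \<le> t" using t0 by (simp add: field_simps)
    then have "h t \<le> exp (- (2 ^ k))" by (rule iter)
    also have "b * t powr \<alpha> \<le> 2 ^ k"
    proof -
      have "b * t powr \<alpha> = (1 / 2) * (t / t0) powr \<alpha>" using t t0 by (simp add: b_def powr_divide)
      also have "(t / t0) powr \<alpha> = 2 powr x" using q M2 False t0(1) by (auto simp: powr_def \<alpha>_def x_def log_def)
      also have "(1 / 2) * 2 powr x = 2 powr (x - 1)" by (simp add: powr_diff)
      also have "\<dots> \<le> 2 powr real k" using k by (intro powr_mono) auto
      finally show ?thesis by (simp add: powr_realpow)
    qed
    then have "exp (- (2 ^ k)) \<le> exp (- b * t powr \<alpha>)" by simp
    also have "\<dots> \<le> A * exp (- b * t powr \<alpha>)" using A by simp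
    finally show ?thesis .
  qed
  have "\<eta> t \<le> (A / C\<^sup>2) * exp (- b * t powr \<alpha>)" if t: "t \<ge> 0" for t
    using bound[OF t] C by (simp add: h_def field_simps)
  then show ?thesis using \<alpha> b A C by (intro exI[of _ "A / C\<^sup>2"] exI[of _ b] exI[of _ \<alpha>]) simp
qed

end

section \<open>Homogeneous entire functions\<close>

lemma sum_apply: "(\<Sum>n\<in>A. y n) x = (\<Sum>n\<in>A. (y n x :: 'b::comm_monoid_add))"
  by (induction A rule: infinite_finite_induct) auto

lemma subspace_fun_scale_iff:
  "module.subspace fun_scale (S :: ('a \<Rightarrow> complex) set) \<longleftrightarrow>
     0 \<in> S \<and> (\<forall>f\<in>S. \<forall>g\<in>S. f + g \<in> S) \<and> (\<forall>c. \<forall>f\<in>S. fun_scale c f \<in> S)"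
proof -
  have "module (fun_scale :: complex \<Rightarrow> ('a \<Rightarrow> complex) \<Rightarrow> _)"
    by unfold_locales (auto simp: fun_scale_def algebra_simps)
  then show ?thesis by (rule module.subspace_def)
qed

lemma homogeneous_entire_growth:
  fixes P :: "'a::complex_banach \<Rightarrow> complex"
  assumes "entire_on_banach P" "homogeneous n P"
  shows "\<exists>C\<ge>0. \<forall>x. cmod (P x) \<le> C * norm x ^ n"
proof -
  obtain r M where r: "r > 0" "\<And>h. norm (h - 0) \<le> r \<Longrightarrow> cmod (P h) \<le> M"
    using assms(1) unfolding entire_on_banach_iff locally_bounded_def by meson
  have M: "M \<ge> 0" using r(2)[of 0] r(1) norm_ge_zero[of "P 0"] by (simp del: norm_ge_zero)
  have "cmod (P x) \<le> M / r ^ n * norm x ^ n" for x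
  proof (cases "x = 0")
    case True
    then show ?thesis
      using r(2)[of 0] r(1) assms(2)[unfolded homogeneous_def, rule_format, of 0 0] by (cases n) auto
  next
    case False
    define z where "z = (r / norm x) *\<^sub>R x"
    have "x = scaleC (of_real (norm x / r)) z"
      using False r(1) by (simp add: z_def scaleC_of_real del: of_real_divide)
    moreover have "P (scaleC (of_real (norm x / r)) z) = of_real (norm x / r) ^ n * P z"
      using assms(2) by (simp add: homogeneous_def)
    ultimately have "cmod (P x) = cmod (of_real (norm x / r) ^ n * P z)" by (simp only:)
    also have "\<dots> = (norm x / r) ^ n * cmod (P z)"
      using r(1) by (simp add: norm_mult norm_power norm_divide)
    also have "\<dots> \<le> (norm x / r) ^ n * M"
      using r(1) False by (intro mult_left_mono r(2)) (auto simp: z_def)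
    finally show ?thesis by (simp add: power_divide mult.commute)
  qed
  then show ?thesis using M r(1) by (intro exI[of _ "M / r ^ n"]) simp
qed

text \<open>A description of the spaces of weighted polynomials that does not mention the weights,
  so that the two families can share it; see \<open>weighted_polys_eq\<close>.\<close>

definition hom_entire :: "nat \<Rightarrow> ('a::complex_banach \<Rightarrow> complex) set" where
  "hom_entire n = {P. entire_on_banach P \<and> homogeneous n P}"

lemma hom_part_diff:
  assumes "entire_on_banach f" "entire_on_banach g"
  shows "hom_part n (f - g) = hom_part n f - hom_part n g"
proof
  fix x
  have "(\<lambda>k. (hom_part k f x - hom_part k g x) * z ^ k) sums (f - g) (scaleC z x)" for z
    using sums_diff[OF hom_part_sums_line[OF assms(1), of x z] hom_part_sums_line[OF assms(2), of x z]]
    by (simp add: left_diff_distrib)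
  from taylor_coeff_unique[OF this] show "hom_part n (f - g) x = (hom_part n f - hom_part n g) x"
    by (simp add: hom_part_def)
qed

section \<open>Weighted spaces of entire functions\<close>

text \<open>The properties shared by roots and dilations: \<open>radial\<close> makes Cauchy's
  estimates compatible with the seminorms, \<open>lower\<close> turns seminorm bounds into bounds on
  balls, and \<open>power\<close> puts every homogeneous entire function into the space.\<close>

locale radial_weights =
  fixes V :: "('a::complex_banach \<Rightarrow> real) set"
  assumes nonempty: "V \<noteq> {}"
    and radial: "\<And>v x y. v \<in> V \<Longrightarrow> norm x = norm y \<Longrightarrow> v x = v y"
    and lower: "\<And>v R. v \<in> V \<Longrightarrow> \<exists>d>0. \<forall>x. norm x \<le> R \<longrightarrow> d \<le> v x"
    and power: "\<And>v k. v \<in> V \<Longrightarrow> \<exists>D. \<forall>x. norm x ^ k * v x \<le> D"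
begin

lemma positive: "v \<in> V \<Longrightarrow> 0 < v x"
proof -
  assume "v \<in> V"
  from lower[OF this, of "norm x"] obtain d where "d > 0" "d \<le> v x" by blast
  then show "0 < v x" by simp
qed

lemma entire: "f \<in> weighted_space V \<Longrightarrow> entire_on_banach f"
  by (simp add: weighted_space_def)

lemma weighted_sup_upper: "f \<in> weighted_space V \<Longrightarrow> v \<in> V \<Longrightarrow> v x * cmod (f x) \<le> weighted_sup v f"
  unfolding weighted_sup_def by (rule cSUP_upper) (auto intro: weighted_spaceD)

lemma weighted_sup_least: "(\<And>x. v x * cmod (f x) \<le> B) \<Longrightarrow> weighted_sup v f \<le> B"
  unfolding weighted_sup_def by (rule cSUP_least) auto

lemma weighted_spaceI:
  "entire_on_banach f \<Longrightarrow> (\<And>v. v \<in> V \<Longrightarrow> \<exists>B. \<forall>x. v x * cmod (f x) \<le> B) \<Longrightarrow> f \<in> weighted_space V"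
  unfolding weighted_space_def bdd_above_def by blast

lemma weighted_sup_nonneg: "f \<in> weighted_space V \<Longrightarrow> v \<in> V \<Longrightarrow> 0 \<le> weighted_sup v f"
  using weighted_sup_upper[of f v 0] mult_nonneg_nonneg[OF less_imp_le[OF positive[of v 0]] norm_ge_zero[of "f 0"]]
  by linarith

lemma zero_in: "0 \<in> weighted_space V"
proof (rule weighted_spaceI)
  show "entire_on_banach (0 :: 'a \<Rightarrow> complex)" using entire_const[of 0] by (simp add: zero_fun_def)
qed auto

lemma weighted_sup_0: "weighted_sup v (0 :: 'a \<Rightarrow> complex) = 0"
  by (simp add: weighted_sup_def)

lemma add_bound:
  assumes "f \<in> weighted_space V" "g \<in> weighted_space V" "v \<in> V"
  shows "v x * cmod ((f + g) x) \<le> weighted_sup v f + weighted_sup v g"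
proof -
  have "v x * cmod ((f + g) x) \<le> v x * (cmod (f x) + cmod (g x))"
    using positive[OF assms(3), of x] norm_triangle_ineq[of "f x" "g x"] by (simp add: mult_left_mono)
  then show ?thesis
    using weighted_sup_upper[OF assms(1,3), of x] weighted_sup_upper[OF assms(2,3), of x]
    by (simp add: distrib_left)
qed

lemma add_in: "f \<in> weighted_space V \<Longrightarrow> g \<in> weighted_space V \<Longrightarrow> f + g \<in> weighted_space V"
proof (rule weighted_spaceI)
  assume f: "f \<in> weighted_space V" "g \<in> weighted_space V"
  show "entire_on_banach (f + g)" using entire_add[OF entire[OF f(1)] entire[OF f(2)]] by (simp add: plus_fun_def)
  show "\<exists>B. \<forall>x. v x * cmod ((f + g) x) \<le> B" if "v \<in> V" for v using add_bound[OF f that] by blast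
qed

lemma weighted_sup_add:
  "f \<in> weighted_space V \<Longrightarrow> g \<in> weighted_space V \<Longrightarrow> v \<in> V \<Longrightarrow> weighted_sup v (f + g) \<le> weighted_sup v f + weighted_sup v g"
  by (intro weighted_sup_least add_bound)

lemma weighted_sup_scale_bound:
  assumes "f \<in> weighted_space V" "v \<in> V"
  shows "v x * cmod (fun_scale c f x) \<le> cmod c * weighted_sup v f"
  using mult_left_mono[OF weighted_sup_upper[OF assms, of x], of "cmod c"]
  by (simp add: fun_scale_def norm_mult mult_ac)

lemma scale_in: "f \<in> weighted_space V \<Longrightarrow> fun_scale c f \<in> weighted_space V"
proof (rule weighted_spaceI)
  assume f: "f \<in> weighted_space V"
  show "entire_on_banach (fun_scale c f)" using entire_cmult entire[OF f] by (simp add: fun_scale_def)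
  show "\<exists>B. \<forall>x. v x * cmod (fun_scale c f x) \<le> B" if "v \<in> V" for v using weighted_sup_scale_bound[OF f that] by blast
qed

lemma weighted_sup_scale:
  assumes "f \<in> weighted_space V" "v \<in> V"
  shows "weighted_sup v (fun_scale c f) = cmod c * weighted_sup v f"
proof (cases "c = 0")
  case True
  then have "fun_scale c f = 0" by (simp add: fun_scale_def fun_eq_iff)
  then show ?thesis using True by (simp add: weighted_sup_0)
next
  case False
  have "fun_scale (1 / c) (fun_scale c f) = f" using False by (simp add: fun_scale_def fun_eq_iff)
  then have "weighted_sup v f \<le> cmod (1 / c) * weighted_sup v (fun_scale c f)"
    using weighted_sup_least[OF weighted_sup_scale_bound[OF scale_in[OF assms(1), of c] assms(2), of _ "1 / c"]]
    by simp
  then have "cmod c * weighted_sup v f \<le> weighted_sup v (fun_scale c f)"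
    using False by (simp add: norm_divide field_simps)
  moreover have "weighted_sup v (fun_scale c f) \<le> cmod c * weighted_sup v f"
    by (intro weighted_sup_least weighted_sup_scale_bound assms)
  ultimately show ?thesis by simp
qed

lemma diff_in: "f \<in> weighted_space V \<Longrightarrow> g \<in> weighted_space V \<Longrightarrow> f - g \<in> weighted_space V"
  using add_in[of f "fun_scale (-1) g"] scale_in[of g "-1"]
  by (simp add: fun_scale_def plus_fun_def fun_diff_def)

lemma sum_in: "(\<And>n. n \<in> A \<Longrightarrow> y n \<in> weighted_space V) \<Longrightarrow> (\<Sum>n\<in>A. y n) \<in> weighted_space V"
  by (induction A rule: infinite_finite_induct) (auto intro: zero_in add_in)

lemma weighted_sup_sum:
  assumes "v \<in> V" "\<And>n. n \<in> A \<Longrightarrow> y n \<in> weighted_space V"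
  shows "weighted_sup v (\<Sum>n\<in>A. y n) \<le> (\<Sum>n\<in>A. weighted_sup v (y n))"
  using assms(2)
proof (induction A rule: infinite_finite_induct)
  case (insert a A)
  have "weighted_sup v (y a + (\<Sum>n\<in>A. y n)) \<le> weighted_sup v (y a) + weighted_sup v (\<Sum>n\<in>A. y n)"
    using insert.prems by (intro weighted_sup_add sum_in assms(1)) auto
  moreover have "weighted_sup v (\<Sum>n\<in>A. y n) \<le> (\<Sum>n\<in>A. weighted_sup v (y n))"
    using insert by blast
  ultimately show ?case unfolding sum.insert[OF insert.hyps] by linarith
qed (simp_all add: weighted_sup_0)

lemma weighted_sup_eq_0:
  assumes "f \<in> weighted_space V" "v \<in> V"
  shows "weighted_sup v f = 0 \<longleftrightarrow> f = 0"
proof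
  assume 0: "weighted_sup v f = 0"
  have "f x = 0" for x
    using weighted_sup_upper[OF assms, of x] positive[OF assms(2), of x] 0
    by (simp add: mult_le_0_iff)
  then show "f = 0" by (simp add: fun_eq_iff)
qed (simp add: weighted_sup_0)

section \<open>Weighted convergence and Taylor parts\<close>

lemma topspace_weighted: "topspace (weighted_topology V) = weighted_space V"
proof -
  obtain v where v: "v \<in> V" using nonempty by blast
  have "h \<in> topspace (weighted_topology V)" if h: "h \<in> weighted_space V" for h
  proof -
    have "h \<in> {g \<in> weighted_space V. weighted_sup v (g - h) < 1}" using h by (simp add: weighted_sup_0)
    then show ?thesis unfolding weighted_topology_def topology_generated_by_topspace
      using h v zero_less_one by blast
  qed
  moreover have "topspace (weighted_topology V) \<subseteq> weighted_space V"
    unfolding weighted_topology_def topology_generated_by_topspace by blast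
  ultimately show ?thesis by blast
qed

lemma openin_ball:
  "v \<in> V \<Longrightarrow> f \<in> weighted_space V \<Longrightarrow> 0 < e \<Longrightarrow>
    openin (weighted_topology V) {g \<in> weighted_space V. weighted_sup v (g - f) < e}"
  unfolding weighted_topology_def by (rule topology_generated_by_Basis) blast

lemma weighted_sup_triangle:
  assumes "f \<in> weighted_space V" "g \<in> weighted_space V" "h \<in> weighted_space V" "v \<in> V"
  shows "weighted_sup v (f - h) \<le> weighted_sup v (f - g) + weighted_sup v (g - h)"
  using weighted_sup_add[OF diff_in[OF assms(1,2)] diff_in[OF assms(2,3)] assms(4)] by simp

text \<open>Subbasic balls may have any centre g, but one containing f also contains a ball about f,
  of radius e minus the distance from f to g. Induction over the generated topology extends this to
  all open sets.\<close>

lemma limitin_weighted_iff: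
  assumes s: "\<And>m. s m \<in> weighted_space V"
  shows "limitin (weighted_topology V) s f sequentially \<longleftrightarrow>
    f \<in> weighted_space V \<and> (\<forall>v\<in>V. (\<lambda>m. weighted_sup v (s m - f)) \<longlonglongrightarrow> 0)" (is "?L \<longleftrightarrow> ?R")
proof
  assume L: ?L
  then have f: "f \<in> weighted_space V" by (simp add: limitin_def topspace_weighted)
  moreover have "(\<lambda>m. weighted_sup v (s m - f)) \<longlonglongrightarrow> 0" if v: "v \<in> V" for v
  proof (rule order_tendstoI)
    fix a :: real assume "a < 0"
    then have "a < weighted_sup v (s m - f)" for m using weighted_sup_nonneg[OF diff_in[OF s f] v, of m] by simp
    then show "\<forall>\<^sub>F m in sequentially. a < weighted_sup v (s m - f)" by simp
  next
    fix a :: real assume "0 < a"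
    then have "openin (weighted_topology V) {g \<in> weighted_space V. weighted_sup v (g - f) < a}"
      "f \<in> {g \<in> weighted_space V. weighted_sup v (g - f) < a}"
      using openin_ball[OF v f] f by (simp_all add: weighted_sup_0)
    then have "\<forall>\<^sub>F m in sequentially. s m \<in> {g \<in> weighted_space V. weighted_sup v (g - f) < a}"
      using L unfolding limitin_def by blast
    then show "\<forall>\<^sub>F m in sequentially. weighted_sup v (s m - f) < a" by eventually_elim simp
  qed
  ultimately show ?R by blast
next
  assume R: ?R
  have "\<forall>\<^sub>F m in sequentially. s m \<in> U" if "openin (weighted_topology V) U" "f \<in> U" for U
    using that(1)[unfolded weighted_topology_def, THEN openin_topology_generated_by] that(2)
  proof induction
    case (Int a b)
    then show ?case by (simp add: eventually_conj_iff)
  next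
    case (UN K)
    then obtain k where k: "k \<in> K" "f \<in> k" by blast
    then have "\<forall>\<^sub>F m in sequentially. s m \<in> k" using UN by blast
    then show ?case by eventually_elim (use k in blast)
  next
    case (Basis U)
    then obtain v g e where U: "U = {h \<in> weighted_space V. weighted_sup v (h - g) < e}"
      and v: "v \<in> V" and g: "g \<in> weighted_space V" by blast
    have "weighted_sup v (f - g) < e" using Basis(2) U by blast
    then have "\<forall>\<^sub>F m in sequentially. weighted_sup v (s m - f) < e - weighted_sup v (f - g)"
      using R v by (intro order_tendstoD(2)[where y = 0]) auto
    then show ?case
    proof eventually_elim
      case (elim m)
      then show ?case using weighted_sup_triangle[OF s _ g v, of f m] R s U by auto
    qed
  qed simp
  then show ?L using R unfolding limitin_def topspace_weighted by blast
qed

lemma hom_entire_in: "P \<in> hom_entire n \<Longrightarrow> P \<in> weighted_space V"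
proof (rule weighted_spaceI)
  assume P: "P \<in> hom_entire n"
  then show "entire_on_banach P" by (simp add: hom_entire_def)
  obtain C where C: "C \<ge> 0" "\<And>x. cmod (P x) \<le> C * norm x ^ n"
    using homogeneous_entire_growth P unfolding hom_entire_def by blast
  show "\<exists>B. \<forall>x. v x * cmod (P x) \<le> B" if v: "v \<in> V" for v
  proof -
    obtain D where D: "\<And>x. norm x ^ n * v x \<le> D" using power[OF v] by blast
    have "v x * cmod (P x) \<le> C * D" for x
    proof -
      have "v x * cmod (P x) \<le> v x * (C * norm x ^ n)"
        using C(2) positive[OF v, of x] by (intro mult_left_mono) auto
      also have "\<dots> = C * (norm x ^ n * v x)" by simp
      also have "\<dots> \<le> C * D" using D C(1) by (intro mult_left_mono) auto
      finally show ?thesis .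
    qed
    then show ?thesis by blast
  qed
qed

lemma partial_sum_in:
  assumes "\<And>n. y n \<in> hom_entire n"
  shows "(\<Sum>n<m. y n) \<in> weighted_space V"
proof (rule sum_in)
  fix n show "y n \<in> weighted_space V" using assms by (rule hom_entire_in)
qed

text \<open>Membership in the weighted space supplies holomorphy in one direction; in the other,
  polynomial growth supplies membership and the polar form supplies the multilinear form.\<close>

lemma weighted_polys_eq: "weighted_polys V n = hom_entire n"
  unfolding weighted_polys_def
  using hom_entire_in entire continuous_homogeneous_polysI continuous_homogeneous_polysD
  unfolding hom_entire_def by blast

lemma hom_part_in:
  assumes f: "f \<in> weighted_space V"
  shows "hom_part n f \<in> hom_entire n"
proof -
  obtain v where v: "v \<in> V" using nonempty by blast
  have "\<exists>M. \<forall>x. norm x \<le> R \<longrightarrow> cmod (f x) \<le> M" for R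
  proof -
    obtain d where d: "d > 0" "\<And>x. norm x \<le> R \<Longrightarrow> d \<le> v x" using lower[OF v] by blast
    have "cmod (f x) \<le> weighted_sup v f / d" if "norm x \<le> R" for x
    proof -
      have "d * cmod (f x) \<le> v x * cmod (f x)" using d(2)[OF that] by (intro mult_right_mono) auto
      then have "cmod (f x) * d \<le> weighted_sup v f" using weighted_sup_upper[OF f v, of x] by (simp add: mult.commute)
      then show ?thesis using d(1) by (simp add: pos_le_divide_eq)
    qed
    then show ?thesis by blast
  qed
  then show ?thesis
    using hom_part_entire[OF entire[OF f]] hom_part_homogeneous[OF entire[OF f]] by (simp add: hom_entire_def)
qed

text \<open>The circle used in Cauchy's estimate at x lies on the sphere through x, where v is
  constant; hence no constant is lost.\<close>

lemma weighted_sup_hom_part: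
  assumes f: "f \<in> weighted_space V" and v: "v \<in> V"
  shows "weighted_sup v (hom_part n f) \<le> weighted_sup v f"
proof (rule weighted_sup_least)
  fix x :: 'a
  have "cmod (hom_part n f x) \<le> weighted_sup v f / v x"
  proof (rule hom_part_bound[OF entire[OF f]])
    fix u :: 'a assume "norm u = norm x"
    then have "v u = v x" by (rule radial[OF v])
    then show "cmod (f u) \<le> weighted_sup v f / v x"
      using weighted_sup_upper[OF f v, of u] positive[OF v, of x] by (simp add: pos_le_divide_eq mult.commute)
  qed
  then show "v x * cmod (hom_part n f x) \<le> weighted_sup v f"
    using positive[OF v, of x] by (simp add: pos_le_divide_eq mult.commute)
qed

lemma series_converges_weighted_iff:
  assumes y: "\<And>n. y n \<in> hom_entire n"
  shows "series_converges_to (weighted_topology V) y f \<longleftrightarrow>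
    f \<in> weighted_space V \<and> (\<forall>v\<in>V. (\<lambda>m. weighted_sup v ((\<Sum>n<m. y n) - f)) \<longlonglongrightarrow> 0)"
  unfolding series_converges_to_def by (rule limitin_weighted_iff) (rule partial_sum_in[OF y])

lemma series_converges_sums:
  assumes y: "\<And>n. y n \<in> hom_entire n" and c: "series_converges_to (weighted_topology V) y f"
  shows "(\<lambda>n. y n x) sums f x"
proof -
  obtain v where v: "v \<in> V" using nonempty by blast
  have f: "f \<in> weighted_space V" and l: "(\<lambda>m. weighted_sup v ((\<Sum>n<m. y n) - f)) \<longlonglongrightarrow> 0"
    using c v unfolding series_converges_weighted_iff[OF y] by auto
  have "(\<lambda>m. weighted_sup v ((\<Sum>n<m. y n) - f) / v x) \<longlonglongrightarrow> 0 / v x"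
    by (intro tendsto_intros l) (use positive[OF v, of x] in simp)
  then have "(\<lambda>m. weighted_sup v ((\<Sum>n<m. y n) - f) / v x) \<longlonglongrightarrow> 0" by simp
  then have "(\<lambda>m. (\<Sum>n<m. y n x) - f x) \<longlonglongrightarrow> 0"
  proof (rule Lim_null_comparison[rotated])
    have "cmod ((\<Sum>n<m. y n x) - f x) \<le> weighted_sup v ((\<Sum>n<m. y n) - f) / v x" for m
    proof -
      have "(\<Sum>n<m. y n) - f \<in> weighted_space V" by (rule diff_in[OF partial_sum_in[OF y] f])
      from weighted_sup_upper[OF this v, of x] show ?thesis
        using positive[OF v, of x] by (simp add: sum_apply pos_le_divide_eq mult.commute)
    qed
    then show "\<forall>\<^sub>F m in sequentially. cmod ((\<Sum>n<m. y n x) - f x) \<le> weighted_sup v ((\<Sum>n<m. y n) - f) / v x" by simp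
  qed
  then show ?thesis unfolding sums_def by (rule LIM_zero_cancel)
qed

text \<open>Weighted convergence implies pointwise convergence, so uniqueness of the expansion
  reduces to uniqueness of Taylor parts.\<close>

lemma series_converges_unique:
  assumes "\<And>n. y n \<in> hom_entire n" "series_converges_to (weighted_topology V) y f"
  shows "y n = hom_part n f"
  using hom_part_unique[of y f] series_converges_sums[OF assms] assms(1) by (simp add: hom_entire_def)

section \<open>Banach structure of the homogeneous parts and the Schauder decomposition\<close>

lemma subspace_hom_entire: "module.subspace fun_scale (hom_entire n :: ('a \<Rightarrow> complex) set)"
  unfolding subspace_fun_scale_iff
proof (intro conjI ballI allI)
  show "0 \<in> (hom_entire n :: ('a \<Rightarrow> complex) set)"
    using entire_const[of 0] by (simp add: hom_entire_def homogeneous_def zero_fun_def)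
  show "f + g \<in> hom_entire n" if "f \<in> hom_entire n" "g \<in> hom_entire n" for f g :: "'a \<Rightarrow> complex"
    using that entire_add[of f g] by (simp add: hom_entire_def homogeneous_def plus_fun_def distrib_left)
  show "fun_scale c f \<in> hom_entire n" if "f \<in> hom_entire n" for c and f :: "'a \<Rightarrow> complex"
    using that entire_cmult[of f c] by (simp add: hom_entire_def homogeneous_def fun_scale_def mult_ac)
qed

text \<open>Positivity of v makes the sequence pointwise Cauchy. The Cauchy condition gives
  v-uniform convergence, and the lower bound of v on balls makes it locally uniform, so the limit is
  entire; homogeneity passes to it pointwise.\<close>

lemma hom_entire_complete:
  assumes v: "v \<in> V" and s: "\<And>k. s k \<in> hom_entire n"
    and cau: "\<And>e. e > 0 \<Longrightarrow> \<exists>K. \<forall>j\<ge>K. \<forall>k\<ge>K. weighted_sup v (s j - s k) < e"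
  shows "\<exists>f\<in>hom_entire n. (\<lambda>k. weighted_sup v (s k - f)) \<longlonglongrightarrow> 0"
proof -
  have d: "s j - s k \<in> weighted_space V" for j k by (rule diff_in[OF hom_entire_in[OF s] hom_entire_in[OF s]])
  have pt: "v x * cmod (s j x - s k x) \<le> weighted_sup v (s j - s k)" for x j k
    using weighted_sup_upper[OF d v] by simp
  have "Cauchy (\<lambda>k. s k x)" for x
  proof (rule metric_CauchyI)
    fix e :: real assume "0 < e"
    then have "e * v x > 0" using positive[OF v] by simp
    then obtain K where K: "\<And>j k. j \<ge> K \<Longrightarrow> k \<ge> K \<Longrightarrow> weighted_sup v (s j - s k) < e * v x" using cau by meson
    have "dist (s j x) (s k x) < e" if "j \<ge> K" "k \<ge> K" for j k
    proof -
      have "cmod (s j x - s k x) * v x < e * v x" using pt[of x j k] K[OF that] by (simp add: mult.commute)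
      then show ?thesis using positive[OF v, of x] by (simp add: dist_norm)
    qed
    then show "\<exists>M. \<forall>m\<ge>M. \<forall>n\<ge>M. dist (s m x) (s n x) < e" by blast
  qed
  then have "\<exists>l. (\<lambda>k. s k x) \<longlonglongrightarrow> l" for x using Cauchy_convergent convergent_def by blast
  then obtain f where f: "\<And>x. (\<lambda>k. s k x) \<longlonglongrightarrow> f x" by metis
  have unif: "\<exists>K. \<forall>k\<ge>K. \<forall>x. v x * cmod (s k x - f x) \<le> e" if e: "e > 0" for e
  proof -
    obtain K where K: "\<And>j k. j \<ge> K \<Longrightarrow> k \<ge> K \<Longrightarrow> weighted_sup v (s j - s k) < e" using cau[OF e] by meson
    have "v x * cmod (s k x - f x) \<le> e" if k: "k \<ge> K" for k x
    proof (rule LIMSEQ_le_const2)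
      show "(\<lambda>j. v x * cmod (s k x - s j x)) \<longlonglongrightarrow> v x * cmod (s k x - f x)" by (intro tendsto_intros f)
      show "\<exists>N. \<forall>j\<ge>N. v x * cmod (s k x - s j x) \<le> e"
        using K[OF k] pt[of x k] by (meson less_imp_le order_trans)
    qed
    then show ?thesis by blast
  qed
  have "entire_on_banach f"
  proof (rule entire_on_banach_locally_uniform_limit)
    show "entire_on_banach (s k)" for k using s by (simp add: hom_entire_def)
    fix x :: 'a
    obtain d where d: "d > 0" "\<And>y. norm y \<le> norm x + 1 \<Longrightarrow> d \<le> v y" using lower[OF v] by blast
    have "uniform_limit (cball x 1) s f sequentially"
    proof (rule uniform_limitI)
      fix e :: real assume e: "e > 0"
      then have "d * (e / 2) > 0" using d by simp
      from unif[OF this] obtain K where K: "\<And>k y. k \<ge> K \<Longrightarrow> v y * cmod (s k y - f y) \<le> d * (e / 2)" by blast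
      have "dist (s k y) (f y) < e" if "k \<ge> K" "y \<in> cball x 1" for k y
      proof -
        have "norm y \<le> norm x + 1" using that(2) norm_triangle_sub[of y x] by (simp add: dist_norm norm_minus_commute)
        then have "d * cmod (s k y - f y) \<le> v y * cmod (s k y - f y)" using d(2) by (intro mult_right_mono) auto
        also have "\<dots> \<le> d * (e / 2)" by (rule K[OF that(1)])
        finally have "cmod (s k y - f y) \<le> e / 2" using d(1) by simp
        then show ?thesis using e by (simp add: dist_norm)
      qed
      then show "\<forall>\<^sub>F k in sequentially. \<forall>y\<in>cball x 1. dist (s k y) (f y) < e"
        unfolding eventually_sequentially by blast
    qed
    then show "\<exists>r>0. uniform_limit (cball x r) s f sequentially" using zero_less_one by blast
  qed
  moreover have "homogeneous n f" unfolding homogeneous_def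
  proof (intro allI)
    fix c x
    have "(\<lambda>k. s k (scaleC c x)) \<longlonglongrightarrow> c ^ n * f x"
      using tendsto_mult_left[OF f[of x], of "c ^ n"] s unfolding hom_entire_def homogeneous_def by simp
    then show "f (scaleC c x) = c ^ n * f x" using f LIMSEQ_unique by blast
  qed
  ultimately have fh: "f \<in> hom_entire n" by (simp add: hom_entire_def)
  have "(\<lambda>k. weighted_sup v (s k - f)) \<longlonglongrightarrow> 0"
  proof (rule LIMSEQ_I)
    fix e :: real assume e: "e > 0"
    then obtain K where K: "\<And>k x. k \<ge> K \<Longrightarrow> v x * cmod (s k x - f x) \<le> e / 2" using unif[of "e / 2"] by auto
    have "norm (weighted_sup v (s k - f) - 0) < e" if "k \<ge> K" for k
    proof -
      have "weighted_sup v (s k - f) \<le> e / 2" using K[OF that] by (intro weighted_sup_least) simp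
      moreover have "0 \<le> weighted_sup v (s k - f)"
        by (intro weighted_sup_nonneg diff_in v hom_entire_in[OF s] hom_entire_in[OF fh])
      ultimately show ?thesis using e by simp
    qed
    then show "\<exists>K. \<forall>k\<ge>K. norm (weighted_sup v (s k - f) - 0) < e" by blast
  qed
  with fh show ?thesis by blast
qed

lemma banach_hom_entire:
  assumes v: "v \<in> V"
  shows "banach_space_with_norm (hom_entire n) (weighted_sup v)"
  unfolding banach_space_with_norm_def
proof (intro conjI ballI allI impI)
  show "module.subspace fun_scale (hom_entire n :: ('a \<Rightarrow> complex) set)" by (rule subspace_hom_entire)
qed (use v hom_entire_in hom_entire_complete[OF v] in
    \<open>auto simp: weighted_sup_nonneg weighted_sup_eq_0 weighted_sup_scale intro: weighted_sup_add\<close>)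

text \<open>Each Taylor projection is contractive in every seminorm, so the sum up to m is Lipschitz
  with constant m+1.\<close>

lemma continuous_map_partial_sum:
  "continuous_map (weighted_topology V) (weighted_topology V) (\<lambda>f. \<Sum>n\<le>m. hom_part n f)"
    (is "continuous_map _ _ ?Q")
proof -
  have Qin: "?Q f \<in> weighted_space V" if "f \<in> weighted_space V" for f
    by (intro sum_in hom_entire_in[OF hom_part_in[OF that]])
  have Qd: "weighted_sup v (?Q f - ?Q g) \<le> real (Suc m) * weighted_sup v (f - g)"
    if f: "f \<in> weighted_space V" and g: "g \<in> weighted_space V" and v: "v \<in> V" for f g v
  proof -
    have e: "?Q f - ?Q g = (\<Sum>n\<le>m. hom_part n (f - g))"
      using hom_part_diff[OF entire[OF f] entire[OF g]] by (simp add: sum_subtractf)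
    have "weighted_sup v (?Q f - ?Q g) \<le> (\<Sum>n\<le>m. weighted_sup v (hom_part n (f - g)))"
      unfolding e by (intro weighted_sup_sum v hom_entire_in[OF hom_part_in] diff_in f g)
    also have "\<dots> \<le> (\<Sum>n\<le>m. weighted_sup v (f - g))"
      by (intro sum_mono weighted_sup_hom_part v diff_in f g)
    finally show ?thesis by simp
  qed
  have "continuous_map (weighted_topology V) (topology_generated_by
     {{g \<in> weighted_space V. weighted_sup v (g - f) < e} | v f e. v \<in> V \<and> f \<in> weighted_space V \<and> 0 < e}) ?Q"
  proof (rule continuous_on_generated_topo)
    fix U assume "U \<in> {{g \<in> weighted_space V. weighted_sup v (g - f) < e} | v f e. v \<in> V \<and> f \<in> weighted_space V \<and> 0 < e}"
    then obtain v g e where U: "U = {h \<in> weighted_space V. weighted_sup v (h - g) < e}"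
      and v: "v \<in> V" and g: "g \<in> weighted_space V" by blast
    show "openin (weighted_topology V) (?Q -` U \<inter> topspace (weighted_topology V))"
    proof (subst openin_subopen, intro ballI)
      fix f assume "f \<in> ?Q -` U \<inter> topspace (weighted_topology V)"
      then have f: "f \<in> weighted_space V" "weighted_sup v (?Q f - g) < e" by (auto simp: U topspace_weighted)
      \<comment> \<open>The margin left inside the subbasic ball, divided by the Lipschitz
        constant.\<close>
      define d where "d = (e - weighted_sup v (?Q f - g)) / real (Suc m)"
      have d: "d > 0" using f(2) by (simp add: d_def)
      let ?B = "{h \<in> weighted_space V. weighted_sup v (h - f) < d}"
      have "h \<in> ?Q -` U \<inter> topspace (weighted_topology V)" if h: "h \<in> ?B" for h
      proof -
        have hV: "h \<in> weighted_space V" using h by blast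
        have "real (Suc m) * weighted_sup v (h - f) < real (Suc m) * d" using h by simp
        also have "\<dots> = e - weighted_sup v (?Q f - g)" by (simp add: d_def del: of_nat_Suc)
        finally have "weighted_sup v (?Q h - g) < e"
          using Qd[OF hV f(1) v] weighted_sup_triangle[OF Qin[OF hV] Qin[OF f(1)] g v] by linarith
        then show ?thesis using hV Qin[OF hV] by (simp add: U topspace_weighted)
      qed
      moreover have "f \<in> ?B" using f(1) d by (simp add: weighted_sup_0)
      ultimately show "\<exists>T. openin (weighted_topology V) T \<and> f \<in> T \<and> T \<subseteq> ?Q -` U \<inter> topspace (weighted_topology V)"
        using openin_ball[OF v f(1) d] by blast
    qed
  next
    have "topspace (weighted_topology V) = \<Union>{{g \<in> weighted_space V. weighted_sup v (g - f) < e} | v f e. v \<in> V \<and> f \<in> weighted_space V \<and> 0 < e}"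
      unfolding weighted_topology_def by (rule topology_generated_by_topspace)
    then show "?Q ` topspace (weighted_topology V) \<subseteq> \<Union>{{g \<in> weighted_space V. weighted_sup v (g - f) < e} | v f e. v \<in> V \<and> f \<in> weighted_space V \<and> 0 < e}"
      using Qin unfolding topspace_weighted by auto
  qed
  then show ?thesis unfolding weighted_topology_def .
qed

text \<open>Convergence of Taylor series is the only point at which the weights matter further: it
  identifies the \<open>THE\<close> with the sequence of Taylor parts, and the projections with the
  maps already known to be continuous.\<close>

lemma schauder_decomposition_hom_entire:
  assumes "\<And>f. f \<in> weighted_space V \<Longrightarrow> series_converges_to (weighted_topology V) (\<lambda>n. hom_part n f) f"
  shows "schauder_decomposition (weighted_topology V) hom_entire"
proof -
  have iff: "is_expansion (weighted_topology V) hom_entire f y \<longleftrightarrow> y = (\<lambda>n. hom_part n f)"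
    if f: "f \<in> weighted_space V" for f y
  proof
    assume "is_expansion (weighted_topology V) hom_entire f y"
    then have "y n = hom_part n f" for n
      unfolding is_expansion_def using series_converges_unique by blast
    then show "y = (\<lambda>n. hom_part n f)" by (rule ext)
  next
    assume "y = (\<lambda>n. hom_part n f)"
    then show "is_expansion (weighted_topology V) hom_entire f y"
      unfolding is_expansion_def using assms[OF f] hom_part_in[OF f] by simp
  qed
  have the: "(THE y. is_expansion (weighted_topology V) hom_entire f y) = (\<lambda>n. hom_part n f)"
    if "f \<in> weighted_space V" for f
    using iff[OF that] by simp
  have cont: "continuous_map (weighted_topology V) (weighted_topology V)
      (\<lambda>x. \<Sum>n\<le>m. (THE y. is_expansion (weighted_topology V) hom_entire x y) n)" for m
    by (rule continuous_map_eq[OF continuous_map_partial_sum]) (simp add: topspace_weighted the)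
  show ?thesis
    unfolding schauder_decomposition_def topspace_weighted
    using cont subspace_hom_entire hom_entire_in iff by auto
qed

end

section \<open>The decomposition theorem\<close>

text \<open>Geometric decay against the distinguished weight u m0, which is bounded below on balls,
  gives locally uniform convergence. Against the other weights the same decay is summed pointwise to
  estimate the tails.\<close>

lemma series_sum_exists:
  fixes y :: "nat \<Rightarrow> 'a::complex_banach \<Rightarrow> complex"
  assumes y: "\<And>n. entire_on_banach (y n)" and I: "m0 \<in> I"
    and u: "\<And>m x. m \<in> I \<Longrightarrow> 0 < u m x" "\<And>R. \<exists>d>0. \<forall>x. norm x \<le> R \<longrightarrow> d \<le> u m0 x"
    and b: "\<And>m. m \<in> I \<Longrightarrow> \<exists>C. \<forall>n x. u m x * cmod (y n x) \<le> C * (1/2) ^ n"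
  shows "\<exists>f. entire_on_banach f \<and> (\<forall>x. (\<lambda>n. y n x) sums f x) \<and>
    (\<forall>m\<in>I. \<exists>C. \<forall>M x. u m x * cmod (f x - (\<Sum>n<M. y n x)) \<le> C * (1/2) ^ M)"
proof -
  have bd: "cmod (y n x) \<le> C / u m x * (1/2) ^ n" if "m \<in> I" "\<And>n x. u m x * cmod (y n x) \<le> C * (1/2) ^ n" for m C n x
    using that(2)[of x n] u(1)[OF that(1), of x] by (simp add: field_simps)
  have geo: "(\<lambda>n. C * (1/2) ^ n) sums (2 * C)" for C :: real
    using sums_mult[OF geometric_sums[of "1/2::real"], of C] by (simp add: mult.commute)
  obtain C0 where C0: "\<And>n x. u m0 x * cmod (y n x) \<le> C0 * (1/2) ^ n" using b[OF I] by blast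
  have summ: "summable (\<lambda>n. y n x)" for x
    by (rule summable_comparison_test'[OF sums_summable[OF geo[of "C0 / u m0 x"]], of 0]) (use bd[OF I C0] in auto)
  define f where "f x = (\<Sum>n. y n x)" for x
  have fs: "(\<lambda>n. y n x) sums f x" for x unfolding f_def by (rule summable_sums[OF summ])
  have "entire_on_banach f"
  proof (rule entire_on_banach_locally_uniform_limit)
    show "entire_on_banach (\<lambda>x. \<Sum>n<M. y n x)" for M by (intro entire_sum y)
    fix x :: 'a
    obtain d where d: "d > 0" "\<And>z. norm z \<le> norm x + 1 \<Longrightarrow> d \<le> u m0 z" using u(2) by blast
    have "0 \<le> u m0 x * cmod (y 0 x)" using u(1)[OF I, of x] by simp
    then have C00: "C0 \<ge> 0" using C0[of x 0] by simp
    have "uniform_limit (cball x 1) (\<lambda>M z. \<Sum>n<M. y n z) f sequentially"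
      unfolding f_def
    proof (rule Weierstrass_m_test[OF _ sums_summable[OF geo[of "C0 / d"]]])
      fix n z assume "z \<in> cball x 1"
      then have "norm z \<le> norm x + 1" using norm_triangle_sub[of z x] by (simp add: dist_norm norm_minus_commute)
      then have "C0 / u m0 z \<le> C0 / d" using d C00 u(1)[OF I, of z] by (intro divide_left_mono) auto
      then have "C0 / u m0 z * (1/2) ^ n \<le> C0 / d * (1/2) ^ n" by (rule mult_right_mono) simp
      then show "cmod (y n z) \<le> C0 / d * (1/2) ^ n" using bd[OF I C0, of n z] by linarith
    qed
    then show "\<exists>r>0. uniform_limit (cball x r) (\<lambda>M z. \<Sum>n<M. y n z) f sequentially"
      using zero_less_one by blast
  qed
  moreover have "\<exists>C. \<forall>M x. u m x * cmod (f x - (\<Sum>n<M. y n x)) \<le> C * (1/2) ^ M" if m: "m \<in> I" for m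
  proof -
    obtain C where C: "\<And>n x. u m x * cmod (y n x) \<le> C * (1/2) ^ n" using b[OF m] by blast
    have "u m x * cmod (f x - (\<Sum>n<M. y n x)) \<le> 2 * C * (1/2) ^ M" for M x
    proof -
      have "cmod (f x - (\<Sum>n<M. y n x)) \<le> 2 * (C / u m x * (1/2) ^ M)"
      proof (rule norm_sums_le[OF sums_split_initial_segment[OF fs] geo])
        show "cmod (y (n + M) x) \<le> C / u m x * (1/2) ^ M * (1/2) ^ n" for n
          using bd[OF m C, of "n + M" x] by (simp add: power_add mult_ac)
      qed
      then show ?thesis using u(1)[OF m, of x] by (simp add: field_simps)
    qed
    then show ?thesis by blast
  qed
  ultimately show ?thesis using fs by blast
qed

section \<open>Taylor norms, dilated weights and the main equivalence\<close>

context weight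
begin

lemma radial_weights_root: "radial_weights (root_weights \<eta> :: ('a::complex_banach \<Rightarrow> real) set)"
proof
  show "root_weights \<eta> \<noteq> ({} :: ('a \<Rightarrow> real) set)" by (simp add: root_weights_range)
  fix v :: "'a \<Rightarrow> real" assume "v \<in> root_weights \<eta>"
  then obtain n where n: "v = (\<lambda>x. root n (\<eta> (norm x)))" "n \<ge> 1" by (auto simp: root_weights_def)
  show "v x = v y" if "norm x = norm y" for x y using that n by simp
  show "\<exists>d>0. \<forall>x. norm x \<le> R \<longrightarrow> d \<le> v x" for R
    by (rule exI[of _ "root n (\<eta> \<bar>R\<bar>)"]) (use n pos decreasing in auto)
  show "\<exists>D. \<forall>x. norm x ^ k * v x \<le> D" for k
  proof -
    obtain D where "\<And>t. t \<ge> 0 \<Longrightarrow> t ^ k * root n (\<eta> t) \<le> D" using root_power_bound[of n k] n(2) by auto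
    then have "norm x ^ k * v x \<le> D" for x unfolding n(1) by simp
    then show ?thesis by blast
  qed
qed

lemma radial_weights_dilated: "radial_weights (dilated_weights \<eta> :: ('a::complex_banach \<Rightarrow> real) set)"
proof
  show "dilated_weights \<eta> \<noteq> ({} :: ('a \<Rightarrow> real) set)" by (simp add: dilated_weights_range)
  fix v :: "'a \<Rightarrow> real" assume "v \<in> dilated_weights \<eta>"
  then obtain n where n: "v = (\<lambda>x. \<eta> (norm x / real n))" "n \<ge> 1" by (auto simp: dilated_weights_def)
  show "v x = v y" if "norm x = norm y" for x y using that n by simp
  have "norm x / real n \<le> \<bar>R\<bar> / real n" if "norm x \<le> R" for R and x :: 'a
    using that by (intro divide_right_mono) auto
  then show "\<exists>d>0. \<forall>x. norm x \<le> R \<longrightarrow> d \<le> v x" for R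
    by (intro exI[of _ "\<eta> (\<bar>R\<bar> / real n)"]) (use n pos decreasing in auto)
  show "\<exists>D. \<forall>x. norm x ^ k * v x \<le> D" for k
  proof -
    obtain D where "\<And>t. t \<ge> 0 \<Longrightarrow> t ^ k * \<eta> (t / real n) \<le> D" using dilated_power_bound[of n k] n(2) by auto
    then have "norm x ^ k * v x \<le> D" for x unfolding n(1) by simp
    then show ?thesis by blast
  qed
qed

text \<open>The norm for the first weight, which is common to both families: v_1 = w_1.\<close>

abbreviation (input) base_norm :: "('a::complex_banach \<Rightarrow> complex) \<Rightarrow> real" where
  "base_norm \<equiv> weighted_sup (\<lambda>x. \<eta> (norm x))"

lemma base_in_root: "(\<lambda>x::'a::complex_banach. \<eta> (norm x)) \<in> root_weights \<eta>"
  unfolding root_weights_def by (intro CollectI exI[of _ 1]) simp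

text \<open>By homogeneity the dilation by m costs the factor m^n. Eventually the norms are below
  (2m)^-n, which pays for it and leaves 2^-n.\<close>

lemma coeff_bound_of_root_limit:
  fixes y :: "nat \<Rightarrow> 'a::complex_banach \<Rightarrow> complex"
  assumes y: "\<And>n. y n \<in> hom_entire n" and lim: "(\<lambda>n. root n (base_norm (y n))) \<longlonglongrightarrow> 0" and m: "m \<ge> 1"
  shows "\<exists>C. \<forall>n x. \<eta> (norm x / real m) * cmod (y n x) \<le> C * (1/2) ^ n"
proof -
  interpret V: radial_weights "root_weights \<eta> :: ('a \<Rightarrow> real) set" by (rule radial_weights_root)
  have nn: "base_norm (y n) \<ge> 0" for n by (intro V.weighted_sup_nonneg V.hom_entire_in[OF y] base_in_root)
  have scaled: "\<eta> (norm x / real m) * cmod (y n x) \<le> real m ^ n * base_norm (y n)" for n x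
  proof -
    define z where "z = (1 / real m) *\<^sub>R x"
    have "x = scaleC (of_nat m) z" using m scaleC_of_real[of "real m" z] by (simp add: z_def)
    moreover have "y n (scaleC (of_nat m) z) = of_nat m ^ n * y n z"
      using y[of n] by (simp add: hom_entire_def homogeneous_def)
    ultimately have "y n x = of_nat m ^ n * y n z" by (simp only:)
    then have "\<eta> (norm x / real m) * cmod (y n x) = real m ^ n * (\<eta> (norm z) * cmod (y n z))"
      by (simp add: norm_mult norm_power z_def)
    also have "\<dots> \<le> real m ^ n * base_norm (y n)"
      by (intro mult_left_mono V.weighted_sup_upper[OF V.hom_entire_in[OF y] base_in_root]) auto
    finally show ?thesis .
  qed
  have "\<forall>\<^sub>F n in sequentially. root n (base_norm (y n)) < 1 / (2 * real m)"
    using m by (intro order_tendstoD(2)[OF lim]) auto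
  then obtain n0 where n0: "\<And>n. n \<ge> n0 \<Longrightarrow> root n (base_norm (y n)) < 1 / (2 * real m)"
    unfolding eventually_sequentially by blast
  define a where "a n = (2 * real m) ^ n * base_norm (y n)" for n
  have a0: "a n \<ge> 0" for n using nn[of n] by (simp add: a_def)
  \<comment> \<open>The finitely many early degrees are summed into C. They include n = 0, where
    \<open>root 0\<close> is 0 by convention and carries no information.\<close>
  define C where "C = 1 + (\<Sum>n\<le>n0. a n)"
  have aC: "a n \<le> C" for n
  proof (cases "n \<le> n0")
    case True
    then have "a n \<le> (\<Sum>n\<le>n0. a n)" using a0 by (intro member_le_sum) auto
    then show ?thesis by (simp add: C_def)
  next
    case False
    then have "base_norm (y n) = root n (base_norm (y n)) ^ n" using nn by simp
    also have "\<dots> \<le> (1 / (2 * real m)) ^ n" using False n0[of n] nn[of n] by (intro power_mono) auto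
    finally have "a n \<le> (2 * real m) ^ n * (1 / (2 * real m)) ^ n" unfolding a_def by (intro mult_left_mono) auto
    also have "\<dots> = (2 * real m * (1 / (2 * real m))) ^ n" by (simp only: power_mult_distrib)
    also have "2 * real m * (1 / (2 * real m)) = 1" using m by simp
    finally have "a n \<le> 1" by simp
    moreover have "0 \<le> (\<Sum>n\<le>n0. a n)" using a0 by (intro sum_nonneg) auto
    ultimately show ?thesis by (simp add: C_def)
  qed
  have "\<eta> (norm x / real m) * cmod (y n x) \<le> C * (1/2) ^ n" for n x
  proof -
    have "real m ^ n * base_norm (y n) = a n * (1/2) ^ n"
      by (simp add: a_def power_mult_distrib power_one_over)
    also have "\<dots> \<le> C * (1/2) ^ n" using aC by (intro mult_right_mono) auto
    finally show ?thesis using scaled[of x n] by linarith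
  qed
  then show ?thesis by blast
qed

text \<open>The seminorm of the dilation by m bounds the n-th Taylor part, and homogeneity turns
  this into a base norm of at most C m^-n. The n-th root of C tends to 1, so the roots are
  eventually below 2/m, for every m.\<close>

lemma root_limit_of_dilated:
  fixes f :: "'a::complex_banach \<Rightarrow> complex"
  assumes f: "f \<in> weighted_space (dilated_weights \<eta>)"
  shows "(\<lambda>n. root n (base_norm (hom_part n f))) \<longlonglongrightarrow> 0"
proof -
  interpret V: radial_weights "root_weights \<eta> :: ('a \<Rightarrow> real) set" by (rule radial_weights_root)
  interpret W: radial_weights "dilated_weights \<eta> :: ('a \<Rightarrow> real) set" by (rule radial_weights_dilated)
  note P = W.hom_part_in[OF f]
  have nn: "base_norm (hom_part n f) \<ge> 0" for n by (intro V.weighted_sup_nonneg V.hom_entire_in[OF P] base_in_root)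
  have ev: "\<forall>\<^sub>F n in sequentially. root n (base_norm (hom_part n f)) \<le> 2 / real m" if m: "m \<ge> 1" for m
  proof -
    let ?w = "\<lambda>x::'a. \<eta> (norm x / real m)"
    have w: "?w \<in> dilated_weights \<eta>" using m by (auto simp: dilated_weights_def)
    \<comment> \<open>The summand 1 makes C positive, so that its n-th roots tend to 1.\<close>
    define C where "C = weighted_sup ?w f + 1"
    have C: "C > 0" using W.weighted_sup_nonneg[OF f w] by (simp add: C_def)
    have le: "base_norm (hom_part n f) \<le> C * (1 / real m) ^ n" for n
    proof (rule V.weighted_sup_least)
      fix x :: 'a
      define z where "z = real m *\<^sub>R x"
      have "x = scaleC (of_real (1 / real m)) z" using m by (simp add: z_def scaleC_of_real del: of_real_divide)
      moreover have "hom_part n f (scaleC (of_real (1 / real m)) z) = of_real (1 / real m) ^ n * hom_part n f z"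
        using P[of n] by (simp add: hom_entire_def homogeneous_def)
      ultimately have "hom_part n f x = of_real (1 / real m) ^ n * hom_part n f z" by (simp only:)
      then have "cmod (hom_part n f x) = (1 / real m) ^ n * cmod (hom_part n f z)"
        by (simp add: norm_mult norm_power norm_divide)
      moreover have "\<eta> (norm x) = ?w z" using m by (simp add: z_def)
      ultimately have "\<eta> (norm x) * cmod (hom_part n f x) = (1 / real m) ^ n * (?w z * cmod (hom_part n f z))"
        by simp
      also have "\<dots> \<le> (1 / real m) ^ n * C"
        using W.weighted_sup_upper[OF W.hom_entire_in[OF P] w, of z n] W.weighted_sup_hom_part[OF f w, of n]
        by (intro mult_left_mono) (auto simp: C_def)
      finally show "\<eta> (norm x) * cmod (hom_part n f x) \<le> C * (1 / real m) ^ n" by (simp add: mult.commute)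
    qed
    have "\<forall>\<^sub>F n in sequentially. root n C < 2"
      by (intro order_tendstoD(2)[OF LIMSEQ_root_const[OF C]]) simp
    then show ?thesis using eventually_gt_at_top[of 0]
    proof eventually_elim
      case (elim n)
      have "root n (base_norm (hom_part n f)) \<le> root n (C * (1 / real m) ^ n)" using le elim by simp
      also have "\<dots> = root n C * (1 / real m)" using elim by (simp add: real_root_mult real_root_power_cancel)
      also have "\<dots> \<le> 2 * (1 / real m)" using elim by (intro mult_right_mono) auto
      finally show ?case by simp
    qed
  qed
  show ?thesis
  proof (rule order_tendstoI)
    fix a :: real assume "a < 0"
    then have "a < root n (base_norm (hom_part n f))" for n
      using real_root_ge_zero[OF nn, of n n] by linarith
    then show "\<forall>\<^sub>F n in sequentially. a < root n (base_norm (hom_part n f))" by simp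
  next
    fix a :: real assume a: "0 < a"
    obtain m where m: "2 / a < real m" using reals_Archimedean2 by blast
    then have "m \<ge> 1" using a by (cases m) (auto simp: field_simps)
    moreover have "2 / real m < a" using m a \<open>m \<ge> 1\<close> by (simp add: field_simps)
    ultimately show "\<forall>\<^sub>F n in sequentially. root n (base_norm (hom_part n f)) < a"
      using ev[of m] by (auto elim: eventually_mono)
  qed
qed

lemma dilated_sum_exists:
  fixes y :: "nat \<Rightarrow> 'a::complex_banach \<Rightarrow> complex"
  assumes y: "\<And>n. y n \<in> hom_entire n" and lim: "(\<lambda>n. root n (base_norm (y n))) \<longlonglongrightarrow> 0"
  shows "\<exists>f\<in>weighted_space (dilated_weights \<eta>). (\<forall>x. (\<lambda>n. y n x) sums f x) \<and>
    (\<forall>m\<ge>1. \<exists>C. \<forall>M x. \<eta> (norm x / real m) * cmod (f x - (\<Sum>n<M. y n x)) \<le> C * (1/2) ^ M)"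
proof -
  interpret W: radial_weights "dilated_weights \<eta> :: ('a \<Rightarrow> real) set" by (rule radial_weights_dilated)
  have w: "(\<lambda>x::'a. \<eta> (norm x / real m)) \<in> dilated_weights \<eta>" if "m \<ge> 1" for m
    using that by (auto simp: dilated_weights_def)
  have "\<exists>f. entire_on_banach f \<and> (\<forall>x. (\<lambda>n. y n x) sums f x) \<and>
    (\<forall>m\<in>{1..}. \<exists>C. \<forall>M x. \<eta> (norm x / real m) * cmod (f x - (\<Sum>n<M. y n x)) \<le> C * (1/2) ^ M)"
  proof (rule series_sum_exists[where ?m0.0 = 1])
    show "\<exists>d>0. \<forall>x::'a. norm x \<le> R \<longrightarrow> d \<le> \<eta> (norm x / real 1)" for R using W.lower[OF w[of 1]] by simp
    show "\<exists>C. \<forall>n x. \<eta> (norm x / real m) * cmod (y n x) \<le> C * (1/2) ^ n" if "m \<in> {1..}" for m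
      using coeff_bound_of_root_limit[OF y lim] that by simp
  qed (use y pos in \<open>auto simp: hom_entire_def\<close>)
  then obtain f where "entire_on_banach f \<and> (\<forall>x. (\<lambda>n. y n x) sums f x) \<and>
    (\<forall>m\<in>{1..}. \<exists>C. \<forall>M x. \<eta> (norm x / real m) * cmod (f x - (\<Sum>n<M. y n x)) \<le> C * (1/2) ^ M)" ..
  then have f: "entire_on_banach f" "\<And>x. (\<lambda>n. y n x) sums f x"
    "\<And>m. m \<ge> 1 \<Longrightarrow> \<exists>C. \<forall>M x. \<eta> (norm x / real m) * cmod (f x - (\<Sum>n<M. y n x)) \<le> C * (1/2) ^ M"
    by (simp_all only: atLeast_iff Ball_def)
  have "f \<in> weighted_space (dilated_weights \<eta>)"
  proof (rule W.weighted_spaceI[OF f(1)])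
    fix v :: "'a \<Rightarrow> real" assume "v \<in> dilated_weights \<eta>"
    then obtain m where m: "v = (\<lambda>x. \<eta> (norm x / real m))" "m \<ge> 1" by (auto simp: dilated_weights_def)
    obtain C where C: "\<And>M x. \<eta> (norm x / real m) * cmod (f x - (\<Sum>n<M. y n x)) \<le> C * (1/2) ^ M" using f(3)[OF m(2)] by blast
    \<comment> \<open>The tail estimate with M = 0, where the partial sum is empty.\<close>
    have "v x * cmod (f x) \<le> C" for x using C[of x 0] m(1) by simp
    then show "\<exists>B. \<forall>x. v x * cmod (f x) \<le> B" by blast
  qed
  then show ?thesis using f(2,3) by (intro bexI[of _ f] conjI allI impI)
qed

text \<open>Sums obtained in different spaces are identified pointwise throughout: convergence in
  either space forces pointwise convergence, and a pointwise sum is unique.\<close>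

lemma infinity_schauder_iff:
  fixes V W :: "('a::complex_banach \<Rightarrow> real) set"
  assumes nz: "\<exists>x::'a. x \<noteq> 0" and ess: "essential \<eta>"
    and V: "V = root_weights \<eta>" and W: "W = dilated_weights \<eta>"
  shows "infinity_schauder_decomposition (weighted_topology V) (weighted_polys V) (\<lambda>n. base_norm)
    \<longleftrightarrow> weighted_space V = weighted_space W" (is "?S \<longleftrightarrow> _")
proof -
  interpret V: radial_weights V unfolding V by (rule radial_weights_root)
  interpret W: radial_weights W unfolding W by (rule radial_weights_dilated)
  have polys: "weighted_polys V = hom_entire" by (rule ext) (rule V.weighted_polys_eq)
  have b: "(\<lambda>x. \<eta> (norm x)) \<in> V" unfolding V by (rule base_in_root)
  show ?thesis
  proof
    assume S: ?S
    note parts = S[unfolded infinity_schauder_decomposition_def polys]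
    have conv: "(\<exists>x. series_converges_to (weighted_topology V) y x) \<longleftrightarrow> (\<lambda>n. root n (base_norm (y n))) \<longlonglongrightarrow> 0"
      if "\<And>n. y n \<in> hom_entire n" for y
      using that by (intro conjunct2[OF conjunct2[OF parts], rule_format])
    show "weighted_space V = weighted_space W"
    proof (intro equalityI subsetI)
      fix f assume f: "f \<in> weighted_space V"
      then have "\<exists>y. is_expansion (weighted_topology V) hom_entire f y"
        using conjunct1[OF parts] unfolding schauder_decomposition_def V.topspace_weighted by (meson ex1_implies_ex)
      then obtain y where y: "\<And>n. y n \<in> hom_entire n" "series_converges_to (weighted_topology V) y f"
        unfolding is_expansion_def by blast
      then have "(\<lambda>n. root n (base_norm (y n))) \<longlonglongrightarrow> 0" using conv[of y] by blast
      then obtain g where g: "g \<in> weighted_space W" "\<And>x. (\<lambda>n. y n x) sums g x"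
        using dilated_sum_exists[OF y(1)] unfolding W by blast
      then have "f = g" using V.series_converges_sums[OF y] sums_unique2 by blast
      then show "f \<in> weighted_space W" using g by simp
    next
      fix f assume f: "f \<in> weighted_space W"
      note P = W.hom_part_in[OF f]
      have "(\<lambda>n. root n (base_norm (hom_part n f))) \<longlonglongrightarrow> 0"
        using root_limit_of_dilated f unfolding W by blast
      then obtain g where g: "series_converges_to (weighted_topology V) (\<lambda>n. hom_part n f) g"
        using conv[of "\<lambda>n. hom_part n f", OF P] by blast
      then have "f = g"
        using V.series_converges_sums[OF P g] hom_part_sums[OF W.entire[OF f]] sums_unique2 by blast
      then show "f \<in> weighted_space V" using g P by (simp add: V.series_converges_weighted_iff)
    qed
  next
    assume eq: "weighted_space V = weighted_space W"
    \<comment> \<open>The sum exists in HW(X) with geometric tails against every dilation;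
      domination of the roots by dilations makes it the limit in the topology of
      \<open>V\<close>.\<close>
    have L1: "\<exists>f. series_converges_to (weighted_topology V) y f"
      if y: "\<And>n. y n \<in> hom_entire n" and lim: "(\<lambda>n. root n (base_norm (y n))) \<longlonglongrightarrow> 0" for y
    proof -
      obtain f where f: "f \<in> weighted_space V"
        "\<And>m. m \<ge> 1 \<Longrightarrow> \<exists>C. \<forall>M x. \<eta> (norm x / real m) * cmod (f x - (\<Sum>n<M. y n x)) \<le> C * (1/2) ^ M"
        using dilated_sum_exists[OF y lim] eq unfolding W by blast
      have "(\<lambda>M. weighted_sup v ((\<Sum>n<M. y n) - f)) \<longlonglongrightarrow> 0" if v: "v \<in> V" for v
      proof -
        obtain N where N: "v = (\<lambda>x. root N (\<eta> (norm x)))" "N \<ge> 1" using v unfolding V root_weights_def by blast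
        obtain m B where m: "m \<ge> 1" "\<And>t. t \<ge> 0 \<Longrightarrow> root N (\<eta> t) \<le> B * \<eta> (t / real m)"
          using root_dominated_by_dilation[OF nz ess N(2)] eq unfolding V W by blast
        obtain C where C: "\<And>M x. \<eta> (norm x / real m) * cmod (f x - (\<Sum>n<M. y n x)) \<le> C * (1/2) ^ M"
          using f(2)[OF m(1)] by blast
        have "0 < root N (\<eta> 0)" using N(2) pos[of 0] by simp
        also have "\<dots> \<le> B * \<eta> 0" using m(2)[of 0] by simp
        finally have B: "B > 0" using pos[of 0] by (simp add: zero_less_mult_iff)
        have le: "weighted_sup v ((\<Sum>n<M. y n) - f) \<le> B * C * (1/2) ^ M" for M
        proof (rule V.weighted_sup_least)
          fix x
          have "v x * cmod (((\<Sum>n<M. y n) - f) x) \<le> B * \<eta> (norm x / real m) * cmod (((\<Sum>n<M. y n) - f) x)"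
            unfolding N(1) by (intro mult_right_mono m) auto
          also have "\<dots> = B * (\<eta> (norm x / real m) * cmod (f x - (\<Sum>n<M. y n x)))"
            by (simp add: sum_apply norm_minus_commute)
          also have "\<dots> \<le> B * (C * (1/2) ^ M)" using B C by (intro mult_left_mono) auto
          finally show "v x * cmod (((\<Sum>n<M. y n) - f) x) \<le> B * C * (1/2) ^ M" by simp
        qed
        have nn: "0 \<le> weighted_sup v ((\<Sum>n<M. y n) - f)" for M
          by (intro V.weighted_sup_nonneg[OF _ v] V.diff_in V.partial_sum_in[OF y] f(1))
        have lim: "(\<lambda>M. B * C * (1/2::real) ^ M) \<longlonglongrightarrow> 0"
          by (intro tendsto_mult_right_zero LIMSEQ_realpow_zero) auto
        show ?thesis
          by (rule tendsto_sandwich[OF always_eventually always_eventually tendsto_const lim]) (use nn le in auto)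
      qed
      then show ?thesis using f(1) unfolding V.series_converges_weighted_iff[OF y] by blast
    qed
    \<comment> \<open>\<open>L1\<close> only yields some limit g of the Taylor series; it equals f
      because both are its pointwise sum.\<close>
    have L3: "series_converges_to (weighted_topology V) (\<lambda>n. hom_part n f) f" if f: "f \<in> weighted_space V" for f
    proof -
      note P = V.hom_part_in[OF f]
      have "(\<lambda>n. root n (base_norm (hom_part n f))) \<longlonglongrightarrow> 0"
        using root_limit_of_dilated f eq unfolding W by blast
      then obtain g where g: "series_converges_to (weighted_topology V) (\<lambda>n. hom_part n f) g"
        using L1[of "\<lambda>n. hom_part n f", OF P] by blast
      then have "f = g"
        using V.series_converges_sums[OF P g] hom_part_sums[OF V.entire[OF f]] sums_unique2 by blast
      then show ?thesis using g by simp
    qed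
    have L2: "(\<lambda>n. root n (base_norm (y n))) \<longlonglongrightarrow> 0"
      if y: "\<And>n. y n \<in> hom_entire n" and c: "series_converges_to (weighted_topology V) y f" for y f
    proof -
      have "f \<in> weighted_space (dilated_weights \<eta>)"
        using c eq unfolding V.series_converges_weighted_iff[OF y] W by blast
      from root_limit_of_dilated[OF this] show ?thesis
        using V.series_converges_unique[OF y c] by simp
    qed
    show ?S
      unfolding infinity_schauder_decomposition_def polys
    proof (intro conjI allI impI)
      show "schauder_decomposition (weighted_topology V) hom_entire"
        by (rule V.schauder_decomposition_hom_entire[OF L3])
      show "banach_space_with_norm (hom_entire n :: ('a \<Rightarrow> complex) set) base_norm" for n by (rule V.banach_hom_entire[OF b])
      fix y :: "nat \<Rightarrow> 'a \<Rightarrow> complex" assume "\<forall>n. y n \<in> hom_entire n"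
      then have y: "\<And>n. y n \<in> hom_entire n" ..
      show "(\<exists>x. series_converges_to (weighted_topology V) y x) \<longleftrightarrow> (\<lambda>n. root n (base_norm (y n))) \<longlonglongrightarrow> 0"
        using L1[OF y] L2[OF y] by (intro iffI) (elim exE)
    qed
  qed
qed

text \<open>The inclusions act separately: HV(X) in HW(X) gives the doubling condition and the lower
  bound, while HW(X) in HV(X), through domination of the square root, gives the upper bound.\<close>

lemma growth_bounds:
  assumes nz: "\<exists>x::'a::complex_banach. x \<noteq> 0" and ess: "essential \<eta>"
    and eq: "weighted_space (root_weights \<eta>) = (weighted_space (dilated_weights \<eta>) :: ('a \<Rightarrow> complex) set)"
  shows "\<exists>a1 a2 b1 b2 \<alpha>1 \<alpha>2 :: real.
           0 < a1 \<and> 0 < a2 \<and> 0 < b1 \<and> 0 < b2 \<and> 0 < \<alpha>1 \<and> 0 < \<alpha>2 \<and>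
           (\<forall>t\<ge>0. a1 * exp (- b1 * t powr \<alpha>1) \<le> \<eta> t \<and> \<eta> t \<le> a2 * exp (- b2 * t powr \<alpha>2))"
proof -
  obtain m C where "m \<ge> 1" "\<And>s. s \<ge> 0 \<Longrightarrow> - ln (\<eta> s) \<le> real m * (- ln (\<eta> (s / 2))) + C"
    using doubling_condition[OF nz ess] eq by blast
  from lower_growth[OF this] obtain a1 b1 \<alpha>1 where 1: "0 < a1" "0 < b1" "0 < \<alpha>1"
    "\<And>t. t \<ge> 0 \<Longrightarrow> a1 * exp (- b1 * t powr \<alpha>1) \<le> \<eta> t" by blast
  obtain m C where "m \<ge> 1" "\<And>t. t \<ge> 0 \<Longrightarrow> root 2 (\<eta> t) \<le> C * \<eta> (t / real m)"
    using root_dominated_by_dilation[OF nz ess, of 2] eq by auto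
  from upper_growth[OF this] obtain a2 b2 \<alpha>2 where 2: "0 < a2" "0 < b2" "0 < \<alpha>2"
    "\<And>t. t \<ge> 0 \<Longrightarrow> \<eta> t \<le> a2 * exp (- b2 * t powr \<alpha>2)" by blast
  show ?thesis
    by (rule exI[of _ a1], rule exI[of _ a2], rule exI[of _ b1], rule exI[of _ b2], rule exI[of _ \<alpha>1], rule exI[of _ \<alpha>2])
      (intro conjI allI impI 1 2)
qed

end

theorem proposition2p5:
  fixes \<eta> :: "real \<Rightarrow> real"
    and V W :: "('a::complex_banach \<Rightarrow> real) set"
  assumes nontrivial: "\<exists>x::'a. x \<noteq> 0"
    and pos: "\<forall>t\<ge>0. 0 < \<eta> t"
    and decreasing: "antimono_on {0..} \<eta>"
    and cont: "continuous_on {0..} \<eta>"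
    and rapid: "\<forall>k::nat. ((\<lambda>t. t ^ k * \<eta> t) \<longlongrightarrow> 0) at_top"
    and V_def: "V = root_weights \<eta>"
    and W_def: "W = dilated_weights \<eta>"
    and ess: "essential \<eta>"
  shows "(infinity_schauder_decomposition (weighted_topology V) (weighted_polys V)
            (\<lambda>n. weighted_sup (\<lambda>x. \<eta> (norm x)))
          \<longleftrightarrow> weighted_space V = weighted_space W)
    \<and> (weighted_space V = weighted_space W \<longrightarrow>
        (\<exists>a1 a2 b1 b2 \<alpha>1 \<alpha>2 :: real.
           0 < a1 \<and> 0 < a2 \<and> 0 < b1 \<and> 0 < b2 \<and> 0 < \<alpha>1 \<and> 0 < \<alpha>2 \<and>
           (\<forall>t\<ge>0. a1 * exp (- b1 * t powr \<alpha>1) \<le> \<eta> t \<and>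
                   \<eta> t \<le> a2 * exp (- b2 * t powr \<alpha>2))))"
proof -
  interpret weight \<eta>
    by unfold_locales (use pos decreasing rapid in \<open>auto simp: monotone_on_def\<close>)
  show ?thesis
    using infinity_schauder_iff[OF nontrivial ess V_def W_def] growth_bounds[OF nontrivial ess]
    unfolding V_def W_def by (intro conjI impI)
qed

end
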